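(* Let $\{F_\delta\}_{\delta\in[0,1)}$ be an admissible $R(\delta)$-perturbation of $F=F_0$ satisfying (A1) and (A2), and let $\mu_0$ and $\mu_\delta$ be the unique invariant probability measures in $S^\infty$ of $F$ and $F_\delta$, respectively. Then there exist constants $D_2<0$ and $\bar\delta\in(0,1)$, $\bar\delta\le\delta_1$, such that for all $\delta\in[0,\bar\delta)$ $$\|\mu_\delta-\mu_0\|_\infty\le D_2\,R(\delta)\log\delta ,$$ where for $\delta=0$ the right-hand side is read as its limit value $0$.
   Context: **Base and skew product.** $A$ is an aperiodic $N\times N$ matrix with entries in $\{0,1\}$, $\Sigma_A^+=\{\underline x=(x_i)_{i\ge 0}: x_i\in\{1,\dots,N\},\ A_{x_i,x_{i+1}}=1\ \forall i\ge 0\}$, $\theta\in(0,1)$ is fixed, $d_\theta(\underline x,\underline y)=\sum_{i\ge0}\theta^i(1-\delta_{x_i,y_i})$ (Kronecker delta), $\sigma$ is the left shift and $m$ is a fixed $\sigma$-invariant Markov measure on $\Sigma_A^+$. For $\varphi:\Sigma_A^+\to\mathbb R$, $|\varphi|_\theta$ is its Lipschitz constant for $d_\theta$, $|\varphi|_\infty$ its sup norm, $\|\varphi\|_\theta=|\varphi|_\infty+|\varphi|_\theta$, and $\mathcal F_\theta(\Sigma_A^+)$ is the Banach space of functions with $|\varphi|_\theta<\infty$. $(K,d)$ is a compact metric space with $\operatorname{diam}K=1$, $\Sigma=\Sigma_A^+\times K$, and $\gamma_{\underline x}=\{\underline x\}\times K$. A skew product is $F(\underline x,z)=(\sigma(\underline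 x),G(\underline x,z))$ with $G:\Sigma\to K$ measurable. (G1) There is $0<\alpha<1$ such that for $m$-a.e. $\underline x$: $d(G(\underline x,y_1),G(\underline x,y_2))\le\alpha\, d(y_1,y_2)$ for all $y_1,y_2\in K$. (G2) For each $y\in K$ there is $k_y\ge0$ with $d(G(\underline x^1,y),G(\underline x^2,y))\le k_y d_\theta(\underline x^1,\underline x^2)$ for all $\underline x^1,\underline x^2$, and $H:=\sup_{y}k_y<\infty$. **Measures.** $\pi_1:\Sigma\to\Sigma_A^+$ is the projection and $\pi_1^*\mu$ the push-forward. $\mathcal{AB}_m$ is the set of finite signed Borel measures $\mu$ on $\Sigma$ with $\pi_1^*\mu^+\ll m$ and $\pi_1^*\mu^-\ll m$ (Jordan decomposition $\mu=\mu^+-\mu^-$). For a positive $\mu\in\mathcal{AB}_m$ let $(\{\mu_\gamma\},\phi_1 m)$ be its Rokhlin disintegration along the fibers $\gamma_{\underline x}$, with $\mu_\gamma$ probability measures on the fibers and $\phi_1=d(\pi_1^*\mu)/dm$. The restriction $\mu|_{\gamma}$, $\gamma=\gamma_{\underline x}$, is the measure on $K$ given by the push-forward of $\phi_1(\underline x)\mu_\gamma$ under $(\underline x,y)\mapsto y$; for signed $\mu$, $\mu|_\gamma=\mu^+|_\gamma-\mu^-|_\gamma$. For signed measures on $K$, $W_1^0(\mu,\nu)=\sup\{|\int g\,d\mu-\int g\,d\nu|: \operatorname{Lip}(g)\le1,\|g\|_\infty\le1\}$, $\|\mu\|_W=W_1^0(0,\mu)$. $\mathcal L^\infty=\{\mu\in\mathcal{AB}_m:\|\mu\|_\infty<\infty\}$,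 where $\|\mu\|_\infty=\operatorname{ess\,sup}_{\underline x}\|\mu|_{\gamma_{\underline x}}\|_W$ (ess sup with respect to $m$). $S^\infty=\{\mu\in\mathcal L^\infty:\phi_1\in\mathcal F_\theta(\Sigma_A^+)\}$, $\phi_1=d(\pi_1^*\mu)/dm$, with norm $\|\mu\|_{S^\infty}=\|\phi_1\|_\theta+\|\mu\|_\infty$. (It is known that a skew product $F(\underline x,z)=(\sigma(\underline x),G(\underline x,z))$ on $\Sigma=\Sigma_A^+\times K$, with $G:\Sigma\to K$ measurable, satisfying (G1) has a unique invariant probability measure in $S^\infty$.) **Admissible $R(\delta)$-perturbation.** A family $\{F_\delta\}_{\delta\in[0,1)}$, $F_0=F$, $F_\delta=(\sigma_\delta,G_\delta)$, each satisfying (G1) and (G2), and such that: (U1) There is $\delta_1>0$ such that for $\delta\in(0,\delta_1)$ the base system is $(\sigma,m_\delta)$, i.e. $\sigma_\delta=\sigma$, with $m_\delta$ a $\sigma$-invariant Markov measure defined by a probability vector $p_\delta=(p_{1,\delta},\dots,p_{N,\delta})$ ($m_0=m$). In particular the $i$-th preimage $i\underline x:=(i,x_0,x_1,\dots)$ of $\underline x$ does not depend on $\delta$. (U2) There is a function $\delta\mapsto R(\delta)\in\mathbb R^+$ with $\lim_{\delta\to0^+}R(\delta)\log\delta=0$ such that: (U2.1) with $J_{\sigma_\delta}$ the Jacobian of $(\sigma,m_\delta)$ and $g_\delta=1/J_{\sigma_\delta}$, $\sum_{i=1}^N|g_\delta(i\underline x)-g_0(i\underline x)|\le R(\delta)$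 for all $\underline x\in\Sigma_A^+$ (sum over admissible preimages); (U2.2) $d(G_0(\underline x,y),G_\delta(\underline x,y))\le R(\delta)$ for all $(\underline x,y)\in\Sigma$. (U3) For all $\delta\in[0,\delta_1)$, $m_\delta$ is equivalent to $m$, and $\sup_{\delta\in[0,\delta_1)}\|dm_\delta/dm\|_\infty<\infty$ ($L^\infty(m)$ norm). **Further standing assumptions on the family.** (A1) There are $B_3>0$, $0<\beta_3<1$ such that for all $u\in\mathcal F_\theta(\Sigma_A^+)$, all $\delta\in[0,\delta_1)$, $n\ge1$: $\|P_{\sigma_\delta}^nu\|_\theta\le B_3\beta_3^n\|u\|_\theta+B_3|u|_\infty$, where $P_{\sigma_\delta}$ is the Ruelle–Perron–Frobenius operator of $(\sigma,m_\delta)$. (A2) With $H_\delta$ the constant $H$ of (G2) for $G_\delta$ and $C_{1,\delta}=\max\{H_\delta\theta+\theta N|g_\delta|_\theta,2\}$, one has $\sup_\delta C_{1,\delta}<\infty$ (over $\delta\in[0,\delta_1)$). *)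

theory Defs
  imports "HOL-Probability.Probability"
begin

section \<open>The one-sided subshift of finite type\<close>

text \<open>The symbols are the elements of a finite type \<open>'n\<close>, so that \<open>N = CARD('n)\<close>.\<close>

definition mat_power :: "nat^'n^'n \<Rightarrow> nat \<Rightarrow> nat^'n^'n" where
  "mat_power A n = (((**) A) ^^ n) (mat 1)"

definition transition_matrix :: "nat^'n^'n \<Rightarrow> bool" where
  "transition_matrix A \<longleftrightarrow> (\<forall>i j. A $ i $ j \<in> {0, 1})"

definition aperiodic :: "nat^'n^'n \<Rightarrow> bool" where
  "aperiodic A \<longleftrightarrow> (\<exists>n\<ge>1. \<forall>i j. mat_power A n $ i $ j > 0)"

definition shift_space :: "nat^'n^'n \<Rightarrow> (nat \<Rightarrow> 'n) set" where
  "shift_space A = {x. \<forall>i. A $ (x i) $ (x (Suc i)) = 1}"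

definition shift :: "(nat \<Rightarrow> 'n) \<Rightarrow> nat \<Rightarrow> 'n" where
  "shift x = (\<lambda>i. x (Suc i))"

definition d_theta :: "real \<Rightarrow> (nat \<Rightarrow> 'n) \<Rightarrow> (nat \<Rightarrow> 'n) \<Rightarrow> real" where
  "d_theta \<theta> x y = (\<Sum>i. \<theta> ^ i * (1 - (if x i = y i then 1 else 0)))"

text \<open>The metric \<open>d_theta \<theta>\<close> induces the product of the discrete topologies. There are only
  countably many cylinders, so its Borel sets are generated by the coordinates.\<close>

definition shift_algebra :: "nat^'n^'n \<Rightarrow> (nat \<Rightarrow> 'n) measure" where
  "shift_algebra A = restrict_space (PiM UNIV (\<lambda>_. count_space UNIV)) (shift_space A)"

text \<open>Sup norm, Lipschitz constant and Lipschitz norm of a function on the shift space. They are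
  valued in \<^typ>\<open>ennreal\<close>, so that they are infinite, rather than junk values, for functions that
  are not bounded or not Lipschitz. The diagonal \<open>x = y\<close> contributes \<open>0 / 0 = 0\<close>.\<close>

definition sup_norm :: "nat^'n^'n \<Rightarrow> ((nat \<Rightarrow> 'n) \<Rightarrow> real) \<Rightarrow> ennreal" where
  "sup_norm A u = (SUP x\<in>shift_space A. ennreal \<bar>u x\<bar>)"

definition lip_theta :: "real \<Rightarrow> nat^'n^'n \<Rightarrow> ((nat \<Rightarrow> 'n) \<Rightarrow> real) \<Rightarrow> ennreal" where
  "lip_theta \<theta> A u =
     (SUP x\<in>shift_space A. SUP y\<in>shift_space A. ennreal (\<bar>u x - u y\<bar> / d_theta \<theta> x y))"

definition norm_theta :: "real \<Rightarrow> nat^'n^'n \<Rightarrow> ((nat \<Rightarrow> 'n) \<Rightarrow> real) \<Rightarrow> ennreal" where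
  "norm_theta \<theta> A u = sup_norm A u + lip_theta \<theta> A u"

definition F_theta :: "real \<Rightarrow> nat^'n^'n \<Rightarrow> ((nat \<Rightarrow> 'n) \<Rightarrow> real) set" where
  "F_theta \<theta> A = {u. lip_theta \<theta> A u < \<infinity>}"

section \<open>Markov measures, Jacobians and transfer operators\<close>

text \<open>\<open>m\<close> is the Markov measure of the probability vector \<open>p\<close> and a stochastic matrix \<open>P\<close> whose
  positive entries are exactly the transitions allowed by \<open>A\<close>. Shift-invariance of \<open>m\<close> is
  the stationarity \<open>p v* P = p\<close>.\<close>

definition markov_measure ::
  "nat^'n^'n \<Rightarrow> real^'n \<Rightarrow> (nat \<Rightarrow> 'n) measure \<Rightarrow> bool" where
  "markov_measure A p m \<longleftrightarrow>
     (\<forall>i. 0 \<le> p $ i) \<and> (\<Sum>i\<in>UNIV. p $ i) = 1 \<and>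
     prob_space m \<and> sets m = sets (shift_algebra A) \<and>
     (\<exists>P :: real^'n^'n.
        (\<forall>i j. 0 \<le> P $ i $ j) \<and> (\<forall>i. (\<Sum>j\<in>UNIV. P $ i $ j) = 1) \<and>
        (\<forall>i j. 0 < P $ i $ j \<longleftrightarrow> A $ i $ j = 1) \<and>
        p v* P = p \<and>
        (\<forall>w n. measure m {x \<in> shift_space A. \<forall>k\<le>n. x k = w k} =
               p $ (w 0) * (\<Prod>k<n. P $ (w k) $ (w (Suc k)))))"

text \<open>A Jacobian is determined by the integral formula only up to null sets. Since a Markov measure
  has full support, continuity singles out one version, defined at every point.\<close>

definition is_jacobian ::
  "real \<Rightarrow> nat^'n^'n \<Rightarrow> (nat \<Rightarrow> 'n) measure \<Rightarrow> ((nat \<Rightarrow> 'n) \<Rightarrow> real) \<Rightarrow> bool" where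
  "is_jacobian \<theta> A m J \<longleftrightarrow>
     J \<in> borel_measurable m \<and> (\<forall>x\<in>shift_space A. 0 \<le> J x) \<and>
     continuous_map (Metric_space.mtopology (shift_space A) (d_theta \<theta>)) euclideanreal J \<and>
     (\<forall>B\<in>sets m. inj_on shift B \<longrightarrow>
        emeasure m (shift ` B) = (\<integral>\<^sup>+x\<in>B. ennreal (J x) \<partial>m))"

text \<open>\<open>case_nat i x\<close> is the sequence \<open>(i, x\<^sub>0, x\<^sub>1, \<dots>)\<close>.\<close>

definition transfer_op ::
  "nat^'n^'n \<Rightarrow> ((nat \<Rightarrow> 'n) \<Rightarrow> real) \<Rightarrow> ((nat \<Rightarrow> 'n) \<Rightarrow> real) \<Rightarrow> (nat \<Rightarrow> 'n) \<Rightarrow> real" where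
  "transfer_op A g u x = (\<Sum>i | A $ i $ (x 0) = 1. g (case_nat i x) * u (case_nat i x))"

section \<open>Signed measures\<close>

text \<open>A finite signed measure is a real-valued set function; the positive measure \<open>\<mu>\<close> is
  the signed measure \<open>measure \<mu>\<close>. Only the \<open>\<sigma>\<close>-algebra of \<open>M\<close> matters here.\<close>

definition signed_measure :: "'a measure \<Rightarrow> ('a set \<Rightarrow> real) \<Rightarrow> bool" where
  "signed_measure M \<nu> \<longleftrightarrow>
     \<nu> {} = 0 \<and>
     (\<forall>E :: nat \<Rightarrow> 'a set. range E \<subseteq> sets M \<longrightarrow> disjoint_family E \<longrightarrow>
        (\<lambda>i. \<nu> (E i)) sums \<nu> (\<Union>i. E i))"

definition jordan_decomposition ::
  "'a measure \<Rightarrow> ('a set \<Rightarrow> real) \<Rightarrow> 'a measure \<Rightarrow> 'a measure \<Rightarrow> bool" where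
  "jordan_decomposition M \<nu> P Q \<longleftrightarrow>
     finite_measure P \<and> sets P = sets M \<and> finite_measure Q \<and> sets Q = sets M \<and>
     (\<exists>S\<in>sets M. emeasure P (space M - S) = 0 \<and> emeasure Q S = 0) \<and>
     (\<forall>E\<in>sets M. \<nu> E = measure P E - measure Q E)"

definition jordan_pos :: "'a measure \<Rightarrow> ('a set \<Rightarrow> real) \<Rightarrow> 'a measure" where
  "jordan_pos M \<nu> = (THE P. \<exists>Q. jordan_decomposition M \<nu> P Q)"

definition jordan_neg :: "'a measure \<Rightarrow> ('a set \<Rightarrow> real) \<Rightarrow> 'a measure" where
  "jordan_neg M \<nu> = (THE Q. \<exists>P. jordan_decomposition M \<nu> P Q)"

definition signed_integral :: "'a measure \<Rightarrow> ('a set \<Rightarrow> real) \<Rightarrow> ('a \<Rightarrow> real) \<Rightarrow> real" where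
  "signed_integral M \<nu> g = (\<integral>y. g y \<partial>jordan_pos M \<nu>) - (\<integral>y. g y \<partial>jordan_neg M \<nu>)"

definition W10 :: "('k::metric_space set \<Rightarrow> real) \<Rightarrow> ('k set \<Rightarrow> real) \<Rightarrow> ennreal" where
  "W10 \<mu> \<nu> =
     (SUP g \<in> {g :: 'k \<Rightarrow> real. 1-lipschitz_on UNIV g \<and> (\<forall>y. \<bar>g y\<bar> \<le> 1)}.
        ennreal \<bar>signed_integral borel \<mu> g - signed_integral borel \<nu> g\<bar>)"

definition W_norm :: "('k::metric_space set \<Rightarrow> real) \<Rightarrow> ennreal" where
  "W_norm \<mu> = W10 (\<lambda>_. 0) \<mu>"

section \<open>Disintegration along the fibers and the spaces of signed measures\<close>

text \<open>The \<open>\<sigma>\<close>-algebra of the total space. When \<open>'k\<close> is second countable it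
  is the Borel \<open>\<sigma>\<close>-algebra of the product.\<close>

abbreviation total_alg :: "(nat \<Rightarrow> 'n) measure \<Rightarrow> ((nat \<Rightarrow> 'n) \<times> 'k::metric_space) measure" where
  "total_alg m \<equiv> m \<Otimes>\<^sub>M borel"

definition marginal_density ::
  "(nat \<Rightarrow> 'n) measure \<Rightarrow> ((nat \<Rightarrow> 'n) \<times> 'k::metric_space) measure \<Rightarrow> (nat \<Rightarrow> 'n) \<Rightarrow> ennreal" where
  "marginal_density m \<mu> = RN_deriv m (distr \<mu> m fst)"

definition disintegration ::
  "(nat \<Rightarrow> 'n) measure \<Rightarrow> ((nat \<Rightarrow> 'n) \<times> 'k::metric_space) measure \<Rightarrow>
   ((nat \<Rightarrow> 'n) \<Rightarrow> ((nat \<Rightarrow> 'n) \<times> 'k) measure) \<Rightarrow> bool" where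
  "disintegration m \<mu> \<kappa> \<longleftrightarrow>
     \<kappa> \<in> m \<rightarrow>\<^sub>M prob_algebra (total_alg m) \<and>
     (\<forall>x\<in>space m. emeasure (\<kappa> x) ({x} \<times> UNIV) = 1) \<and>
     (\<forall>E\<in>sets (total_alg m). emeasure \<mu> E = (\<integral>\<^sup>+x. marginal_density m \<mu> x * emeasure (\<kappa> x) E \<partial>m))"

definition restriction_pos ::
  "(nat \<Rightarrow> 'n) measure \<Rightarrow> ((nat \<Rightarrow> 'n) \<times> 'k::metric_space) measure \<Rightarrow>
   ((nat \<Rightarrow> 'n) \<Rightarrow> ((nat \<Rightarrow> 'n) \<times> 'k) measure) \<Rightarrow> (nat \<Rightarrow> 'n) \<Rightarrow> 'k measure" where
  "restriction_pos m \<mu> \<kappa> x = distr (scale_measure (marginal_density m \<mu> x) (\<kappa> x)) borel snd"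

text \<open>The families \<open>(\<nu>|\<^sub>\<gamma>)\<close> of restrictions of a signed measure \<open>\<nu>\<close>, one for each
  choice of the disintegrations of \<open>\<nu>\<^sup>+\<close> and \<open>\<nu>\<^sup>-\<close>.\<close>

definition restrictions ::
  "(nat \<Rightarrow> 'n) measure \<Rightarrow> (((nat \<Rightarrow> 'n) \<times> 'k::metric_space) set \<Rightarrow> real) \<Rightarrow>
   ((nat \<Rightarrow> 'n) \<Rightarrow> 'k set \<Rightarrow> real) set" where
  "restrictions m \<nu> =
     {\<lambda>x B. measure (restriction_pos m (jordan_pos (total_alg m) \<nu>) \<kappa>p x) B -
            measure (restriction_pos m (jordan_neg (total_alg m) \<nu>) \<kappa>n x) B | \<kappa>p \<kappa>n.
      disintegration m (jordan_pos (total_alg m) \<nu>) \<kappa>p \<and>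
      disintegration m (jordan_neg (total_alg m) \<nu>) \<kappa>n}"

text \<open>Disintegrations are unique up to \<open>m\<close>-null sets, so the essential supremum is the same for all
  elements of \<open>restrictions m \<nu>\<close> and the infimum below only removes the choice.\<close>

definition norm_inf ::
  "(nat \<Rightarrow> 'n) measure \<Rightarrow> (((nat \<Rightarrow> 'n) \<times> 'k::metric_space) set \<Rightarrow> real) \<Rightarrow> ennreal" where
  "norm_inf m \<nu> = (INF \<rho>\<in>restrictions m \<nu>. esssup m (\<lambda>x. W_norm (\<rho> x)))"

definition AB ::
  "(nat \<Rightarrow> 'n) measure \<Rightarrow> (((nat \<Rightarrow> 'n) \<times> 'k::metric_space) set \<Rightarrow> real) set" where
  "AB m = {\<nu>. signed_measure (total_alg m) \<nu> \<and>
     absolutely_continuous m (distr (jordan_pos (total_alg m) \<nu>) m fst) \<and>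
     absolutely_continuous m (distr (jordan_neg (total_alg m) \<nu>) m fst)}"

definition L_inf ::
  "(nat \<Rightarrow> 'n) measure \<Rightarrow> (((nat \<Rightarrow> 'n) \<times> 'k::metric_space) set \<Rightarrow> real) set" where
  "L_inf m = {\<nu> \<in> AB m. norm_inf m \<nu> < \<infinity>}"

definition signed_marginal_density ::
  "(nat \<Rightarrow> 'n) measure \<Rightarrow> (((nat \<Rightarrow> 'n) \<times> 'k::metric_space) set \<Rightarrow> real) \<Rightarrow>
   (nat \<Rightarrow> 'n) \<Rightarrow> real" where
  "signed_marginal_density m \<nu> x =
     enn2real (marginal_density m (jordan_pos (total_alg m) \<nu>) x) -
     enn2real (marginal_density m (jordan_neg (total_alg m) \<nu>) x)"

text \<open>The density is defined up to \<open>m\<close>-null sets; it has to have a version in \<open>F_theta \<theta> A\<close>.\<close>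

definition S_inf ::
  "real \<Rightarrow> nat^'n^'n \<Rightarrow> (nat \<Rightarrow> 'n) measure \<Rightarrow>
   (((nat \<Rightarrow> 'n) \<times> 'k::metric_space) set \<Rightarrow> real) set" where
  "S_inf \<theta> A m = {\<nu> \<in> L_inf m.
     \<exists>\<phi>\<in>F_theta \<theta> A. AE x in m. signed_marginal_density m \<nu> x = \<phi> x}"

section \<open>Skew products and their perturbations\<close>

definition skew ::
  "((nat \<Rightarrow> 'n) \<Rightarrow> nat \<Rightarrow> 'n) \<Rightarrow> ((nat \<Rightarrow> 'n) \<times> 'k \<Rightarrow> 'k) \<Rightarrow>
   (nat \<Rightarrow> 'n) \<times> 'k \<Rightarrow> (nat \<Rightarrow> 'n) \<times> 'k" where
  "skew s G = (\<lambda>(x, z). (s x, G (x, z)))"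

definition invariant_probs ::
  "real \<Rightarrow> nat^'n^'n \<Rightarrow> (nat \<Rightarrow> 'n) measure \<Rightarrow>
   ((nat \<Rightarrow> 'n) \<times> 'k::metric_space \<Rightarrow> (nat \<Rightarrow> 'n) \<times> 'k) \<Rightarrow>
   ((nat \<Rightarrow> 'n) \<times> 'k) measure set" where
  "invariant_probs \<theta> A m F = {\<mu>. prob_space \<mu> \<and> sets \<mu> = sets (total_alg m) \<and>
     distr \<mu> (total_alg m) F = \<mu> \<and> measure \<mu> \<in> S_inf \<theta> A m}"

definition G1 ::
  "(nat \<Rightarrow> 'n) measure \<Rightarrow> ((nat \<Rightarrow> 'n) \<times> 'k::metric_space \<Rightarrow> 'k) \<Rightarrow> bool" where
  "G1 m G \<longleftrightarrow> (\<exists>\<alpha>. 0 < \<alpha> \<and> \<alpha> < 1 \<and>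
     (AE x in m. \<forall>y1 y2. dist (G (x, y1)) (G (x, y2)) \<le> \<alpha> * dist y1 y2))"

text \<open>The constants \<open>k y\<close> are kept as data, because the constant \<open>H\<close> is used again below.\<close>

definition G2 ::
  "real \<Rightarrow> nat^'n^'n \<Rightarrow> ((nat \<Rightarrow> 'n) \<times> 'k::metric_space \<Rightarrow> 'k) \<Rightarrow> ('k \<Rightarrow> real) \<Rightarrow> bool" where
  "G2 \<theta> A G k \<longleftrightarrow>
     (\<forall>y. 0 \<le> k y \<and> (\<forall>x1\<in>shift_space A. \<forall>x2\<in>shift_space A.
        dist (G (x1, y)) (G (x2, y)) \<le> k y * d_theta \<theta> x1 x2)) \<and>
     bdd_above (range k)"

definition H_const :: "('k \<Rightarrow> real) \<Rightarrow> real" where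
  "H_const k = (SUP y. k y)"

definition U1 ::
  "nat^'n^'n \<Rightarrow> (nat \<Rightarrow> 'n) measure \<Rightarrow> real \<Rightarrow> (real \<Rightarrow> (nat \<Rightarrow> 'n) \<Rightarrow> nat \<Rightarrow> 'n) \<Rightarrow>
   (real \<Rightarrow> (nat \<Rightarrow> 'n) measure) \<Rightarrow> (real \<Rightarrow> real^'n) \<Rightarrow> bool" where
  "U1 A m \<delta>1 sg ms p \<longleftrightarrow>
     ms 0 = m \<and>
     (\<forall>\<delta>\<in>{0<..<\<delta>1}. (\<forall>x\<in>shift_space A. sg \<delta> x = shift x) \<and> markov_measure A (p \<delta>) (ms \<delta>))"

definition U2 ::
  "nat^'n^'n \<Rightarrow> real \<Rightarrow> (real \<Rightarrow> (nat \<Rightarrow> 'n) \<times> 'k::metric_space \<Rightarrow> 'k) \<Rightarrow>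
   (real \<Rightarrow> (nat \<Rightarrow> 'n) \<Rightarrow> real) \<Rightarrow> (real \<Rightarrow> real) \<Rightarrow> bool" where
  "U2 A \<delta>1 G g R \<longleftrightarrow>
     ((\<lambda>\<delta>. R \<delta> * ln \<delta>) \<longlongrightarrow> 0) (at_right 0) \<and>
     (\<forall>\<delta>\<in>{0<..<\<delta>1}.
        0 \<le> R \<delta> \<and>
        (\<forall>x\<in>shift_space A.
           (\<Sum>i | A $ i $ (x 0) = 1. \<bar>g \<delta> (case_nat i x) - g 0 (case_nat i x)\<bar>) \<le> R \<delta>) \<and>
        (\<forall>x\<in>shift_space A. \<forall>y. dist (G 0 (x, y)) (G \<delta> (x, y)) \<le> R \<delta>))"

definition U3 ::
  "(nat \<Rightarrow> 'n) measure \<Rightarrow> real \<Rightarrow> (real \<Rightarrow> (nat \<Rightarrow> 'n) measure) \<Rightarrow> bool" where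
  "U3 m \<delta>1 ms \<longleftrightarrow>
     (\<forall>\<delta>\<in>{0..<\<delta>1}. absolutely_continuous m (ms \<delta>) \<and> absolutely_continuous (ms \<delta>) m) \<and>
     (SUP \<delta>\<in>{0..<\<delta>1}. esssup m (RN_deriv m (ms \<delta>))) < \<infinity>"

text \<open>\<open>sg \<delta>\<close> and \<open>G \<delta>\<close> are the two components of \<open>F\<^sub>\<delta>\<close>, \<open>k \<delta>\<close> are the constants of
  \<open>G2\<close> for \<open>G \<delta>\<close>, and \<open>J \<delta>\<close> is the Jacobian of the shift with respect to \<open>ms \<delta>\<close>. The base
  maps \<open>sg \<delta>\<close> with \<open>\<delta> \<ge> \<delta>1\<close> need only be measurable.\<close>

definition admissible_perturbation ::
  "real \<Rightarrow> nat^'n^'n \<Rightarrow> (nat \<Rightarrow> 'n) measure \<Rightarrow> (real \<Rightarrow> (nat \<Rightarrow> 'n) \<Rightarrow> nat \<Rightarrow> 'n) \<Rightarrow>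
   (real \<Rightarrow> (nat \<Rightarrow> 'n) \<times> 'k::metric_space \<Rightarrow> 'k) \<Rightarrow> (real \<Rightarrow> 'k \<Rightarrow> real) \<Rightarrow>
   real \<Rightarrow> (real \<Rightarrow> (nat \<Rightarrow> 'n) measure) \<Rightarrow> (real \<Rightarrow> real^'n) \<Rightarrow>
   (real \<Rightarrow> (nat \<Rightarrow> 'n) \<Rightarrow> real) \<Rightarrow> (real \<Rightarrow> real) \<Rightarrow> bool" where
  "admissible_perturbation \<theta> A m sg G k \<delta>1 ms p J R \<longleftrightarrow>
     (\<forall>x\<in>shift_space A. sg 0 x = shift x) \<and>
     (\<forall>\<delta>\<in>{0..<1}. sg \<delta> \<in> m \<rightarrow>\<^sub>M m \<and> G \<delta> \<in> total_alg m \<rightarrow>\<^sub>M borel \<and>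
        G1 m (G \<delta>) \<and> G2 \<theta> A (G \<delta>) (k \<delta>)) \<and>
     (\<forall>\<delta>\<in>{0..<\<delta>1}. is_jacobian \<theta> A (ms \<delta>) (J \<delta>)) \<and>
     U1 A m \<delta>1 sg ms p \<and> U2 A \<delta>1 G (\<lambda>\<delta> x. 1 / J \<delta> x) R \<and> U3 m \<delta>1 ms"

definition A1 ::
  "real \<Rightarrow> nat^'n^'n \<Rightarrow> real \<Rightarrow> (real \<Rightarrow> (nat \<Rightarrow> 'n) \<Rightarrow> real) \<Rightarrow> bool" where
  "A1 \<theta> A \<delta>1 g \<longleftrightarrow> (\<exists>B3 \<beta>3. 0 < B3 \<and> 0 < \<beta>3 \<and> \<beta>3 < 1 \<and>
     (\<forall>u\<in>F_theta \<theta> A. \<forall>\<delta>\<in>{0..<\<delta>1}. \<forall>n\<ge>1.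
        norm_theta \<theta> A ((transfer_op A (g \<delta>) ^^ n) u) \<le>
        ennreal (B3 * \<beta>3 ^ n) * norm_theta \<theta> A u + ennreal B3 * sup_norm A u))"

definition C1 ::
  "real \<Rightarrow> nat^'n^'n \<Rightarrow> ('k \<Rightarrow> real) \<Rightarrow> ((nat \<Rightarrow> 'n) \<Rightarrow> real) \<Rightarrow> ennreal" where
  "C1 \<theta> A k g =
     max (ennreal (H_const k * \<theta>) + ennreal (\<theta> * real CARD('n)) * lip_theta \<theta> A g) 2"

definition A2 ::
  "real \<Rightarrow> nat^'n^'n \<Rightarrow> real \<Rightarrow> (real \<Rightarrow> 'k \<Rightarrow> real) \<Rightarrow>
   (real \<Rightarrow> (nat \<Rightarrow> 'n) \<Rightarrow> real) \<Rightarrow> bool" where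
  "A2 \<theta> A \<delta>1 k g \<longleftrightarrow> (SUP \<delta>\<in>{0..<\<delta>1}. C1 \<theta> A (k \<delta>) (g \<delta>)) < \<infinity>"

end

theory Submission
  imports Defs
begin

text \<open>
  Since \<open>\<sigma>\<^sub>\<delta> = \<sigma>\<close>, the marginal of \<open>\<mu>\<^sub>\<delta>\<close> on the base is a shift-invariant measure with a Lipschitz
  density with respect to \<open>m\<close>. By aperiodicity \<open>m(C \<inter> \<sigma>\<^sup>-\<^sup>n D) \<ge> c m(C) m(D)\<close> for cylinders and suitable
  \<open>n\<close>, which forces this density to be constant. So all \<open>\<mu>\<^sub>\<delta>\<close> have marginal \<open>m\<close>, and
  \<open>\<mu>\<^sub>\<delta> - \<mu>\<^sub>0\<close> has marginal \<open>0\<close>. On such measures the action of \<open>F\<^sub>0\<close> contracts \<open>\<parallel>\<cdot>\<parallel>\<^sub>\<infinity>\<close> by the factor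
  \<open>\<alpha>\<close>, while replacing \<open>G\<^sub>\<delta>\<close> by \<open>G\<^sub>0\<close> costs at most \<open>R(\<delta>)\<close>. This gives the bound
  \<open>R(\<delta>) / (1 - \<alpha>)\<close>, which is at most \<open>R(\<delta>) \<bar>log \<delta>\<bar> / (1 - \<alpha>)\<close> for \<open>\<delta> < 1/e\<close>.

  The contraction is proved in dual form, for integrals of test functions over the total space.
  A disintegration is needed only to translate the result into \<open>\<parallel>\<cdot>\<parallel>\<^sub>\<infinity>\<close>; it is obtained from
  conditional distribution functions after a Borel embedding of \<open>K\<close> into the reals.
\<close>

section \<open>Jordan decompositions\<close>

text \<open>The factor \<open>\<alpha>\<close> comes from oscillation. Against two measures with the
  same marginal, a function of the base point alone has equal integrals, so only the fiberwise
  oscillation of a test function counts, and composing with \<open>G 0\<close> multiplies its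
  fiberwise Lipschitz constant by \<open>\<alpha>\<close>. Each iteration costs one replacement of
  \<open>G \<delta>\<close> by \<open>G 0\<close>, and \<open>1 / (1 - \<alpha>)\<close> is the sum
  of the resulting geometric series. Products \<open>indicator B x * g y\<close> are enough as test
  functions: a bound \<open>C * measure m B\<close> for all \<open>B\<close> is a bound by
  \<open>C\<close> on almost every fiber.

  The obstacle is the passage to \<open>norm_inf\<close>. It is an infimum over disintegrations of
  the two Jordan parts, hence infinite if there are none, so a pair has to be exhibited. The fiber
  norm is a supremum over uncountably many \<open>g\<close>; it is reduced to a countable family,
  which makes it measurable in the base point and allows the exceptional null sets of the individual
  \<open>g\<close> to be united.\<close>

lemma jordan_decomposition_uminus:
  assumes "jordan_decomposition M \<nu> P Q"
  shows "jordan_decomposition M (\<lambda>E. - \<nu> E) Q P"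
proof -
  from assms obtain S where S: "S \<in> sets M" "emeasure P (space M - S) = 0" "emeasure Q S = 0"
    unfolding jordan_decomposition_def by blast
  have "space M - S \<in> sets M" "emeasure Q (space M - (space M - S)) = 0"
    using S sets.sets_into_space[OF S(1)] by (auto simp: double_diff)
  then show ?thesis
    using assms S unfolding jordan_decomposition_def by (auto intro!: bexI[of _ "space M - S"])
qed

text \<open>On the set \<open>S\<close> that carries \<open>P\<close>, the measure \<open>P\<close>
  agrees with \<open>\<nu>\<close>, and \<open>\<nu>\<close> lies below the positive term of every
  other representation. Used in both directions, this gives the uniqueness that the definite
  descriptions \<open>jordan_pos\<close> and \<open>jordan_neg\<close> require.\<close>

lemma jordan_decomposition_le:
  assumes 1: "jordan_decomposition M \<nu> P Q" and 2: "jordan_decomposition M \<nu> P' Q'"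
    and E: "E \<in> sets M"
  shows "measure P E \<le> measure P' E"
proof -
  from 1 obtain S where S: "S \<in> sets M" "emeasure P (space M - S) = 0" "emeasure Q S = 0"
    unfolding jordan_decomposition_def by blast
  from 1 interpret P: finite_measure P by (simp add: jordan_decomposition_def)
  from 2 interpret P': finite_measure P' by (simp add: jordan_decomposition_def)
  have sets[simp]: "sets P = sets M" "sets Q = sets M" "sets P' = sets M"
    using 1 2 by (auto simp: jordan_decomposition_def)
  have "space M - S \<in> null_sets P"
    using S by (auto simp: null_sets_def)
  then have "measure P E = measure P (E - (space M - S))"
    using E by (simp add: measure_Diff_null_set)
  also have "E - (space M - S) = E \<inter> S"
    using sets.sets_into_space[OF E] by auto
  finally have P: "measure P E = measure P (E \<inter> S)" .
  have "emeasure Q (E \<inter> S) \<le> emeasure Q S"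
    using S by (intro emeasure_mono) auto
  then have Q: "measure Q (E \<inter> S) = 0"
    using S by (simp add: measure_def)
  have ES: "E \<inter> S \<in> sets M" using E S by auto
  have "measure P (E \<inter> S) = \<nu> (E \<inter> S)"
    using 1 ES Q by (auto simp: jordan_decomposition_def)
  also have "\<dots> = measure P' (E \<inter> S) - measure Q' (E \<inter> S)"
    using 2 ES by (auto simp: jordan_decomposition_def)
  also have "\<dots> \<le> measure P' (E \<inter> S)" by simp
  also have "\<dots> \<le> measure P' E"
    using E by (intro P'.finite_measure_mono) auto
  finally show ?thesis using P by simp
qed

lemma jordan_decomposition_unique_pos:
  assumes 1: "jordan_decomposition M \<nu> P Q" and 2: "jordan_decomposition M \<nu> P' Q'"
  shows "P = P'"
proof (rule measure_eqI)
  show "sets P = sets P'" using 1 2 by (simp add: jordan_decomposition_def)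
  fix E assume "E \<in> sets P"
  then have "E \<in> sets M" using 1 by (simp add: jordan_decomposition_def)
  then have "measure P E = measure P' E"
    using jordan_decomposition_le[OF 1 2] jordan_decomposition_le[OF 2 1] by (auto intro: antisym)
  then show "emeasure P E = emeasure P' E"
    using 1 2 by (simp add: jordan_decomposition_def finite_measure.emeasure_eq_measure)
qed

lemma jordan_pos_eq:
  assumes "jordan_decomposition M \<nu> P Q"
  shows "jordan_pos M \<nu> = P"
  unfolding jordan_pos_def
  using assms jordan_decomposition_unique_pos by (intro the_equality) blast+

lemma jordan_neg_eq:
  assumes "jordan_decomposition M \<nu> P Q"
  shows "jordan_neg M \<nu> = Q"
  unfolding jordan_neg_def
  using assms jordan_decomposition_unique_pos[OF jordan_decomposition_uminus jordan_decomposition_uminus]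
  by (intro the_equality) blast+

text \<open>A Hahn set \<open>Y\<close> separates the region where \<open>M1\<close> dominates from
  the one where \<open>M2\<close> does; the parts are the differences restricted to \<open>Y\<close>
  and to its complement. The bounds by \<open>M1\<close> and \<open>M2\<close> are recorded because
  they later make the marginals of the parts absolutely continuous.\<close>

lemma jordan_decomposition_exists:
  assumes fin: "finite_measure M1" "finite_measure M2" and sets: "sets M1 = sets M" "sets M2 = sets M"
  obtains P Q where "jordan_decomposition M (\<lambda>E. measure M1 E - measure M2 E) P Q"
    "\<And>E. E \<in> sets M \<Longrightarrow> emeasure P E \<le> emeasure M1 E"
    "\<And>E. E \<in> sets M \<Longrightarrow> emeasure Q E \<le> emeasure M2 E"
proof -
  interpret M1: finite_measure M1 by fact
  interpret M2: finite_measure M2 by fact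
  note sets[measurable_cong, simp]
  have space: "space M1 = space M" "space M2 = space M"
    by (rule sets_eq_imp_space_eq[OF sets(1)], rule sets_eq_imp_space_eq[OF sets(2)])
  obtain Y where Y: "Y \<in> sets M" 
    "\<And>X. X \<in> sets M \<Longrightarrow> X \<subseteq> Y \<Longrightarrow> emeasure M2 X \<le> emeasure M1 X"
    "\<And>X. X \<in> sets M \<Longrightarrow> X \<subseteq> space M \<Longrightarrow> X \<inter> Y = {} \<Longrightarrow> emeasure M1 X \<le> emeasure M2 X"
    using unsigned_Hahn_decomposition[of M2 M1 "space M"] by (auto simp: sets)
  let ?r = "\<lambda>N Y. density N (indicator Y)"
  define P where "P = diff_measure (?r M1 Y) (?r M2 Y)"
  define Q where "Q = diff_measure (?r M2 (space M - Y)) (?r M1 (space M - Y))"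
  have r: "emeasure (?r N Z) E = emeasure N (E \<inter> Z)" if "sets N = sets M" "Z \<in> sets M" "E \<in> sets M" for N Z E
    using that by (simp add: emeasure_restricted Int_commute)
  have finr: "finite_measure (?r N Z)" if "finite_measure N" "sets N = sets M" "Z \<in> sets M" for N Z
  proof
    have "space N = space M" using that sets_eq_imp_space_eq by blast
    then show "emeasure (?r N Z) (space (?r N Z)) \<noteq> \<infinity>"
      using that r[of N Z "space M"] finite_measure.emeasure_finite by (auto simp: less_top)
  qed
  have emP: "emeasure P E = emeasure M1 (E \<inter> Y) - emeasure M2 (E \<inter> Y)" if "E \<in> sets M" for E
    unfolding P_def using that Y fin by (subst emeasure_diff_measure) (auto simp: r intro!: finr)
  have emQ: "emeasure Q E = emeasure M2 (E \<inter> (space M - Y)) - emeasure M1 (E \<inter> (space M - Y))" if "E \<in> sets M" for E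
    unfolding Q_def using that Y fin by (subst emeasure_diff_measure) (auto simp: r intro!: finr Y(3))
  have sP: "sets P = sets M" "sets Q = sets M" by (auto simp: P_def Q_def)
  have le1: "emeasure P E \<le> emeasure M1 E" if "E \<in> sets M" for E
  proof -
    have "emeasure P E \<le> emeasure M1 (E \<inter> Y)"
      unfolding emP[OF that] by (rule diff_le_self_ennreal)
    also have "\<dots> \<le> emeasure M1 E" using that by (intro emeasure_mono) auto
    finally show ?thesis .
  qed
  have le2: "emeasure Q E \<le> emeasure M2 E" if "E \<in> sets M" for E
  proof -
    have "emeasure Q E \<le> emeasure M2 (E \<inter> (space M - Y))"
      unfolding emQ[OF that] by (rule diff_le_self_ennreal)
    also have "\<dots> \<le> emeasure M2 E" using that by (intro emeasure_mono) auto
    finally show ?thesis .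
  qed
  have fP: "finite_measure P"
    using le1[of "space M"] M1.emeasure_finite[of "space M"] sets_eq_imp_space_eq[OF sP(1)]
    by (intro finite_measureI) (auto simp: top_unique)
  have fQ: "finite_measure Q"
    using le2[of "space M"] M2.emeasure_finite[of "space M"] sets_eq_imp_space_eq[OF sP(2)]
    by (intro finite_measureI) (auto simp: top_unique)
  have "measure M1 E - measure M2 E = measure P E - measure Q E" if E: "E \<in> sets M" for E
  proof -
    have "measure M2 (E \<inter> Y) \<le> measure M1 (E \<inter> Y)"
      using Y(2)[of "E \<inter> Y"] E Y(1) by (simp add: M1.emeasure_eq_measure M2.emeasure_eq_measure)
    then have a: "measure P E = measure M1 (E \<inter> Y) - measure M2 (E \<inter> Y)"
      unfolding measure_def[of P] emP[OF E]
      by (simp add: M1.emeasure_eq_measure M2.emeasure_eq_measure ennreal_minus)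
    have "measure M1 (E \<inter> (space M - Y)) \<le> measure M2 (E \<inter> (space M - Y))"
      using Y(3)[of "E \<inter> (space M - Y)"] E Y(1) sets.sets_into_space[OF E]
      by (auto simp add: M1.emeasure_eq_measure M2.emeasure_eq_measure)
    then have b: "measure Q E = measure M2 (E \<inter> (space M - Y)) - measure M1 (E \<inter> (space M - Y))"
      unfolding measure_def[of Q] emQ[OF E]
      by (simp add: M1.emeasure_eq_measure M2.emeasure_eq_measure ennreal_minus)
    have E2: "E = (E \<inter> Y) \<union> (E \<inter> (space M - Y))"
      using sets.sets_into_space[OF E] by auto
    have c: "measure M1 E = measure M1 (E \<inter> Y) + measure M1 (E \<inter> (space M - Y))"
      using E Y(1) by (subst E2, subst M1.finite_measure_Union) auto
    have d: "measure M2 E = measure M2 (E \<inter> Y) + measure M2 (E \<inter> (space M - Y))"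
      using E Y(1) by (subst E2, subst M2.finite_measure_Union) auto
    show ?thesis using a b c d by simp
  qed
  moreover have "emeasure P (space M - Y) = 0" "emeasure Q Y = 0"
  proof -
    have "(space M - Y) \<inter> Y = {}" "Y \<inter> (space M - Y) = {}" by auto
    then show "emeasure P (space M - Y) = 0" "emeasure Q Y = 0"
      using Y(1) by (auto simp: emP emQ)
  qed
  ultimately have "jordan_decomposition M (\<lambda>E. measure M1 E - measure M2 E) P Q"
    unfolding jordan_decomposition_def using sP fP fQ Y(1) by auto
  then show thesis using le1 le2 that by blast
qed

text \<open>Sums on both sides replace the difference of measures, since subtraction on
  \<open>ennreal\<close> is truncated. In this form the identity passes through the induction on
  nonnegative measurable functions.\<close>

lemma nn_integral_measure_sum_cong:
  assumes sets: "sets P = sets M" "sets Q = sets M" "sets P' = sets M" "sets Q' = sets M"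
    and eq: "\<And>E. E \<in> sets M \<Longrightarrow> emeasure P E + emeasure Q' E = emeasure P' E + emeasure Q E"
    and f: "f \<in> borel_measurable M"
  shows "(\<integral>\<^sup>+x. f x \<partial>P) + (\<integral>\<^sup>+x. f x \<partial>Q') = (\<integral>\<^sup>+x. f x \<partial>P') + (\<integral>\<^sup>+x. f x \<partial>Q)"
  using f
proof (induction rule: borel_measurable_induct)
  note sets[measurable_cong, simp]
  note spaces = sets[THEN sets_eq_imp_space_eq]
  case (cong f g)
  have "(\<integral>\<^sup>+x. f x \<partial>N) = (\<integral>\<^sup>+x. g x \<partial>N)" if "space N = space M" for N
    using that cong by (intro nn_integral_cong) auto
  then show ?case using cong.IH by (simp add: spaces)
next
  case (set A)
  then show ?case using eq by (simp add: sets)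
next
  case (mult u c)
  then have "u \<in> borel_measurable P" "u \<in> borel_measurable Q" "u \<in> borel_measurable P'" "u \<in> borel_measurable Q'"
    using sets by (simp_all cong: measurable_cong_sets)
  then show ?case using mult by (simp add: nn_integral_cmult distrib_left[symmetric])
next
  case (add u v)
  then have "u \<in> borel_measurable P" "u \<in> borel_measurable Q" "u \<in> borel_measurable P'" "u \<in> borel_measurable Q'"
     "v \<in> borel_measurable P" "v \<in> borel_measurable Q" "v \<in> borel_measurable P'" "v \<in> borel_measurable Q'"
    using sets by (simp_all cong: measurable_cong_sets)
  then show ?case using add by (simp add: nn_integral_add) (metis add.assoc add.commute)
next
  case (seq U)
  then have m: "U i \<in> borel_measurable P" "U i \<in> borel_measurable Q" "U i \<in> borel_measurable P'" "U i \<in> borel_measurable Q'" for i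
    using sets by (simp_all cong: measurable_cong_sets)
  have i: "incseq (\<lambda>i. \<integral>\<^sup>+x. U i x \<partial>N)" for N
    using seq(3) by (auto simp: incseq_def le_fun_def intro!: nn_integral_mono)
  have eqS: "(SUP i. (\<integral>\<^sup>+x. U i x \<partial>N)) + (SUP i. (\<integral>\<^sup>+x. U i x \<partial>N')) = (SUP i. (\<integral>\<^sup>+x. U i x \<partial>N) + (\<integral>\<^sup>+x. U i x \<partial>N'))" for N N'
    by (intro ennreal_SUP_add[symmetric] i)
  show ?case
    unfolding SUP_apply Sup_apply image_image
    apply (subst (1 2 3 4) nn_integral_monotone_convergence_SUP)
    using seq m by (auto simp: eqS)
qed

lemma integral_measure_diff_cong:
  fixes f :: "'a \<Rightarrow> real"
  assumes fin: "finite_measure P" "finite_measure Q" "finite_measure P'" "finite_measure Q'"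
    and sets: "sets P = sets M" "sets Q = sets M" "sets P' = sets M" "sets Q' = sets M"
    and eq: "\<And>E. E \<in> sets M \<Longrightarrow> measure P E - measure Q E = measure P' E - measure Q' E"
    and f[measurable]: "f \<in> borel_measurable M" and bd: "\<And>x. \<bar>f x\<bar> \<le> b"
  shows "(\<integral>x. f x \<partial>P) - (\<integral>x. f x \<partial>Q) = (\<integral>x. f x \<partial>P') - (\<integral>x. f x \<partial>Q')"
proof -
  note sets[measurable_cong, simp]
  interpret P: finite_measure P by fact
  interpret Q: finite_measure Q by fact
  interpret P': finite_measure P' by fact
  interpret Q': finite_measure Q' by fact
  have e: "emeasure P E + emeasure Q' E = emeasure P' E + emeasure Q E" if "E \<in> sets M" for E
    using eq[OF that]
    by (simp add: P.emeasure_eq_measure P'.emeasure_eq_measure Q.emeasure_eq_measure Q'.emeasure_eq_measure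
        ennreal_plus[symmetric] del: ennreal_plus)
  \<comment> \<open>Adding \<open>b\<close> makes the integrand nonnegative, so that the additive
    identity applies. The surplus terms, \<open>b\<close> times the total masses, cancel by
    \<open>eq\<close> for the whole space.\<close>
  define g where "g x = f x + b" for x
  have g0: "0 \<le> g x" "\<bar>g x\<bar> \<le> 2 * \<bar>b\<bar>" for x using bd[of x] by (auto simp: g_def)
  have [measurable]: "g \<in> borel_measurable M" unfolding g_def by measurable
  have If: "integrable N f" "integrable N g" if "finite_measure N" "sets N = sets M" for N
    using that bd g0
      finite_measure.integrable_const_bound[OF that(1), of f b]
      finite_measure.integrable_const_bound[OF that(1), of g "2 * \<bar>b\<bar>"]
    by (auto cong: measurable_cong_sets)
  have gf: "(\<integral>x. g x \<partial>N) = (\<integral>x. f x \<partial>N) + b * measure N (space N)" if "finite_measure N" "sets N = sets M" for N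
  proof -
    interpret finite_measure N by fact
    show ?thesis unfolding g_def by (subst Bochner_Integration.integral_add) (use If[OF that] in auto)
  qed
  have "ennreal ((\<integral>x. g x \<partial>P) + (\<integral>x. g x \<partial>Q')) = ennreal ((\<integral>x. g x \<partial>P') + (\<integral>x. g x \<partial>Q))"
    using nn_integral_measure_sum_cong[OF sets e, of "\<lambda>x. ennreal (g x)"] g0
    by (simp add: nn_integral_eq_integral If fin sets)
  then have "(\<integral>x. g x \<partial>P) + (\<integral>x. g x \<partial>Q') = (\<integral>x. g x \<partial>P') + (\<integral>x. g x \<partial>Q)"
    using g0 by (subst (asm) ennreal_inj) (auto intro!: add_nonneg_nonneg integral_nonneg)
  moreover have "measure P (space P) - measure Q (space Q) = measure P' (space P') - measure Q' (space Q')"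
    using eq[of "space M"] sets_eq_imp_space_eq[OF sets(1)] sets_eq_imp_space_eq[OF sets(2)] sets_eq_imp_space_eq[OF sets(3)] sets_eq_imp_space_eq[OF sets(4)]
    by auto
  then have "b * measure P (space P) - b * measure Q (space Q) = b * measure P' (space P') - b * measure Q' (space Q')"
    by (metis right_diff_distrib)
  ultimately show ?thesis by (simp add: gf fin sets)
qed

text \<open>Allows \<open>W_norm\<close> to be computed from any two finite measures representing
  the signed measure, without knowing its Jordan parts.\<close>

lemma signed_integral_measure_diff:
  fixes f :: "'a \<Rightarrow> real"
  assumes fin: "finite_measure M1" "finite_measure M2" and sets: "sets M1 = sets M" "sets M2 = sets M"
    and f: "f \<in> borel_measurable M" "\<And>x. \<bar>f x\<bar> \<le> b"
  shows "signed_integral M (\<lambda>E. measure M1 E - measure M2 E) f = (\<integral>x. f x \<partial>M1) - (\<integral>x. f x \<partial>M2)"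
proof -
  obtain P Q where PQ: "jordan_decomposition M (\<lambda>E. measure M1 E - measure M2 E) P Q"
    by (rule jordan_decomposition_exists[OF fin sets])
  show ?thesis
    unfolding signed_integral_def jordan_pos_eq[OF PQ] jordan_neg_eq[OF PQ]
    using PQ f fin sets
    by (intro integral_measure_diff_cong[where M=M and b=b]) (auto simp: jordan_decomposition_def)
qed

section \<open>Disintegration along the fibers\<close>

lemma AE_le_of_nn_integral_le:
  assumes f[measurable]: "f \<in> borel_measurable M" and g[measurable]: "g \<in> borel_measurable M"
    and fin: "(\<integral>\<^sup>+x. g x \<partial>M) < \<infinity>"
    and le: "\<And>B. B \<in> sets M \<Longrightarrow> (\<integral>\<^sup>+x\<in>B. f x \<partial>M) \<le> (\<integral>\<^sup>+x\<in>B. g x \<partial>M)"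
  shows "AE x in M. f x \<le> (g x :: ennreal)"
proof -
  define B where "B = {x \<in> space M. g x < f x}"
  have B[measurable]: "B \<in> sets M" unfolding B_def by measurable
  have gB: "(\<integral>\<^sup>+x\<in>B. g x \<partial>M) < \<infinity>"
    by (rule le_less_trans[OF _ fin]) (auto intro!: nn_integral_mono simp: indicator_def)
  have "(\<integral>\<^sup>+x. f x * indicator B x - g x * indicator B x \<partial>M)
      = (\<integral>\<^sup>+x\<in>B. f x \<partial>M) - (\<integral>\<^sup>+x\<in>B. g x \<partial>M)"
    using gB by (intro nn_integral_diff) (auto simp: B_def indicator_def less_imp_le)
  also have "\<dots> = 0"
    using le[OF B] gB by (intro diff_eq_0_ennreal) (auto intro: le_less_trans)
  finally have "AE x in M. f x * indicator B x - g x * indicator B x = 0"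
    by (subst (asm) nn_integral_0_iff_AE) auto
  moreover have "AE x in M. x \<in> space M" by simp
  ultimately show ?thesis
  proof eventually_elim
    fix x assume "f x * indicator B x - g x * indicator B x = 0" and x: "x \<in> space M"
    then have "x \<in> B \<Longrightarrow> f x - g x = 0" by simp
    then have "x \<notin> B"
      using diff_gt_0_iff_gt_ennreal[of "f x" "g x"] by (auto simp: B_def)
    then show "f x \<le> g x" using x by (auto simp: B_def)
  qed
qed

text \<open>With a real second coordinate a kernel amounts to a family of distribution functions,
  and their values are Radon-Nikodym derivatives with respect to the marginal \<open>\<eta>\<close>.
  The bounded range makes the limits 0 and 1 at the two ends automatic.\<close>

lemma real_disintegration:
  fixes N :: "('a \<times> real) measure" and \<eta> :: "'a measure"
  assumes fin: "finite_measure N" and sets_N[measurable_cong]: "sets N = sets (\<eta> \<Otimes>\<^sub>M borel)"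
    and marg: "distr N \<eta> fst = \<eta>" and ne: "space \<eta> \<noteq> {}"
    and bounded: "AE z in N. snd z \<in> {0..1}"
  obtains \<kappa> where "\<kappa> \<in> \<eta> \<rightarrow>\<^sub>M prob_algebra borel"
    "\<And>E. E \<in> sets (\<eta> \<Otimes>\<^sub>M borel) \<Longrightarrow> emeasure N E = (\<integral>\<^sup>+x. emeasure (\<kappa> x) (Pair x -` E) \<partial>\<eta>)"
proof -
  interpret N: finite_measure N by fact
  have space_N: "space N = space \<eta> \<times> UNIV"
    using sets_eq_imp_space_eq[OF sets_N] by (simp add: space_pair_measure)
  interpret \<eta>: finite_measure \<eta>
    by (subst marg[symmetric], rule N.finite_measure_distr) simp
  have em\<eta>: "emeasure \<eta> B = emeasure N (B \<times> UNIV)" if "B \<in> sets \<eta>" for B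
  proof -
    have "emeasure \<eta> B = emeasure (distr N \<eta> fst) B" using marg by simp
    also have "\<dots> = emeasure N (fst -` B \<inter> space N)" using that by (intro emeasure_distr) auto
    also have "fst -` B \<inter> space N = B \<times> UNIV"
      using sets.sets_into_space[OF that] by (auto simp: space_N)
    finally show ?thesis .
  qed
  \<comment> \<open>The base measure of the part of \<open>N\<close> below height \<open>t\<close>.
    Its derivative \<open>D t\<close> is the conditional distribution function at \<open>t\<close>,
    determined only up to a null set that depends on \<open>t\<close>.\<close>
  define \<nu> where "\<nu> t = distr (density N (indicator (space \<eta> \<times> {..t}))) \<eta> fst" for t :: real
  have em\<nu>: "emeasure (\<nu> t) B = emeasure N (B \<times> {..t})" if "B \<in> sets \<eta>" for B t
  proof -
    have "emeasure (\<nu> t) B = emeasure (density N (indicator (space \<eta> \<times> {..t}))) (fst -` B \<inter> space N)"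
      unfolding \<nu>_def using that by (subst emeasure_distr) auto
    also have "\<dots> = emeasure N ((space \<eta> \<times> {..t}) \<inter> (fst -` B \<inter> space N))"
      using that by (intro emeasure_restricted) auto
    also have "(space \<eta> \<times> {..t}) \<inter> (fst -` B \<inter> space N) = B \<times> {..t}"
      using sets.sets_into_space[OF that] by (auto simp: space_N)
    finally show ?thesis .
  qed
  have sets_\<nu>: "sets (\<nu> t) = sets \<eta>" for t by (simp add: \<nu>_def)
  have ac: "absolutely_continuous \<eta> (\<nu> t)" for t
    unfolding absolutely_continuous_def
  proof
    fix B assume B: "B \<in> null_sets \<eta>"
    then have "emeasure (\<nu> t) B \<le> emeasure \<eta> B"
      by (subst em\<nu>, force, subst em\<eta>, force, intro emeasure_mono) auto
    then show "B \<in> null_sets (\<nu> t)" using B by (auto simp: null_sets_def sets_\<nu>)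
  qed
  define D where "D t = RN_deriv \<eta> (\<nu> t)" for t
  have [measurable]: "D t \<in> borel_measurable \<eta>" for t unfolding D_def by simp
  have D: "(\<integral>\<^sup>+x\<in>B. D t x \<partial>\<eta>) = emeasure N (B \<times> {..t})" if [measurable]: "B \<in> sets \<eta>" for B t
  proof -
    have "emeasure N (B \<times> {..t}) = emeasure (density \<eta> (D t)) B"
      unfolding D_def \<eta>.density_RN_deriv[OF ac sets_\<nu>] using that by (simp add: em\<nu>)
    then show ?thesis by (simp add: emeasure_density)
  qed
  have Dfin: "(\<integral>\<^sup>+x. D t x \<partial>\<eta>) < \<infinity>" for t
    using D[OF sets.top, of t] N.emeasure_finite[of "space \<eta> \<times> {..t}"]
    by (simp add: less_top[symmetric] cong: nn_integral_cong)
  have D_mono: "AE x in \<eta>. D s x \<le> D t x" if "s \<le> t" for s t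
    using that by (intro AE_le_of_nn_integral_le Dfin) (auto simp: D intro!: emeasure_mono)
  have D_0: "AE x in \<eta>. D t x = 0" if "t < 0" for t
  proof -
    have "emeasure N (space \<eta> \<times> {..t}) = emeasure N {}"
      using bounded that by (intro emeasure_eq_AE) (auto elim!: eventually_mono)
    then have "(\<integral>\<^sup>+x\<in>space \<eta>. D t x \<partial>\<eta>) = 0" by (subst D) auto
    then have "(\<integral>\<^sup>+x. D t x \<partial>\<eta>) = 0" by (simp cong: nn_integral_cong)
    then show ?thesis by (subst (asm) nn_integral_0_iff_AE) auto
  qed

  have D_1: "AE x in \<eta>. D t x = 1" if "1 \<le> t" for t
  proof -
    have "density \<eta> (\<lambda>_. 1) = \<nu> t"
    proof (rule measure_eqI)
      fix B assume "B \<in> sets (density \<eta> (\<lambda>_. 1))"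
      then have B: "B \<in> sets \<eta>" by simp
      have "emeasure N (B \<times> UNIV) = emeasure N (B \<times> {..t})"
      proof (rule emeasure_eq_AE)
        show "AE z in N. z \<in> B \<times> UNIV \<longleftrightarrow> z \<in> B \<times> {..t}"
          using bounded by eventually_elim (use that in auto)
      qed (use B in auto)
      then show "emeasure (density \<eta> (\<lambda>_. 1)) B = emeasure (\<nu> t) B"
        using B by (simp add: em\<nu> em\<eta> density_1)
    qed (simp add: sets_\<nu>)
    then have "AE x in \<eta>. 1 = D t x"
      unfolding D_def by (intro \<eta>.RN_deriv_unique) auto
    then show ?thesis by eventually_elim simp
  qed
  \<comment> \<open>A version of \<open>D q\<close> that is exactly 0 below 0, exactly 1 from 1 on,
    and at most 1 in between, at every \<open>x\<close>. Hence every \<open>F x\<close> below is a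
    genuine distribution function.\<close>
  define c where "c q x = (if q < 0 then 0 else if 1 \<le> q then 1 else min 1 (D q x))" for q x
  have [measurable]: "c q \<in> borel_measurable \<eta>" for q unfolding c_def by measurable
  have cD: "AE x in \<eta>. c q x = D q x" for q
    using D_0[of q] D_1[of q] D_1[OF order_refl] D_mono[of q 1]
    by (cases "q < 0"; cases "1 \<le> q") (auto simp: c_def elim!: eventually_elim2)
  \<comment> \<open>The infimum over rationals \<open>q > t\<close> is monotone and right continuous in \<open>t\<close> at every \<open>x\<close>,
    so no exceptional null set has to be removed.\<close>
  define Q where "Q t = {q \<in> \<rat>. t < q}" for t :: real
  have Q_count: "countable (Q t)" for t unfolding Q_def by (rule countable_subset[OF _ countable_rat]) auto
  define F where "F x t = (INF q\<in>Q t. c q x)" for x t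
  have [measurable]: "(\<lambda>x. F x t) \<in> borel_measurable \<eta>" for t
    unfolding F_def using Q_count by measurable
  have F_mono: "F x s \<le> F x t" if "s \<le> t" for x s t
    unfolding F_def using that by (intro INF_superset_mono) (auto simp: Q_def)
  have F_le1: "F x t \<le> 1" for x t
  proof -
    obtain q where "q \<in> \<rat>" "max t 1 < q" using Rats_dense_in_real[of "max t 1" "max t 1 + 1"] by auto
    then have "F x t \<le> c q x" unfolding F_def by (intro INF_lower) (auto simp: Q_def)
    then show ?thesis using \<open>max t 1 < q\<close> by (simp add: c_def)
  qed
  then have F_top: "F x t < \<top>" for x t by (rule le_less_trans) simp
  have F_1: "F x t = 1" if "1 \<le> t" for x t
  proof (rule antisym[OF F_le1])
    show "1 \<le> F x t" unfolding F_def Q_def using that by (intro INF_greatest) (auto simp: c_def)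
  qed
  have F_0: "F x t = 0" if t: "t < 0" for x t
  proof -
    obtain q where "q \<in> \<rat>" "t < q" "q < 0" using Rats_dense_in_real[OF t] by auto
    then have "F x t \<le> c q x" unfolding F_def by (intro INF_lower) (auto simp: Q_def)
    then show ?thesis using \<open>q < 0\<close> by (simp add: c_def)
  qed
  have F_right: "(F x \<longlongrightarrow> F x t) (at_right t)" for x t
  proof (rule order_tendstoI)
    fix a assume "a < F x t"
    then have "\<And>s. t < s \<Longrightarrow> a < F x s" using F_mono[of t] by (meson less_imp_le less_le_trans)
    then show "\<forall>\<^sub>F s in at_right t. a < F x s" 
      using eventually_at_right_less[of t] by (auto elim!: eventually_mono)
  next
    fix a assume "F x t < a"
    then obtain q where q: "q \<in> Q t" "c q x < a" unfolding F_def by (auto simp: INF_less_iff)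
    have "F x s < a" if "s < q" for s
    proof -
      have "F x s \<le> c q x" using q that unfolding F_def by (intro INF_lower) (auto simp: Q_def)
      then show ?thesis using q by simp
    qed
    moreover have "t < q" using q by (simp add: Q_def)
    ultimately show "\<forall>\<^sub>F s in at_right t. F x s < a" 
      by (auto simp: eventually_at_right_field)
  qed
  define f where "f x t = enn2real (F x t)" for x t
  have f_mono: "f x s \<le> f x t" if "s \<le> t" for x s t
    unfolding f_def using F_mono[OF that] F_top by (intro enn2real_mono) auto
  have f_right: "continuous (at_right t) (f x)" for x t
    unfolding continuous_within f_def using F_right[of x t] F_top[of x t] by (intro tendsto_enn2real) auto
  have f_bot: "(f x \<longlongrightarrow> 0) at_bot" for x
    by (rule tendsto_eventually) (auto simp: eventually_at_bot_dense f_def F_0 intro!: exI[of _ 0])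
  have f_top: "(f x \<longlongrightarrow> 1) at_top" for x
    by (rule tendsto_eventually) (auto simp: eventually_at_top_linorder f_def F_1 intro!: exI[of _ 1])
  define \<kappa> where "\<kappa> x = interval_measure (f x)" for x
  have \<kappa>_prob: "prob_space (\<kappa> x)" for x
    using real_distribution_interval_measure[OF f_mono f_right f_bot f_top] unfolding \<kappa>_def
    by (simp add: real_distribution_def)
  have em\<kappa>: "emeasure (\<kappa> x) {..t} = F x t" for x t
    unfolding \<kappa>_def using F_top
    by (subst emeasure_interval_measure_Iic[OF f_mono f_right f_bot]) (auto simp: f_def)
  have sets_\<kappa>: "sets (\<kappa> x) = sets borel" for x by (simp add: \<kappa>_def)
  have \<kappa>[measurable]: "\<kappa> \<in> \<eta> \<rightarrow>\<^sub>M prob_algebra borel"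
  proof (rule measurable_prob_algebra_generated[where \<Omega>=UNIV and G="range atMost"])
    show "sets borel = sigma_sets UNIV (range (atMost :: real \<Rightarrow> _))"
      unfolding borel_eq_atMost by simp
    show "Int_stable (range (atMost :: real \<Rightarrow> _))"
      by (auto simp: Int_stable_def)
  qed (auto simp: \<kappa>_prob sets_\<kappa> em\<kappa>)
  \<comment> \<open>The infimum must not have changed the integrals. From below,
    \<open>D t \<le> D q\<close> holds almost everywhere for all of the countably many rational
    \<open>q > t\<close> at once. From above, \<open>F x t\<close> is at most \<open>D q x\<close>
    for a rational \<open>q\<close> just above \<open>t\<close>, and continuity of \<open>N\<close>
    from above closes the gap.\<close>
  have F_int: "(\<integral>\<^sup>+x\<in>B. F x t \<partial>\<eta>) = emeasure N (B \<times> {..t})" if B[measurable]: "B \<in> sets \<eta>" for B t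
  proof (rule antisym)
    have "AE x in \<eta>. \<forall>q\<in>Q t. c q x = D q x \<and> D t x \<le> D q x"
      using Q_count cD D_mono by (subst AE_ball_countable) (auto simp: Q_def)
    then have "AE x in \<eta>. D t x \<le> F x t"
      by eventually_elim (auto simp: F_def intro!: INF_greatest)
    then have "(\<integral>\<^sup>+x\<in>B. D t x \<partial>\<eta>) \<le> (\<integral>\<^sup>+x\<in>B. F x t \<partial>\<eta>)"
      by (intro nn_integral_mono_AE) (auto elim!: eventually_mono intro: mult_right_mono)
    then show "emeasure N (B \<times> {..t}) \<le> (\<integral>\<^sup>+x\<in>B. F x t \<partial>\<eta>)" by (simp add: D)
    have "(\<integral>\<^sup>+x\<in>B. F x t \<partial>\<eta>) \<le> emeasure N (B \<times> {..t + 1 / Suc n})" for n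
    proof -
      obtain q where q: "q \<in> \<rat>" "t < q" "q < t + 1 / Suc n" using Rats_dense_in_real[of t "t + 1 / Suc n"] by auto
      have "AE x in \<eta>. F x t \<le> D q x"
        using cD[of q] by eventually_elim (use q in \<open>auto simp: F_def Q_def intro!: INF_lower2[of q]\<close>)
      then have "(\<integral>\<^sup>+x\<in>B. F x t \<partial>\<eta>) \<le> (\<integral>\<^sup>+x\<in>B. D q x \<partial>\<eta>)"
        by (intro nn_integral_mono_AE) (auto elim!: eventually_mono intro: mult_right_mono)
      also have "\<dots> \<le> emeasure N (B \<times> {..t + 1 / Suc n})"
        unfolding D[OF B] using q by (intro emeasure_mono) auto
      finally show ?thesis .
    qed
    moreover have "(\<lambda>n. emeasure N (B \<times> {..t + 1 / Suc n})) \<longlonglongrightarrow> emeasure N (\<Inter>n. B \<times> {..t + 1 / Suc n})"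
    proof (rule Lim_emeasure_decseq)
      show "decseq (\<lambda>n. B \<times> {..t + 1 / Suc n})"
        unfolding decseq_def by (auto simp: field_simps intro: order_trans)
    qed auto
    moreover have "(\<Inter>n. B \<times> {..t + 1 / Suc n}) = B \<times> {..t}"
    proof -
      have "y \<le> t" if y: "\<And>n. y \<le> t + 1 / real (Suc n)" for y
      proof (rule field_le_epsilon)
        fix e :: real assume "0 < e"
        then obtain n where "1 / real (Suc n) < e" using nat_approx_posE by blast
        then show "y \<le> t + e" using y[of n] by simp
      qed
      then show ?thesis by (auto intro: add_increasing2)
    qed
    ultimately show "(\<integral>\<^sup>+x\<in>B. F x t \<partial>\<eta>) \<le> emeasure N (B \<times> {..t})"
      by (intro LIMSEQ_le_const) auto
  qed
  \<comment> \<open>The measure rebuilt from \<open>\<eta>\<close> and the kernel. It agrees with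
    \<open>N\<close> on the products \<open>B \<times> {..t}\<close>, which are stable under
    intersection and generate the product algebra.\<close>
  define L where "L = \<eta> \<bind> (\<lambda>x. distr (\<kappa> x) (\<eta> \<Otimes>\<^sub>M borel) (Pair x))"
  have k_meas: "(\<lambda>x. distr (\<kappa> x) (\<eta> \<Otimes>\<^sub>M borel) (Pair x)) \<in> \<eta> \<rightarrow>\<^sub>M subprob_algebra (\<eta> \<Otimes>\<^sub>M borel)"
    by (intro measurable_prob_algebraD) measurable
  have emL: "emeasure L E = (\<integral>\<^sup>+x. emeasure (\<kappa> x) (Pair x -` E) \<partial>\<eta>)" if E: "E \<in> sets (\<eta> \<Otimes>\<^sub>M borel)" for E
    unfolding L_def emeasure_bind[OF ne k_meas E]
    by (intro nn_integral_cong, subst emeasure_distr) (use E in \<open>auto simp: sets_eq_imp_space_eq[OF sets_\<kappa>] cong: measurable_cong_sets[OF sets_\<kappa>]\<close>)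
  have "N = L"
  proof (rule measure_eqI_generator_eq)
    let ?E = "{a \<times> b |a b. a \<in> sets \<eta> \<and> b \<in> range (atMost :: real \<Rightarrow> _)}"
    show "Int_stable ?E" 
      by (auto simp: Int_stable_def Times_Int_Times) blast
    show "?E \<subseteq> Pow (space \<eta> \<times> UNIV)" using sets.sets_into_space by auto
    have *: "sets (\<eta> \<Otimes>\<^sub>M (borel::real measure)) = sigma_sets (space \<eta> \<times> UNIV) ?E"
    proof -
      have "sets (\<eta> \<Otimes>\<^sub>M (borel::real measure)) = sets (sigma (space \<eta> \<times> space (borel::real measure)) ?E)"
      proof (rule sets_pair_eq[where Ca="{space \<eta>}" and Cb="range (\<lambda>n. {.. real n})"])
        show "sets borel = sigma_sets (space borel) (range (atMost :: real \<Rightarrow> _))"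
          unfolding borel_eq_atMost by simp
        show "\<Union> (range (\<lambda>n. {.. real n})) = space borel" by (auto intro: real_arch_simple)
      qed (auto simp: sets.sigma_sets_eq sets.space_closed)
      then show ?thesis using \<open>?E \<subseteq> Pow (space \<eta> \<times> UNIV)\<close> by simp
    qed
    show "sets N = sigma_sets (space \<eta> \<times> UNIV) ?E" using * sets_N by simp
    show "sets L = sigma_sets (space \<eta> \<times> UNIV) ?E" unfolding *[symmetric] L_def
      by (rule sets_bind[OF _ ne]) (use k_meas in \<open>auto dest: measurable_space simp: space_subprob_algebra\<close>)
    fix X assume "X \<in> ?E"
    then obtain B t where X: "X = B \<times> {..t}" and B: "B \<in> sets \<eta>" by auto
    have "emeasure L X = (\<integral>\<^sup>+x\<in>B. F x t \<partial>\<eta>)"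
      using B unfolding X by (subst emL) (auto intro!: nn_integral_cong simp: em\<kappa> indicator_def)
    then show "emeasure N X = emeasure L X" using F_int[OF B] X by simp
  next
    show "range (\<lambda>n. space \<eta> \<times> {.. real n}) \<subseteq> {a \<times> b |a b. a \<in> sets \<eta> \<and> b \<in> range (atMost :: real \<Rightarrow> _)}"
      by auto
    show "(\<Union>n. space \<eta> \<times> {.. real n}) = space \<eta> \<times> UNIV" by (auto intro: real_arch_simple)
  qed auto
  then show thesis using that[OF \<kappa>] emL by simp
qed


text \<open>With digits \<open>0\<close>, \<open>1\<close> in base 4 the tails are at most \<open>1/3\<close>, so the expansion is unique,
  which fails in base 2.\<close>

lemma base4_digit:
  fixes b :: "nat \<Rightarrow> int"
  assumes b: "\<And>i. b i \<in> {0, 1}"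
  shows "summable (\<lambda>i. real_of_int (b i) / 4 ^ Suc i)"
    and "0 \<le> (\<Sum>i. real_of_int (b i) / 4 ^ Suc i)" "(\<Sum>i. real_of_int (b i) / 4 ^ Suc i) \<le> 1 / 3"
    and "\<lfloor>4 ^ Suc n * (\<Sum>i. real_of_int (b i) / 4 ^ Suc i)\<rfloor> mod 4 = b n"
proof -
  have geo: "(\<lambda>i. (1 / 4) ^ Suc i) sums (1 / 3 :: real)"
    using sums_mult[OF geometric_sums[of "1 / 4 :: real"], of "1 / 4"] by simp
  have main: "summable (\<lambda>i. real_of_int (b i) / 4 ^ Suc i) \<and> 0 \<le> (\<Sum>i. real_of_int (b i) / 4 ^ Suc i)
    \<and> (\<Sum>i. real_of_int (b i) / 4 ^ Suc i) \<le> 1 / 3" if b: "\<And>i. b i \<in> {0, 1}" for b :: "nat \<Rightarrow> int"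
  proof -
    have le: "0 \<le> real_of_int (b i) / 4 ^ Suc i" "real_of_int (b i) / 4 ^ Suc i \<le> (1 / 4) ^ Suc i" for i
      using b[of i] by (auto simp: power_divide)
    have s: "summable (\<lambda>i. real_of_int (b i) / 4 ^ Suc i)"
    proof (rule summable_comparison_test'[OF sums_summable[OF geo], where N=0])
      show "norm (real_of_int (b i) / 4 ^ Suc i) \<le> (1 / 4) ^ Suc i" for i
        using b[of i] by (auto simp: power_divide)
    qed
    moreover have "(\<Sum>i. real_of_int (b i) / 4 ^ Suc i) \<le> (\<Sum>i. (1 / 4) ^ Suc i)"
      using le s sums_summable[OF geo] by (intro suminf_le) auto
    ultimately show ?thesis using le sums_unique[OF geo] by (auto intro!: suminf_nonneg)
  qed
  show s: "summable (\<lambda>i. real_of_int (b i) / 4 ^ Suc i)"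
    and "0 \<le> (\<Sum>i. real_of_int (b i) / 4 ^ Suc i)" "(\<Sum>i. real_of_int (b i) / 4 ^ Suc i) \<le> 1 / 3"
    using main[OF b] by auto
  \<comment> \<open>Multiplication by \<open>4 ^ Suc n\<close> turns the sum into the integer
    \<open>4 * I + b n\<close> plus the tail \<open>r\<close>. Since \<open>r\<close> is at most
    \<open>1/3\<close>, the floor removes exactly the tail, and reduction modulo 4 leaves the
    digit.\<close>
  define r where "r = (\<Sum>i. real_of_int (b (i + Suc n)) / 4 ^ Suc i)"
  have r: "0 \<le> r" "r \<le> 1 / 3" unfolding r_def using main[of "\<lambda>i. b (i + Suc n)"] b by auto
  define I where "I = (\<Sum>i<n. b i * 4 ^ (n - Suc i))"
  have "(\<Sum>i. real_of_int (b i) / 4 ^ Suc i) = (\<Sum>i. real_of_int (b (i + Suc n)) / 4 ^ Suc (i + Suc n))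
      + (\<Sum>i<Suc n. real_of_int (b i) / 4 ^ Suc i)"
    by (rule suminf_split_initial_segment[OF s])
  also have "(\<Sum>i. real_of_int (b (i + Suc n)) / 4 ^ Suc (i + Suc n)) = r / 4 ^ Suc n"
  proof -
    have "(\<Sum>i. real_of_int (b (i + Suc n)) / 4 ^ Suc i / 4 ^ Suc n) = r / 4 ^ Suc n"
      unfolding r_def using main[of "\<lambda>i. b (i + Suc n)"] b by (intro suminf_divide) auto
    then show ?thesis by (simp add: power_add field_simps)
  qed
  finally have "4 ^ Suc n * (\<Sum>i. real_of_int (b i) / 4 ^ Suc i)
      = r + (\<Sum>i<Suc n. real_of_int (b i) * (4 ^ Suc n / 4 ^ Suc i))"
    by (simp add: distrib_left sum_distrib_left mult_ac)
  also have "(\<Sum>i<Suc n. real_of_int (b i) * (4 ^ Suc n / 4 ^ Suc i)) = of_int (4 * I + b n)"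
  proof -
    have "(\<Sum>i<n. real_of_int (b i) * (4 ^ Suc n / 4 ^ Suc i)) = (\<Sum>i<n. 4 * (of_int (b i) * 4 ^ (n - Suc i)))"
    proof (rule sum.cong)
      fix i assume "i \<in> {..<n}"
      then have "Suc n = Suc i + Suc (n - Suc i)" by auto
      then have "(4::real) ^ Suc n = 4 ^ Suc i * 4 ^ Suc (n - Suc i)"
        by (metis power_add)
      then show "real_of_int (b i) * (4 ^ Suc n / 4 ^ Suc i) = 4 * (of_int (b i) * 4 ^ (n - Suc i))"
        by simp
    qed simp
    then show ?thesis by (simp add: I_def sum_distrib_left)
  qed
  finally have "\<lfloor>4 ^ Suc n * (\<Sum>i. real_of_int (b i) / 4 ^ Suc i)\<rfloor> = 4 * I + b n"
    using r by (intro floor_unique) auto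
  then show "\<lfloor>4 ^ Suc n * (\<Sum>i. real_of_int (b i) / 4 ^ Suc i)\<rfloor> mod 4 = b n"
    using b[of n] by auto
qed

text \<open>A point is coded by the answers to countably many questions, whether it is within
  \<open>(1/2) ^ k\<close> of the \<open>j\<close>-th point of a dense sequence, one digit for each
  pair \<open>(j, k)\<close>. Decoding takes, for each \<open>k\<close>, the first \<open>j\<close>
  with a positive answer; these points converge to the coded point.\<close>

lemma compact_metric_real_encoding:
  assumes compact: "compact (UNIV :: 'k::{metric_space, second_countable_topology} set)"
  obtains s :: "'k::{metric_space, second_countable_topology} \<Rightarrow> real" and h where
    "s \<in> borel_measurable borel" "h \<in> borel_measurable borel"
    "\<And>y. h (s y) = y" "\<And>y. s y \<in> {0..1}"
proof -
  obtain D :: "'k set" where D: "countable D" "\<And>X. open X \<Longrightarrow> X \<noteq> {} \<Longrightarrow> \<exists>d\<in>D. d \<in> X"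
    using countable_dense_exists by blast
  have "D \<noteq> {}" using D(2)[of UNIV] by auto
  define d where "d = from_nat_into D"
  have d: "\<exists>j. dist (d j) y < e" if "0 < e" for y e
  proof -
    have "ball y e \<noteq> {}" using that by simp
    then obtain z where "z \<in> D" "z \<in> ball y e" using D(2)[OF open_ball] by blast
    then obtain j where "d j = z" using from_nat_into_surj[OF D(1)] unfolding d_def by blast
    then show ?thesis using \<open>z \<in> ball y e\<close> by (auto simp: dist_commute)
  qed
  define b :: "nat \<Rightarrow> 'k \<Rightarrow> int"
    where "b i y = (if dist (d (fst (prod_decode i))) y < (1 / 2) ^ snd (prod_decode i) then 1 else 0)" for i y
  have b01: "b i y \<in> {0, 1}" for i y by (simp add: b_def)
  define s where "s y = (\<Sum>i. real_of_int (b i y) / 4 ^ Suc i)" for y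
  have [measurable]: "s \<in> borel_measurable borel"
    unfolding s_def b_def by measurable
  define dig where "dig i t \<longleftrightarrow> \<lfloor>4 ^ Suc i * t\<rfloor> mod 4 = (1::int)" for i and t :: real
  have [measurable]: "Measurable.pred borel (dig i)" for i
    unfolding dig_def by measurable
  \<comment> \<open>For \<open>t\<close> outside the range of \<open>s\<close> there may be no such
    \<open>j\<close>. The value is then unspecified, but \<open>c k\<close> is still measurable, and
    only its values on the range of \<open>s\<close> have a meaning.\<close>
  define c where "c k t = d (LEAST j. dig (prod_encode (j, k)) t)" for k t
  have [measurable]: "c k \<in> borel_measurable borel" for k
    unfolding c_def by measurable
  have c: "dist (c k (s y)) y < (1 / 2) ^ k" for k y
  proof -
    have iff: "dig (prod_encode (j, k)) (s y) \<longleftrightarrow> dist (d j) y < (1 / 2) ^ k" for j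
      unfolding dig_def s_def base4_digit(4)[OF b01] by (simp add: b_def)
    obtain j where "dist (d j) y < (1 / 2) ^ k" using d[of "(1 / 2) ^ k" y] by auto
    then show ?thesis unfolding c_def iff by (rule LeastI)
  qed
  have lim: "(\<lambda>k. c k (s y)) \<longlonglongrightarrow> y" for y
  proof (rule metric_tendsto_imp_tendsto)
    show "(\<lambda>k. (1 / 2) ^ k :: real) \<longlonglongrightarrow> 0" by (rule LIMSEQ_power_zero) simp
    show "\<forall>\<^sub>F k in sequentially. dist (c k (s y)) y \<le> dist ((1 / 2) ^ k) (0 :: real)"
      using c by (auto intro!: always_eventually less_imp_le)
  qed
  \<comment> \<open>Codes are not the only arguments of \<open>h\<close>, so convergence cannot be
    taken for granted. On \<open>C\<close> compactness supplies completeness and hence a limit; off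
    \<open>C\<close> a constant sequence keeps \<open>h\<close> a pointwise limit of measurable
    functions everywhere.\<close>
  define C where "C = {t. Cauchy (\<lambda>k. c k t)}"
  have C[measurable]: "C \<in> sets borel"
    unfolding C_def using sets_Collect_Cauchy[of c borel] by simp
  define h where "h t = lim (\<lambda>k. if t \<in> C then c k t else d 0)" for t
  have "h \<in> borel_measurable borel"
  proof (rule borel_measurable_LIMSEQ_metric)
    show "(\<lambda>t. if t \<in> C then c k t else d 0) \<in> borel_measurable borel" for k by measurable
    fix t :: real
    show "(\<lambda>k. if t \<in> C then c k t else d 0) \<longlonglongrightarrow> h t"
    proof (cases "t \<in> C")
      case True
      then have "convergent (\<lambda>k. c k t)"
        using completeE[OF compact_imp_complete[OF compact], of "\<lambda>k. c k t"]
        unfolding C_def convergent_def by blast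
      then show ?thesis using True by (simp add: h_def convergent_LIMSEQ_iff)
    qed (simp add: h_def)
  qed
  moreover have "h (s y) = y" for y
  proof -
    have "s y \<in> C" unfolding C_def using lim[of y] by (auto intro: LIMSEQ_imp_Cauchy)
    then show ?thesis using limI[OF lim[of y]] by (simp add: h_def)
  qed
  moreover have "s y \<in> {0..1}" for y
    using base4_digit(2,3)[of "\<lambda>i. b i y"] b01 by (auto simp: s_def)
  ultimately show thesis using that[of s h] by auto
qed

text \<open>The second coordinate is sent to the reals by \<open>s\<close>, disintegrated there, and
  the kernel is brought back by \<open>h\<close> and placed on the fiber over \<open>x\<close>. It
  is a probability kernel at every \<open>x\<close>, also where the marginal density vanishes. The
  base measure \<open>m\<close> replaces the marginal only in the last step.\<close>

lemma fiber_disintegration: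
  fixes P :: "('a \<times> 'k::{metric_space, second_countable_topology}) measure" and m :: "'a measure"
  assumes compact: "compact (UNIV :: 'k set)"
    and fin: "finite_measure P" and sets_P[measurable_cong]: "sets P = sets (m \<Otimes>\<^sub>M borel)"
    and m: "sigma_finite_measure m" "space m \<noteq> {}" "\<And>x. x \<in> space m \<Longrightarrow> {x} \<in> sets m"
    and ac: "absolutely_continuous m (distr P m fst)"
  obtains \<kappa> where "\<kappa> \<in> m \<rightarrow>\<^sub>M prob_algebra (m \<Otimes>\<^sub>M borel)"
    "\<And>x. x \<in> space m \<Longrightarrow> emeasure (\<kappa> x) ({x} \<times> UNIV) = 1"
    "\<And>E. E \<in> sets (m \<Otimes>\<^sub>M borel) \<Longrightarrow>
      emeasure P E = (\<integral>\<^sup>+x. RN_deriv m (distr P m fst) x * emeasure (\<kappa> x) E \<partial>m)"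
proof -
  interpret P: finite_measure P by fact
  interpret m: sigma_finite_measure m by fact
  obtain s :: "'k \<Rightarrow> real" and h where sh[measurable]: "s \<in> borel_measurable borel" "h \<in> borel_measurable borel"
    and hs: "\<And>y. h (s y) = y" and s01: "\<And>y. s y \<in> {0..1}"
    using compact_metric_real_encoding[OF compact] by metis
  define \<eta> where "\<eta> = distr P m fst"
  have sets_\<eta>[measurable_cong, simp]: "sets \<eta> = sets m" and space_\<eta>[simp]: "space \<eta> = space m"
    by (simp_all add: \<eta>_def)
  define N where "N = distr P (\<eta> \<Otimes>\<^sub>M borel) (\<lambda>z. (fst z, s (snd z)))"
  have sN[measurable_cong]: "sets N = sets (\<eta> \<Otimes>\<^sub>M borel)" by (simp add: N_def)
  have 1: "finite_measure N" unfolding N_def by (rule P.finite_measure_distr) simp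
  have 2: "distr N \<eta> fst = \<eta>"
    unfolding N_def by (subst distr_distr) (auto simp: comp_def \<eta>_def intro!: distr_cong)
  have 3: "AE z in N. snd z \<in> {0..1}"
  proof -
    have "{z \<in> space (\<eta> \<Otimes>\<^sub>M borel). snd z \<in> {0..1::real}} \<in> sets (\<eta> \<Otimes>\<^sub>M borel)" by measurable
    then show ?thesis unfolding N_def using s01 by (subst AE_distr_iff) auto
  qed
  obtain \<kappa>0 where k0[measurable]: "\<kappa>0 \<in> \<eta> \<rightarrow>\<^sub>M prob_algebra borel" and
    k0E: "\<And>E. E \<in> sets (\<eta> \<Otimes>\<^sub>M borel) \<Longrightarrow> emeasure N E = (\<integral>\<^sup>+x. emeasure (\<kappa>0 x) (Pair x -` E) \<partial>\<eta>)"
    by (rule real_disintegration[OF 1 sN 2 _ 3]) (use m(2) in auto)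
  define \<kappa> where "\<kappa> x = distr (\<kappa>0 x) (m \<Otimes>\<^sub>M borel) (\<lambda>t. (x, h t))" for x
  have k[measurable]: "\<kappa> \<in> m \<rightarrow>\<^sub>M prob_algebra (m \<Otimes>\<^sub>M borel)"
    unfolding \<kappa>_def by measurable
  have k0x: "sets (\<kappa>0 x) = sets borel" "space (\<kappa>0 x) = UNIV" "prob_space (\<kappa>0 x)" if "x \<in> space m" for x
  proof -
    have "\<kappa>0 x \<in> space (prob_algebra borel)" using measurable_space[OF k0] that by simp
    then show "sets (\<kappa>0 x) = sets borel" "prob_space (\<kappa>0 x)" by (auto simp: space_prob_algebra)
    then show "space (\<kappa>0 x) = UNIV" using sets_eq_imp_space_eq by fastforce
  qed
  have emk: "emeasure (\<kappa> x) E = emeasure (\<kappa>0 x) {t. (x, h t) \<in> E}"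
    if x: "x \<in> space m" and E: "E \<in> sets (m \<Otimes>\<^sub>M borel)" for x E
    unfolding \<kappa>_def using x E
    by (subst emeasure_distr) (auto simp: k0x vimage_def measurable_cong_sets[OF k0x(1)[OF x] refl])
  have "emeasure (\<kappa> x) ({x} \<times> UNIV) = 1" if x: "x \<in> space m" for x
  proof -
    interpret prob_space "\<kappa>0 x" by (rule k0x[OF x])
    show ?thesis using emeasure_space_1 m(3)[OF x] by (subst emk[OF x]) (auto simp: k0x[OF x])
  qed
  moreover have "emeasure P E = (\<integral>\<^sup>+x. RN_deriv m (distr P m fst) x * emeasure (\<kappa> x) E \<partial>m)"
    if E[measurable]: "E \<in> sets (m \<Otimes>\<^sub>M borel)" for E
  proof -
    \<comment> \<open>Taking the preimage under \<open>h\<close>, not the image under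
      \<open>s\<close>, makes measurability immediate; pulling \<open>E'\<close> back by
      \<open>s\<close> returns \<open>E\<close> because \<open>h (s y) = y\<close>.\<close>
    define E' where "E' = {z \<in> space (\<eta> \<Otimes>\<^sub>M borel). (fst z, h (snd z)) \<in> E}"
    have E'[measurable]: "E' \<in> sets (\<eta> \<Otimes>\<^sub>M borel)" unfolding E'_def by measurable
    have "sets (\<eta> \<Otimes>\<^sub>M (borel :: real measure)) = sets (m \<Otimes>\<^sub>M borel)"
      by (rule sets_pair_measure_cong) simp_all
    then have [measurable]: "E' \<in> sets (m \<Otimes>\<^sub>M borel)" using E' by simp
    have "emeasure N E' = emeasure P ((\<lambda>z. (fst z, s (snd z))) -` E' \<inter> space P)"
      unfolding N_def by (subst emeasure_distr) auto
    also have "(\<lambda>z. (fst z, s (snd z))) -` E' \<inter> space P = E"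
      using sets.sets_into_space[OF E] sets_eq_imp_space_eq[OF sets_P]
      by (auto simp: E'_def hs space_pair_measure)
    finally have "emeasure P E = (\<integral>\<^sup>+x. emeasure (\<kappa>0 x) (Pair x -` E') \<partial>\<eta>)" by (simp add: k0E)
    also have "\<dots> = (\<integral>\<^sup>+x. emeasure (\<kappa> x) E \<partial>\<eta>)"
      by (intro nn_integral_cong) (auto simp: emk[OF _ E] E'_def vimage_def space_pair_measure)
    also have "\<dots> = (\<integral>\<^sup>+x. RN_deriv m (distr P m fst) x * emeasure (\<kappa> x) E \<partial>m)"
    proof -
      have "(\<lambda>x. emeasure (\<kappa> x) E) \<in> borel_measurable m"
        using measurable_prob_algebraD[OF k] by measurable
      then show ?thesis unfolding \<eta>_def by (intro m.RN_deriv_nn_integral ac) auto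
    qed
    finally show ?thesis .
  qed
  ultimately show thesis using that[OF k] by blast
qed

section \<open>Invariant densities on the subshift\<close>

lemma mat_power_pos_imp_path:
  assumes "transition_matrix A" and "mat_power A n $ i $ j > 0"
  shows "\<exists>w. w 0 = i \<and> w n = j \<and> (\<forall>k<n. A $ (w k) $ (w (Suc k)) = 1)"
  using assms(2)
proof (induction n arbitrary: i)
  case 0
  then have "i = j" by (simp add: mat_power_def mat_def split: if_splits)
  then show ?case by (intro exI[of _ "\<lambda>_. i"]) simp
next
  case (Suc n)
  have "mat_power A (Suc n) $ i $ j = (\<Sum>k\<in>UNIV. A $ i $ k * mat_power A n $ k $ j)"
    by (simp add: mat_power_def matrix_matrix_mult_def)
  with Suc.prems have "(\<Sum>k\<in>UNIV. A $ i $ k * mat_power A n $ k $ j) \<noteq> 0"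
    by linarith
  then obtain k where "A $ i $ k * mat_power A n $ k $ j \<noteq> 0"
    by (rule sum.not_neutral_contains_not_neutral)
  then have k: "A $ i $ k = 1" "mat_power A n $ k $ j > 0"
    using assms(1) unfolding transition_matrix_def by (metis insert_iff mult_is_0 singletonD, simp)
  from Suc.IH[OF k(2)] obtain w where w: "w 0 = k" "w n = j" "\<forall>l<n. A $ (w l) $ (w (Suc l)) = 1"
    by blast
  then show ?case
    using k(1) by (intro exI[of _ "case_nat i w"]) (auto simp: less_Suc_eq_0_disj split: nat.split)
qed

lemma prod_lessThan_add:
  fixes f :: "nat \<Rightarrow> 'a::comm_monoid_mult"
  shows "(\<Prod>i<a + b. f i) = (\<Prod>i<a. f i) * (\<Prod>i<b. f (a + i))"
  by (induction b) (simp_all add: mult_ac)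

lemma d_theta_summable:
  assumes "0 < \<theta>" "\<theta> < 1"
  shows "summable (\<lambda>i. \<theta> ^ i * (1 - (if x i = y i then 1 else 0)) :: real)"
  using assms by (intro summable_comparison_test'[OF summable_geometric[of \<theta>], where N=0]) auto

lemma d_theta_le:
  assumes \<theta>: "0 < \<theta>" "\<theta> < 1" and eq: "\<And>t. t < k \<Longrightarrow> x t = y t"
  shows "d_theta \<theta> x y \<le> \<theta> ^ k / (1 - \<theta>)"
proof -
  let ?f = "\<lambda>i. \<theta> ^ i * (1 - (if x i = y i then 1 else 0)) :: real"
  have "d_theta \<theta> x y = (\<Sum>i. ?f (i + k)) + (\<Sum>i<k. ?f i)"
    unfolding d_theta_def by (rule suminf_split_initial_segment[OF d_theta_summable[OF \<theta>]])
  also have "(\<Sum>i<k. ?f i) = 0" using eq by (intro sum.neutral) auto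
  also have "(\<Sum>i. ?f (i + k)) \<le> (\<Sum>i. \<theta> ^ k * \<theta> ^ i)"
    using \<theta> by (intro suminf_le summable_mult summable_geometric
        summable_ignore_initial_segment[OF d_theta_summable[OF \<theta>]]) (auto simp: power_add)
  also have "\<dots> = \<theta> ^ k / (1 - \<theta>)"
    using \<theta> by (subst suminf_mult) (auto simp: suminf_geometric summable_geometric)
  finally show ?thesis by simp
qed

lemma d_theta_pos:
  assumes \<theta>: "0 < \<theta>" "\<theta> < 1" and "x \<noteq> y"
  shows "0 < d_theta \<theta> x y"
proof -
  obtain i where "x i \<noteq> y i" using assms(3) by blast
  then show ?thesis
    unfolding d_theta_def using \<theta> by (intro suminf_pos2[OF d_theta_summable[OF \<theta>], where i=i]) auto
qed

text \<open>Two points agreeing in their first \<open>k\<close> coordinates are at distance at most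
  the geometric tail \<open>\<theta> ^ k / (1 - \<theta>)\<close>. This turns the Lipschitz
  condition into a bound on cylinders, the sets whose measure is known.\<close>

lemma F_theta_variation:
  assumes \<theta>: "0 < \<theta>" "\<theta> < 1" and f: "f \<in> F_theta \<theta> A"
  obtains L where "0 \<le> L" "\<And>k x y. x \<in> shift_space A \<Longrightarrow> y \<in> shift_space A \<Longrightarrow>
      (\<And>t. t < k \<Longrightarrow> x t = y t) \<Longrightarrow> \<bar>f x - f y\<bar> \<le> L * \<theta> ^ k"
proof -
  define l where "l = enn2real (lip_theta \<theta> A f)"
  have fin: "lip_theta \<theta> A f < \<top>" using f by (simp add: F_theta_def)
  have l: "\<bar>f x - f y\<bar> \<le> l * d_theta \<theta> x y" if "x \<in> shift_space A" "y \<in> shift_space A" for x y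
  proof (cases "x = y")
    case False
    then have d: "0 < d_theta \<theta> x y" by (rule d_theta_pos[OF \<theta>])
    have "ennreal (\<bar>f x - f y\<bar> / d_theta \<theta> x y) \<le> lip_theta \<theta> A f"
      unfolding lip_theta_def using that by (intro SUP_upper2[of x] SUP_upper) auto
    also have "\<dots> = ennreal l" using fin by (simp add: l_def)
    finally have "\<bar>f x - f y\<bar> / d_theta \<theta> x y \<le> l"
      by (subst (asm) ennreal_le_iff) (simp_all add: l_def)
    then show ?thesis using d by (simp add: field_simps)
  qed (simp add: d_theta_def)
  show thesis
  proof (rule that[of "l / (1 - \<theta>)"])
    show "0 \<le> l / (1 - \<theta>)" using \<theta> by (simp add: l_def)
    fix k x y assume "x \<in> shift_space A" "y \<in> shift_space A" "\<And>t. t < k \<Longrightarrow> x t = y t"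
    then have "\<bar>f x - f y\<bar> \<le> l * d_theta \<theta> x y" "l * d_theta \<theta> x y \<le> l * (\<theta> ^ k / (1 - \<theta>))"
      using l d_theta_le[OF \<theta>, of k x y] by (blast, intro mult_left_mono) (auto simp: l_def)
    then show "\<bar>f x - f y\<bar> \<le> l / (1 - \<theta>) * \<theta> ^ k" by simp
  qed
qed

lemma space_markov_measure:
  assumes "markov_measure A p m"
  shows "space m = shift_space A"
  using assms sets_eq_imp_space_eq[of m "shift_algebra A"]
  by (simp add: markov_measure_def shift_algebra_def space_restrict_space space_PiM)

text \<open>Moving the word one place to the left means summing over the symbol in front of it, and
  this sum collapses by the stationarity \<open>p v* P = p\<close>.\<close>

lemma markov_measure_cylinder_shift:
  assumes m: "markov_measure A p m"
  shows "{x \<in> shift_space A. \<forall>t\<le>l. x (n + t) = v t} \<in> sets m"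
    and "measure m {x \<in> shift_space A. \<forall>t\<le>l. x (n + t) = v t} = measure m {x \<in> shift_space A. \<forall>t\<le>l. x t = v t}"
proof -
  have sets_m[measurable_cong]: "sets m = sets (shift_algebra A)" and prob: "prob_space m"
    using m by (auto simp: markov_measure_def)
  interpret prob_space m by (rule prob)
  have "space m = shift_space A" by (rule space_markov_measure[OF m])
  have coord[measurable]: "(\<lambda>x. x i) \<in> m \<rightarrow>\<^sub>M count_space UNIV" for i
    unfolding measurable_cong_sets[OF sets_m refl] shift_algebra_def
    by (intro measurable_restrict_space1) measurable
  have meas: "{x \<in> shift_space A. \<forall>t\<le>l. x (n + t) = v t} \<in> sets m" for n l v
    unfolding \<open>space m = shift_space A\<close>[symmetric] by measurable
  then show "{x \<in> shift_space A. \<forall>t\<le>l. x (n + t) = v t} \<in> sets m" .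
  obtain P :: "real^'a^'a" where stat: "p v* P = p" and
    cyl: "\<And>w n. measure m {x \<in> shift_space A. \<forall>k\<le>n. x k = w k} = p $ (w 0) * (\<Prod>k<n. P $ (w k) $ (w (Suc k)))"
    using m unfolding markov_measure_def by blast
  show "measure m {x \<in> shift_space A. \<forall>t\<le>l. x (n + t) = v t} = measure m {x \<in> shift_space A. \<forall>t\<le>l. x t = v t}"
  proof (induction n arbitrary: v l)
    case (Suc n)
    let ?S = "\<lambda>i. {x \<in> shift_space A. \<forall>t\<le>Suc l. x (n + t) = case_nat i v t}"
    have "{x \<in> shift_space A. \<forall>t\<le>l. x (Suc n + t) = v t} = (\<Union>i. ?S i)"
    proof (intro set_eqI iffI)
      fix x assume "x \<in> {x \<in> shift_space A. \<forall>t\<le>l. x (Suc n + t) = v t}"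
      then have "x \<in> ?S (x n)" by (auto split: nat.split)
      then show "x \<in> (\<Union>i. ?S i)" by blast
    next
      fix x assume "x \<in> (\<Union>i. ?S i)"
      then obtain i where x: "x \<in> shift_space A" and e: "\<And>t. t \<le> Suc l \<Longrightarrow> x (n + t) = case_nat i v t" by blast
      have "x (Suc n + t) = v t" if "t \<le> l" for t using e[of "Suc t"] that by simp
      then show "x \<in> {x \<in> shift_space A. \<forall>t\<le>l. x (Suc n + t) = v t}" using x by simp
    qed
    also have "measure m (\<Union>i. ?S i) = (\<Sum>i\<in>UNIV. measure m (?S i))"
    proof (rule finite_measure_finite_Union)
      show "disjoint_family ?S"
        unfolding disjoint_family_on_def
      proof (intro ballI impI equals0I)
        fix i j x assume "i \<noteq> j" "x \<in> ?S i \<inter> ?S j"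
        then have "x (n + 0) = case_nat i v 0" "x (n + 0) = case_nat j v 0" by fast+
        then show False using \<open>i \<noteq> j\<close> by simp
      qed
      show "?S ` UNIV \<subseteq> sets m" by (intro image_subsetI meas)
    qed simp
    also have "\<dots> = (\<Sum>i\<in>UNIV. P $ i $ v 0 * p $ i * (\<Prod>k<l. P $ (v k) $ (v (Suc k))))"
      unfolding Suc.IH cyl by (intro sum.cong) (simp_all add: prod.lessThan_Suc_shift mult_ac del: prod.lessThan_Suc)
    also have "\<dots> = (p v* P) $ v 0 * (\<Prod>k<l. P $ (v k) $ (v (Suc k)))"
      by (simp add: vector_matrix_mult_def sum_distrib_right mult.commute[of "P $ _ $ _"])
    finally show ?case unfolding stat cyl .
  qed simp
qed

text \<open>Aperiodicity provides one length \<open>n0\<close> such that any symbol can be joined to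
  any other by an admissible path of that length. Inserting such a path between two words costs at
  most the factor \<open>c\<close>, the smallest weight of the finitely many chosen paths.\<close>

lemma markov_measure_positive_mixing:
  fixes A :: "nat^'n^'n"
  assumes A: "transition_matrix A" "aperiodic A" and m: "markov_measure A p m"
  obtains c n0 where "0 < c"
    "\<And>y l. y \<in> shift_space A \<Longrightarrow> 0 < measure m {x \<in> shift_space A. \<forall>t\<le>l. x t = y t}"
    "\<And>u v k l. c * measure m {x \<in> shift_space A. \<forall>t\<le>k. x t = u t} * measure m {x \<in> shift_space A. \<forall>t\<le>l. x t = v t}
       \<le> measure m {x \<in> shift_space A. (\<forall>t\<le>k. x t = u t) \<and> (\<forall>t\<le>l. x (k + n0 + t) = v t)}"
proof -
  interpret prob_space m using m by (simp add: markov_measure_def)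
  obtain P :: "real^'n^'n" where P: "\<And>i j. 0 < P $ i $ j \<longleftrightarrow> A $ i $ j = 1" "\<And>i j. 0 \<le> P $ i $ j"
    and stat: "p v* P = p" and
    cyl: "\<And>w n. measure m {x \<in> shift_space A. \<forall>k\<le>n. x k = w k} = p $ (w 0) * (\<Prod>k<n. P $ (w k) $ (w (Suc k)))"
    using m unfolding markov_measure_def by blast
  have p0: "\<And>i. 0 \<le> p $ i" and p1: "(\<Sum>i\<in>UNIV. p $ i) = 1"
    using m unfolding markov_measure_def by auto
  obtain n0 where "\<And>i j. mat_power A n0 $ i $ j > 0" using A(2) unfolding aperiodic_def by blast
  then have "\<forall>i j. \<exists>w. w 0 = i \<and> w n0 = j \<and> (\<forall>k<n0. A $ (w k) $ (w (Suc k)) = 1)"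
    using mat_power_pos_imp_path[OF A(1)] by blast
  then obtain W where W: "\<And>i j. W i j 0 = i" "\<And>i j. W i j n0 = j"
    "\<And>i j k. k < n0 \<Longrightarrow> A $ (W i j k) $ (W i j (Suc k)) = 1"
    by metis
  have p_step: "0 < p $ j" if "0 < p $ i" "A $ i $ j = 1" for i j
  proof -
    have "0 < P $ i $ j * p $ i" using that P by simp
    also have "\<dots> \<le> (\<Sum>i\<in>UNIV. P $ i $ j * p $ i)"
      using P p0 by (intro member_le_sum) auto
    also have "\<dots> = (p v* P) $ j" by (simp add: vector_matrix_mult_def mult.commute)
    finally show ?thesis unfolding stat .
  qed
  \<comment> \<open>Some entry of \<open>p\<close> is positive because they sum to 1; stationarity
    carries positivity along the path from that symbol to \<open>j\<close>.\<close>
  have p_pos: "0 < p $ j" for j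
  proof -
    have "(\<Sum>i\<in>UNIV. p $ i) \<noteq> 0" using p1 by simp
    then obtain i where "p $ i \<noteq> 0" by (rule sum.not_neutral_contains_not_neutral)
    then have i: "0 < p $ i" using p0[of i] by simp
    have "k \<le> n0 \<Longrightarrow> 0 < p $ (W i j k)" for k
      by (induction k) (use i W p_step in \<open>auto simp: Suc_le_eq\<close>)
    then show ?thesis using W(2)[of i j] by (metis order_refl)
  qed
  have p_le: "p $ j \<le> 1" for j
    using member_le_sum[of j UNIV "\<lambda>i. p $ i"] p0 p1 by simp
  define c where "c = (MIN (i, j)\<in>UNIV. \<Prod>k<n0. P $ (W i j k) $ (W i j (Suc k)))"
  show thesis
  proof (rule that[of c n0])
    have "0 < (\<Prod>k<n0. P $ (W i j k) $ (W i j (Suc k)))" for i j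
      using W(3) P by (intro prod_pos) auto
    then show "0 < c" unfolding c_def by (subst Min_gr_iff) auto
    show "0 < measure m {x \<in> shift_space A. \<forall>t\<le>l. x t = y t}" if "y \<in> shift_space A" for y l
      unfolding cyl using that P p_pos by (intro mult_pos_pos prod_pos) (auto simp: shift_space_def)
    fix u v k l
    \<comment> \<open>The word \<open>u\<close>, then the connecting path from \<open>u k\<close> to
      \<open>v 0\<close>, then \<open>v\<close>. The pieces share the symbols at positions
      \<open>k\<close> and \<open>k + n0\<close>.\<close>
    define z where "z t = (if t \<le> k then u t else if t \<le> k + n0 then W (u k) (v 0) (t - k) else v (t - k - n0))" for t
    have z: "\<And>t. t \<le> k \<Longrightarrow> z t = u t" "\<And>t. t \<le> n0 \<Longrightarrow> z (k + t) = W (u k) (v 0) t"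
      "\<And>t. z (k + n0 + t) = v t"
      unfolding z_def using W(1,2) by (auto simp: le_Suc_eq)
    have nn: "0 \<le> (\<Prod>k<n. P $ (w k) $ (w (Suc k)))" for w n
      using P by (intro prod_nonneg) auto
    \<comment> \<open>In the joined word \<open>v 0\<close> is no longer an initial symbol, so its
      weight \<open>p $ (v 0)\<close> has no counterpart there and is estimated by 1.\<close>
    have "c \<le> (\<Prod>t<n0. P $ (W (u k) (v 0) t) $ (W (u k) (v 0) (Suc t)))"
      unfolding c_def by (intro Min_le) auto
    then have "c * measure m {x \<in> shift_space A. \<forall>t\<le>k. x t = u t} * measure m {x \<in> shift_space A. \<forall>t\<le>l. x t = v t}
      \<le> (\<Prod>t<n0. P $ (W (u k) (v 0) t) $ (W (u k) (v 0) (Suc t))) * (p $ (u 0) * (\<Prod>t<k. P $ (u t) $ (u (Suc t))))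
         * (1 * (\<Prod>t<l. P $ (v t) $ (v (Suc t))))"
      unfolding cyl using nn p0 p_le
      by (intro mult_mono mult_nonneg_nonneg) auto
    also have "\<dots> = p $ (z 0) * (\<Prod>t<k + n0 + l. P $ (z t) $ (z (Suc t)))"
    proof -
      have "(\<Prod>t<k. P $ (z t) $ (z (Suc t))) = (\<Prod>t<k. P $ (u t) $ (u (Suc t)))"
        using z(1) by (intro prod.cong) auto
      moreover have "(\<Prod>t<n0. P $ (z (k + t)) $ (z (Suc (k + t)))) = (\<Prod>t<n0. P $ (W (u k) (v 0) t) $ (W (u k) (v 0) (Suc t)))"
        using z(2) z(2)[of "Suc t" for t] by (intro prod.cong) auto
      moreover have "(\<Prod>t<l. P $ (z (k + n0 + t)) $ (z (Suc (k + n0 + t)))) = (\<Prod>t<l. P $ (v t) $ (v (Suc t)))"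
        using z(3) z(3)[of "Suc t" for t] by (intro prod.cong) auto
      moreover have "z 0 = u 0" using z(1)[of 0] by simp
      ultimately show ?thesis by (simp add: prod_lessThan_add mult_ac)
    qed
    also have "\<dots> = measure m {x \<in> shift_space A. \<forall>t\<le>k + n0 + l. x t = z t}" by (simp add: cyl)
    also have "\<dots> \<le> measure m {x \<in> shift_space A. (\<forall>t\<le>k. x t = u t) \<and> (\<forall>t\<le>l. x (k + n0 + t) = v t)}"
    proof (rule finite_measure_mono)
      show "{x \<in> shift_space A. \<forall>t\<le>k + n0 + l. x t = z t}
        \<subseteq> {x \<in> shift_space A. (\<forall>t\<le>k. x t = u t) \<and> (\<forall>t\<le>l. x (k + n0 + t) = v t)}"
        using z(1,3) by auto
      have "{x \<in> shift_space A. \<forall>t\<le>k. x (0 + t) = u t} \<inter> {x \<in> shift_space A. \<forall>t\<le>l. x (k + n0 + t) = v t} \<in> sets m"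
        by (intro sets.Int markov_measure_cylinder_shift(1)[OF m])
      also have "{x \<in> shift_space A. \<forall>t\<le>k. x (0 + t) = u t} \<inter> {x \<in> shift_space A. \<forall>t\<le>l. x (k + n0 + t) = v t} 
         = {x \<in> shift_space A. (\<forall>t\<le>k. x t = u t) \<and> (\<forall>t\<le>l. x (k + n0 + t) = v t)}" by auto
      finally show "{x \<in> shift_space A. (\<forall>t\<le>k. x t = u t) \<and> (\<forall>t\<le>l. x (k + n0 + t) = v t)} \<in> sets m" .
    qed
    finally show "c * measure m {x \<in> shift_space A. \<forall>t\<le>k. x t = u t} * measure m {x \<in> shift_space A. \<forall>t\<le>l. x t = v t}
       \<le> measure m {x \<in> shift_space A. (\<forall>t\<le>k. x t = u t) \<and> (\<forall>t\<le>l. x (k + n0 + t) = v t)}" .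
  qed
qed


text \<open>The Lipschitz version \<open>f\<close> is defined at every point, so its infimum
  \<open>a\<close> can be approached at actual points, around which a whole cylinder, of positive
  measure, has density close to \<open>a\<close>. Invariance moves such a cylinder into the far
  future without changing its mass, where mixing makes it meet every other cylinder.\<close>

lemma markov_measure_unique_invariant_density:
  fixes A :: "nat^'n^'n"
  assumes \<theta>: "0 < \<theta>" "\<theta> < 1"
    and A: "transition_matrix A" "aperiodic A" and m: "markov_measure A p m"
    and \<eta>: "prob_space \<eta>" "sets \<eta> = sets m" "absolutely_continuous m \<eta>"
    and f: "f \<in> F_theta \<theta> A" "AE x in m. enn2real (RN_deriv m \<eta> x) = f x"
    and inv: "\<And>B. B \<in> sets m \<Longrightarrow> measure \<eta> {x \<in> space m. shift x \<in> B} = measure \<eta> B"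
  shows "\<eta> = m"
proof -
  interpret m: prob_space m using m by (simp add: markov_measure_def)
  interpret \<eta>: prob_space \<eta> by fact
  let ?X = "shift_space A"
  define S where "S n l v = {x \<in> ?X. \<forall>t\<le>l. x (n + t) = v t}" for n l and v :: "nat \<Rightarrow> 'n"
  have space_m: "space m = ?X"
    by (rule space_markov_measure[OF m])
  have S[measurable]: "S n l v \<in> sets m" for n l v
    unfolding S_def by (rule markov_measure_cylinder_shift[OF m])
  have mS: "measure m (S n l v) = measure m (S 0 l v)" for n l v
    unfolding S_def using markov_measure_cylinder_shift(2)[OF m] by simp
  have \<eta>S: "measure \<eta> (S n l v) = measure \<eta> (S 0 l v)" for n l v
  proof (induction n)
    case (Suc n)
    have "{x \<in> space m. shift x \<in> S n l v} = S (Suc n) l v"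
      unfolding space_m S_def shift_def by (auto simp: shift_space_def)
    then show ?case using inv[OF S[of n l v]] Suc by simp
  qed simp
  define \<phi> where "\<phi> x = enn2real (RN_deriv m \<eta> x)" for x
  have [measurable]: "\<phi> \<in> borel_measurable m" unfolding \<phi>_def by measurable
  have fin: "AE x in m. RN_deriv m \<eta> x \<noteq> \<infinity>"
    by (rule m.RN_deriv_finite[OF _ \<eta>(3,2)]) unfold_locales
  have em: "emeasure \<eta> B = (\<integral>\<^sup>+x\<in>B. ennreal (\<phi> x) \<partial>m)" if "B \<in> sets m" for B
  proof -
    have "emeasure \<eta> B = emeasure (density m (RN_deriv m \<eta>)) B"
      using m.density_RN_deriv[OF \<eta>(3,2)] by simp
    also have "\<dots> = (\<integral>\<^sup>+x\<in>B. RN_deriv m \<eta> x \<partial>m)" using that by (simp add: emeasure_density)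
    also have "\<dots> = (\<integral>\<^sup>+x\<in>B. ennreal (\<phi> x) \<partial>m)"
      using fin by (intro nn_integral_cong_AE) (auto elim!: eventually_mono simp: \<phi>_def less_top)
    finally show ?thesis .
  qed
  have int\<phi>: "integrable m \<phi>"
  proof (rule integrableI_nonneg)
    have "(\<integral>\<^sup>+x. ennreal (\<phi> x) \<partial>m) = emeasure \<eta> (space m)"
      by (subst em) (auto intro!: nn_integral_cong)
    then show "(\<integral>\<^sup>+x. ennreal (\<phi> x) \<partial>m) < \<infinity>" by (simp add: less_top[symmetric])
  qed (auto simp: \<phi>_def)
  have intB: "integrable m (\<lambda>x. \<phi> x * indicator B x)" if "B \<in> sets m" for B
    using integrable_mult_indicator[OF that int\<phi>] by (simp add: mult.commute)
  have meas: "measure \<eta> B = (\<integral>x. \<phi> x * indicator B x \<partial>m)" if B[measurable]: "B \<in> sets m" for B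
  proof -
    have "emeasure \<eta> B = (\<integral>\<^sup>+x. ennreal (\<phi> x * indicator B x) \<partial>m)"
      unfolding em[OF B] by (intro nn_integral_cong) (auto simp: indicator_def)
    also have "\<dots> = ennreal (\<integral>x. \<phi> x * indicator B x \<partial>m)"
      by (rule nn_integral_eq_integral[OF intB[OF B]]) (simp add: \<phi>_def)
    finally have e: "emeasure \<eta> B = ennreal (\<integral>x. \<phi> x * indicator B x \<partial>m)" .
    show ?thesis unfolding measure_def e
      by (auto intro!: integral_nonneg simp: \<phi>_def)
  qed
  have \<phi>f: "AE x in m. \<phi> x = f x" using f(2) unfolding \<phi>_def .
  have indI: "integrable m (\<lambda>x. b * indicator B x)" if "B \<in> sets m" for B and b :: real
    using that by (intro integrable_mult_right integrable_real_indicator) (auto simp: less_top[symmetric])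
  have lower: "b * measure m B \<le> measure \<eta> B" if B[measurable]: "B \<in> sets m" and b: "\<And>x. x \<in> B \<Longrightarrow> b \<le> f x" for B b
  proof -
    have "b * measure m B = (\<integral>x. b * indicator B x \<partial>m)" by simp
    also have "\<dots> \<le> (\<integral>x. \<phi> x * indicator B x \<partial>m)"
    proof (intro integral_mono_AE indI[OF B] intB[OF B])
      show "AE x in m. b * indicator B x \<le> \<phi> x * indicator B x"
        using \<phi>f by eventually_elim (simp add: indicator_def b)
    qed
    finally show ?thesis by (simp add: meas)
  qed
  have upper: "measure \<eta> B \<le> b * measure m B" if B[measurable]: "B \<in> sets m" and b: "\<And>x. x \<in> B \<Longrightarrow> f x \<le> b" for B b
  proof -
    have "(\<integral>x. \<phi> x * indicator B x \<partial>m) \<le> (\<integral>x. b * indicator B x \<partial>m)"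
    proof (intro integral_mono_AE indI[OF B] intB[OF B])
      show "AE x in m. \<phi> x * indicator B x \<le> b * indicator B x"
        using \<phi>f by eventually_elim (simp add: indicator_def b)
    qed
    then show ?thesis by (simp add: meas)
  qed
  obtain L where L: "0 \<le> L" "\<And>k x y. x \<in> ?X \<Longrightarrow> y \<in> ?X \<Longrightarrow> (\<And>t. t < k \<Longrightarrow> x t = y t) \<Longrightarrow> \<bar>f x - f y\<bar> \<le> L * \<theta> ^ k"
    using F_theta_variation[OF \<theta> f(1)] by blast
  obtain c n0 where c: "0 < c" "\<And>y l. y \<in> ?X \<Longrightarrow> 0 < measure m (S 0 l y)"
    "\<And>u v k l. c * measure m (S 0 k u) * measure m (S 0 l v) \<le> measure m (S 0 k u \<inter> S (k + n0) l v)"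
  proof (rule markov_measure_positive_mixing[OF A m])
    fix c n0 assume 1: "0 < c" "\<And>y l. y \<in> ?X \<Longrightarrow> 0 < measure m {x \<in> ?X. \<forall>t\<le>l. x t = y t}"
      and 2: "\<And>u v k l. c * measure m {x \<in> ?X. \<forall>t\<le>k. x t = u t} * measure m {x \<in> ?X. \<forall>t\<le>l. x t = v t}
       \<le> measure m {x \<in> ?X. (\<forall>t\<le>k. x t = u t) \<and> (\<forall>t\<le>l. x (k + n0 + t) = v t)}"
    have "S 0 k u \<inter> S (k + n0) l v = {x \<in> ?X. (\<forall>t\<le>k. x t = u t) \<and> (\<forall>t\<le>l. x (k + n0 + t) = v t)}" for k u l v
      by (auto simp: S_def)
    then show thesis using that[of c n0] 1 2 by (simp add: S_def)
  qed
  have ne: "?X \<noteq> {}" using m.not_empty space_m by simp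
  then obtain x0 where x0: "x0 \<in> ?X" by blast
  have bdd: "bdd_below (f ` ?X)"
  proof (rule bdd_belowI2)
    fix x assume "x \<in> ?X"
    then have "\<bar>f x0 - f x\<bar> \<le> L * \<theta> ^ 0" by (intro L(2) x0) auto
    then show "f x0 - L \<le> f x" by simp
  qed
  define a where "a = Inf (f ` ?X)"
  have a: "a \<le> f x" if "x \<in> ?X" for x unfolding a_def using bdd that by (intro cINF_lower) auto
  have S_sub: "S n l v \<subseteq> ?X" for n l v by (auto simp: S_def)
  \<comment> \<open>\<open>\<eta> - a m\<close> is positive and invariant, and the mixing bound spreads its mass near \<open>x\<close> over every
    cylinder around \<open>y\<close>. Taking \<open>y\<close> close to the infimum \<open>a\<close> forces \<open>f x = a\<close>.\<close>
  have key: "(f x - L * \<theta> ^ Suc k - a) * (c * measure m (S 0 k x)) \<le> f y - a + L * \<theta> ^ Suc l"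
    if x: "x \<in> ?X" and y: "y \<in> ?X" for x y k l
  proof -
    \<comment> \<open>\<open>T\<close> is the preimage of the cylinder around \<open>y\<close> under
      \<open>k + n0\<close> shifts, with the same mass as that cylinder under both measures. On its
      part \<open>W\<close> in the cylinder around \<open>x\<close> the density is almost
      \<open>f x\<close>; on the rest only the lower bound \<open>a\<close> is available. The
      exponents are \<open>Suc k\<close> and \<open>Suc l\<close> because the cylinders fix the
      coordinates up to and including \<open>k\<close> and \<open>l\<close>.\<close>
    define T where "T = S (k + n0) l y"
    define W where "W = S 0 k x \<inter> T"
    have [measurable]: "T \<in> sets m" "W \<in> sets m" by (auto simp: T_def W_def)
    have mV: "0 < measure m (S 0 l y)" by (rule c(2)[OF y])
    have "(f x - L * \<theta> ^ Suc k) * measure m W \<le> measure \<eta> W"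
    proof (rule lower)
      fix z assume z: "z \<in> W"
      then have "\<bar>f x - f z\<bar> \<le> L * \<theta> ^ Suc k"
        by (intro L(2) x) (auto simp: W_def S_def less_Suc_eq_le)
      then show "f x - L * \<theta> ^ Suc k \<le> f z" by simp
    qed simp
    moreover have "a * measure m (T - W) \<le> measure \<eta> (T - W)"
    proof (rule lower)
      show "a \<le> f z" if "z \<in> T - W" for z
        using that S_sub[of "k + n0" l y] by (intro a) (auto simp: T_def)
    qed simp
    moreover have "measure m T = measure m W + measure m (T - W)" "measure \<eta> T = measure \<eta> W + measure \<eta> (T - W)"
      using \<eta>(2) m.finite_measure_Diff[of T W] \<eta>.finite_measure_Diff[of T W]
      by (auto simp: W_def)
    ultimately have "(f x - L * \<theta> ^ Suc k - a) * measure m W \<le> measure \<eta> T - a * measure m T"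
      by (simp add: algebra_simps)
    also have "\<dots> = measure \<eta> (S 0 l y) - a * measure m (S 0 l y)"
      unfolding T_def mS[of "k + n0"] \<eta>S[of "k + n0"] ..
    also have "\<dots> \<le> (f y + L * \<theta> ^ Suc l) * measure m (S 0 l y) - a * measure m (S 0 l y)"
    proof (intro diff_right_mono upper)
      fix z assume z: "z \<in> S 0 l y"
      then have "\<bar>f z - f y\<bar> \<le> L * \<theta> ^ Suc l"
        by (intro L(2) y) (auto simp: S_def less_Suc_eq_le)
      then show "f z \<le> f y + L * \<theta> ^ Suc l" by simp
    qed simp
    finally have 1: "(f x - L * \<theta> ^ Suc k - a) * measure m W \<le> (f y - a + L * \<theta> ^ Suc l) * measure m (S 0 l y)"
      by (simp add: algebra_simps)
    \<comment> \<open>The mixing bound may be multiplied only by a nonnegative factor. If the factor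
      is negative, the left side is nonpositive and the right side nonnegative.\<close>
    show ?thesis
    proof (cases "0 \<le> f x - L * \<theta> ^ Suc k - a")
      case True
      then have "(f x - L * \<theta> ^ Suc k - a) * (c * measure m (S 0 k x) * measure m (S 0 l y)) \<le> (f x - L * \<theta> ^ Suc k - a) * measure m W"
        using c(3) unfolding W_def T_def by (intro mult_left_mono)
      with 1 have "((f x - L * \<theta> ^ Suc k - a) * (c * measure m (S 0 k x))) * measure m (S 0 l y)
          \<le> (f y - a + L * \<theta> ^ Suc l) * measure m (S 0 l y)"
        by (simp add: mult_ac)
      then show ?thesis using mV by simp
    next
      case False
      then have "(f x - L * \<theta> ^ Suc k - a) * (c * measure m (S 0 k x)) \<le> 0"
        using c(1) by (intro mult_nonpos_nonneg) auto
      also have "0 \<le> f y - a + L * \<theta> ^ Suc l" using a[OF y] L(1) \<theta> by simp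
      finally show ?thesis .
    qed
  qed
  have lim0: "(\<lambda>k. L * \<theta> ^ Suc k) \<longlonglongrightarrow> 0"
    using \<theta> by (intro tendsto_mult_right_zero LIMSEQ_Suc LIMSEQ_power_zero) auto
  have f_le: "f x \<le> a" if x: "x \<in> ?X" for x
  proof -
    \<comment> \<open>With \<open>k\<close> fixed, first \<open>l\<close> tends to infinity and then
      the infimum over \<open>y\<close> is taken. The positive mass of the cylinder around
      \<open>x\<close> depends on \<open>k\<close>, so it is divided out before \<open>k\<close>
      tends to infinity.\<close>
    have "f x - L * \<theta> ^ Suc k - a \<le> 0" for k
    proof -
      let ?K = "(f x - L * \<theta> ^ Suc k - a) * (c * measure m (S 0 k x))"
      have "?K + a \<le> f y" if "y \<in> ?X" for y
      proof -
        have "(\<lambda>l. f y - a + L * \<theta> ^ Suc l) \<longlonglongrightarrow> f y - a + 0" by (intro tendsto_intros lim0)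
        then have "?K \<le> f y - a + 0" by (rule LIMSEQ_le_const) (use key[OF x that] in blast)
        then show ?thesis by simp
      qed
      then have "?K + a \<le> a" unfolding a_def using ne by (intro cINF_greatest) (auto simp: a_def)
      then have "?K \<le> 0" by simp
      then show ?thesis using c(1) c(2)[OF x, of k] by (simp add: mult_le_0_iff)
    qed
    then have "f x - a \<le> L * \<theta> ^ Suc k" for k by (simp add: algebra_simps)
    then have "f x - a \<le> 0" by (intro LIMSEQ_le_const[OF lim0]) auto
    then show ?thesis by simp
  qed
  have \<eta>a: "measure \<eta> B = a * measure m B" if B: "B \<in> sets m" for B
  proof -
    have "x \<in> ?X" if "x \<in> B" for x using sets.sets_into_space[OF B] that space_m by blast
    then show ?thesis using lower[OF B, of a] upper[OF B, of a] a f_le by (intro antisym) auto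
  qed
  have "a = 1" using \<eta>a[OF sets.top] m.prob_space \<eta>.prob_space sets_eq_imp_space_eq[OF \<eta>(2)] by simp
  show ?thesis
  proof (rule measure_eqI)
    fix B assume "B \<in> sets \<eta>"
    then show "emeasure \<eta> B = emeasure m B"
      using \<eta>a[of B] \<open>a = 1\<close> \<eta>(2) by (simp add: m.emeasure_eq_measure \<eta>.emeasure_eq_measure)
  qed (rule \<eta>(2))
qed

section \<open>Contraction of invariant measures\<close>

text \<open>The test functions \<open>\<Phi>\<close> with fiberwise Lipschitz constant \<open>w\<close> form a class that is stable under
  composition with the skew product, which replaces \<open>w\<close> by \<open>\<alpha> (w \<circ> s)\<close>; the integral of \<open>w \<circ> s\<close> is
  that of \<open>w\<close>. Iterating the estimate thus yields a geometric series in \<open>\<alpha>\<close>.\<close>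

lemma skew_invariant_duality_contraction:
  fixes \<mu> \<mu>' :: "('a \<times> 'k::metric_space) measure"
  assumes m: "prob_space m" and s[measurable]: "s \<in> m \<rightarrow>\<^sub>M m" and s_inv: "distr m m s = m"
    and \<mu>: "prob_space \<mu>" "sets \<mu> = sets (m \<Otimes>\<^sub>M borel)" "distr \<mu> m fst = m"
      "distr \<mu> (m \<Otimes>\<^sub>M borel) (\<lambda>(x, y). (s x, G (x, y))) = \<mu>"
    and \<mu>': "prob_space \<mu>'" "sets \<mu>' = sets (m \<Otimes>\<^sub>M borel)" "distr \<mu>' m fst = m"
      "distr \<mu>' (m \<Otimes>\<^sub>M borel) (\<lambda>(x, y). (s x, G' (x, y))) = \<mu>'"
    and G[measurable]: "G \<in> m \<Otimes>\<^sub>M borel \<rightarrow>\<^sub>M borel" "G' \<in> m \<Otimes>\<^sub>M borel \<rightarrow>\<^sub>M borel"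
    and contr: "AE x in m. \<forall>y1 y2. dist (G (x, y1)) (G (x, y2)) \<le> \<alpha> * dist y1 y2"
    and \<alpha>: "0 < \<alpha>" "\<alpha> < 1"
    and close: "\<And>x y. x \<in> space m \<Longrightarrow> dist (G (x, y)) (G' (x, y)) \<le> r" and r: "0 \<le> r"
    and diam: "\<And>y1 y2 :: 'k. dist y1 y2 \<le> 1"
    and \<Phi>: "\<Phi> \<in> borel_measurable (m \<Otimes>\<^sub>M borel)" "\<And>z. \<bar>\<Phi> z\<bar> \<le> (b :: real)"
    and w: "w \<in> borel_measurable m" "\<And>x. 0 \<le> w x" "\<And>x. w x \<le> b"
    and lip: "AE x in m. \<forall>y1 y2. \<bar>\<Phi> (x, y1) - \<Phi> (x, y2)\<bar> \<le> w x * dist y1 y2"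
  shows "\<bar>(\<integral>z. \<Phi> z \<partial>\<mu>') - (\<integral>z. \<Phi> z \<partial>\<mu>)\<bar> \<le> r / (1 - \<alpha>) * (\<integral>x. w x \<partial>m)"
proof -
  interpret m: prob_space m by fact
  note [measurable_cong] = \<mu>(2) \<mu>'(2)
  \<comment> \<open>\<open>K\<close> is the fixed point of the recursion
    \<open>c = r + \<alpha> * c\<close>; the bound \<open>K + (2 - K) * \<alpha> ^ n\<close> in
    \<open>iterate\<close> is its solution with initial value 2.\<close>
  define K where "K = r / (1 - \<alpha>)"
  have rK: "r = K * (1 - \<alpha>)" using \<alpha> by (simp add: K_def)
  have AE_fst: "AE z in N. Q (fst z)" if "AE x in m. Q x" "sets N = sets (m \<Otimes>\<^sub>M borel)" "distr N m fst = m"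
    for Q and N :: "('a \<times> 'k) measure"
  proof (rule AE_distrD[where f=fst and M'=m and P=Q])
    show "fst \<in> N \<rightarrow>\<^sub>M m" using that(2) by (simp cong: measurable_cong_sets)
    show "AE x in distr N m fst. Q x" unfolding that(3) by (rule that(1))
  qed
  have int_fst: "(\<integral>z. u (fst z) \<partial>N) = (\<integral>x. u x \<partial>m)"
    if [measurable]: "u \<in> borel_measurable m" and "sets N = sets (m \<Otimes>\<^sub>M borel)" "distr N m fst = m"
    for u :: "'a \<Rightarrow> real" and N :: "('a \<times> 'k) measure"
  proof -
    have "fst \<in> N \<rightarrow>\<^sub>M m" using that(2) by (simp cong: measurable_cong_sets)
    then have "(\<integral>x. u x \<partial>distr N m fst) = (\<integral>z. u (fst z) \<partial>N)" by (intro integral_distr) simp_all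
    then show ?thesis using that(3) by simp
  qed
  have bounded_int: "integrable N f" 
    if "prob_space N" "sets N = sets (m \<Otimes>\<^sub>M borel)" "f \<in> borel_measurable (m \<Otimes>\<^sub>M borel)" "\<And>z. \<bar>f z\<bar> \<le> c"
    for f :: "'a \<times> 'k \<Rightarrow> real" and N c
  proof -
    interpret prob_space N by fact
    show ?thesis using that(2-) by (intro integrable_const_bound[where B=c]) (auto cong: measurable_cong_sets)
  qed
  have bound: "\<bar>(\<integral>z. f z \<partial>N) - (\<integral>z. g z \<partial>N)\<bar> \<le> (\<integral>x. u x \<partial>m)"
    if N: "prob_space N" "sets N = sets (m \<Otimes>\<^sub>M borel)" "distr N m fst = m"
      and f: "f \<in> borel_measurable (m \<Otimes>\<^sub>M borel)" "\<And>z. \<bar>f z\<bar> \<le> b"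
      and g: "g \<in> borel_measurable (m \<Otimes>\<^sub>M borel)" "\<And>z. \<bar>g z\<bar> \<le> b"
      and u: "u \<in> borel_measurable m" "\<And>x. \<bar>u x\<bar> \<le> B"
      and le: "AE z in N. \<bar>f z - g z\<bar> \<le> u (fst z)"
    for f g :: "'a \<times> 'k \<Rightarrow> real" and u :: "'a \<Rightarrow> real" and N B
  proof -
    have fg: "integrable N f" "integrable N g" "integrable N (\<lambda>z. u (fst z))"
    proof -
      show "integrable N f" "integrable N g"
        by (rule bounded_int[OF N(1,2) f], rule bounded_int[OF N(1,2) g])
      show "integrable N (\<lambda>z. u (fst z))"
        by (rule bounded_int[OF N(1,2), of _ B]) (use u in auto)
    qed
    then have "\<bar>(\<integral>z. f z \<partial>N) - (\<integral>z. g z \<partial>N)\<bar> = \<bar>\<integral>z. f z - g z \<partial>N\<bar>" by simp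
    also have "\<dots> \<le> (\<integral>z. \<bar>f z - g z\<bar> \<partial>N)" by (rule integral_abs_bound)
    also have "\<dots> \<le> (\<integral>z. u (fst z) \<partial>N)" using fg le by (intro integral_mono_AE) auto
    also have "\<dots> = (\<integral>x. u x \<partial>m)" by (rule int_fst[OF u(1) N(2,3)])
    finally show ?thesis .
  qed
  have iterate: "\<bar>(\<integral>z. \<Phi> z \<partial>\<mu>') - (\<integral>z. \<Phi> z \<partial>\<mu>)\<bar> \<le> (K + (2 - K) * \<alpha> ^ n) * (\<integral>x. w x \<partial>m)" for n
    using \<Phi> w lip
  proof (induction n arbitrary: \<Phi> w)
    case 0
    note [measurable] = "0.prems"(1,3)
    obtain y0 :: 'k where True by blast
    \<comment> \<open>Freezing the fiber coordinate gives a function of the base point, with equal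
      integrals under \<open>\<mu>\<close> and \<open>\<mu>'\<close>. As fibers have diameter at
      most 1, each replacement costs one integral of \<open>w\<close>, hence the initial value
      2.\<close>
    let ?g = "\<lambda>z. \<Phi> (fst z, y0)"
    have le: "AE z in N. \<bar>\<Phi> z - ?g z\<bar> \<le> w (fst z)" if "sets N = sets (m \<Otimes>\<^sub>M borel)" "distr N m fst = m"
      for N :: "('a \<times> 'k) measure"
      using AE_fst[OF "0.prems"(6) that]
    proof eventually_elim
      fix z :: "'a \<times> 'k" assume "\<forall>y1 y2. \<bar>\<Phi> (fst z, y1) - \<Phi> (fst z, y2)\<bar> \<le> w (fst z) * dist y1 y2"
      then have "\<bar>\<Phi> (fst z, snd z) - \<Phi> (fst z, y0)\<bar> \<le> w (fst z) * dist (snd z) y0" by blast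
      also have "\<dots> \<le> w (fst z) * 1" using diam "0.prems"(4) by (intro mult_left_mono) auto
      finally show "\<bar>\<Phi> z - ?g z\<bar> \<le> w (fst z)" by simp
    qed
    have g: "?g \<in> borel_measurable (m \<Otimes>\<^sub>M borel)" by measurable
    have wb: "\<bar>w x\<bar> \<le> b" for x using "0.prems"(4,5)[of x] by simp
    have "\<bar>(\<integral>z. \<Phi> z \<partial>\<mu>') - (\<integral>z. ?g z \<partial>\<mu>')\<bar> \<le> (\<integral>x. w x \<partial>m)"
      by (rule bound[OF \<mu>'(1-3) "0.prems"(1,2) g "0.prems"(2) "0.prems"(3) wb le[OF \<mu>'(2,3)]])
    moreover have "\<bar>(\<integral>z. \<Phi> z \<partial>\<mu>) - (\<integral>z. ?g z \<partial>\<mu>)\<bar> \<le> (\<integral>x. w x \<partial>m)"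
      by (rule bound[OF \<mu>(1-3) "0.prems"(1,2) g "0.prems"(2) "0.prems"(3) wb le[OF \<mu>(2,3)]])
    moreover have "(\<integral>z. ?g z \<partial>\<mu>') = (\<integral>z. ?g z \<partial>\<mu>)"
      using int_fst[OF _ \<mu>(2,3), of "\<lambda>x. \<Phi> (x, y0)"] int_fst[OF _ \<mu>'(2,3), of "\<lambda>x. \<Phi> (x, y0)"] by simp
    ultimately show ?case by simp
  next
    case (Suc n)
    note [measurable] = "Suc.prems"(1,3)
    \<comment> \<open>Each measure is rewritten by its own invariance. Exchanging \<open>G'\<close>
      for \<open>G\<close> under \<open>\<mu>'\<close> costs \<open>r\<close> times the integral of
      \<open>w\<close>; what remains has the same integrand \<open>?\<Psi>\<close> for both
      measures, and the induction hypothesis applies to it with the weight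
      \<open>\<alpha> * w (s x)\<close>.\<close>
    let ?\<Psi> = "\<lambda>z. \<Phi> (s (fst z), G z)" and ?\<Psi>' = "\<lambda>z. \<Phi> (s (fst z), G' z)"
    have w_s: "(\<integral>x. w (s x) \<partial>m) = (\<integral>x. w x \<partial>m)"
      using integral_distr[OF s, of w] s_inv by simp
    have lip_s: "AE x in m. \<forall>y1 y2. \<bar>\<Phi> (s x, y1) - \<Phi> (s x, y2)\<bar> \<le> w (s x) * dist y1 y2"
      by (rule AE_distrD[OF s], unfold s_inv, rule Suc.prems(6))
    have 1: "(\<integral>z. \<Phi> z \<partial>\<mu>) = (\<integral>z. ?\<Psi> z \<partial>\<mu>)"
      by (subst \<mu>(4)[symmetric], subst integral_distr) (auto simp: case_prod_beta)
    have 2: "(\<integral>z. \<Phi> z \<partial>\<mu>') = (\<integral>z. ?\<Psi>' z \<partial>\<mu>')"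
      by (subst \<mu>'(4)[symmetric], subst integral_distr) (auto simp: case_prod_beta)
    have "AE z in \<mu>'. \<bar>?\<Psi>' z - ?\<Psi> z\<bar> \<le> r * w (s (fst z))"
      using AE_fst[OF lip_s \<mu>'(2,3)] AE_space[of \<mu>']
    proof eventually_elim
      fix z assume z: "\<forall>y1 y2. \<bar>\<Phi> (s (fst z), y1) - \<Phi> (s (fst z), y2)\<bar> \<le> w (s (fst z)) * dist y1 y2" "z \<in> space \<mu>'"
      then have "fst z \<in> space m" using sets_eq_imp_space_eq[OF \<mu>'(2)] by (auto simp: space_pair_measure)
      have "\<bar>?\<Psi>' z - ?\<Psi> z\<bar> \<le> w (s (fst z)) * dist (G' z) (G z)" using z by blast
      also have "\<dots> \<le> w (s (fst z)) * r"
        using close[OF \<open>fst z \<in> space m\<close>, of "snd z"] Suc.prems(4) by (intro mult_left_mono) (auto simp: dist_commute)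
      finally show "\<bar>?\<Psi>' z - ?\<Psi> z\<bar> \<le> r * w (s (fst z))" by (simp add: mult.commute)
    qed
    then have near: "AE z in \<mu>'. \<bar>?\<Psi>' z - ?\<Psi> z\<bar> \<le> (\<lambda>x. r * w (s x)) (fst z)" .
    have rw: "\<bar>r * w (s x)\<bar> \<le> r * b" for x
      using Suc.prems(4,5) r by (auto simp: abs_mult intro!: mult_left_mono)
    have "\<bar>(\<integral>z. ?\<Psi>' z \<partial>\<mu>') - (\<integral>z. ?\<Psi> z \<partial>\<mu>')\<bar> \<le> (\<integral>x. r * w (s x) \<partial>m)"
      by (rule bound[OF \<mu>'(1-3) _ Suc.prems(2) _ Suc.prems(2) _ rw near]) measurable
    moreover have "\<bar>(\<integral>z. ?\<Psi> z \<partial>\<mu>') - (\<integral>z. ?\<Psi> z \<partial>\<mu>)\<bar> \<le> (K + (2 - K) * \<alpha> ^ n) * (\<integral>x. \<alpha> * w (s x) \<partial>m)"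
    proof (rule Suc.IH)
      show "0 \<le> \<alpha> * w (s x)" for x using Suc.prems(4) \<alpha> by simp
      show "\<alpha> * w (s x) \<le> b" for x
        using mult_left_le_one_le[of "w (s x)" \<alpha>] \<alpha> Suc.prems(4,5)[of "s x"] by auto
      show "AE x in m. \<forall>y1 y2. \<bar>\<Phi> (s (fst (x, y1)), G (x, y1)) - \<Phi> (s (fst (x, y2)), G (x, y2))\<bar> \<le> \<alpha> * w (s x) * dist y1 y2"
        using lip_s contr
      proof eventually_elim
        fix x assume 1: "\<forall>y1 y2. \<bar>\<Phi> (s x, y1) - \<Phi> (s x, y2)\<bar> \<le> w (s x) * dist y1 y2"
          and 2: "\<forall>y1 y2. dist (G (x, y1)) (G (x, y2)) \<le> \<alpha> * dist y1 y2"
        show "\<forall>y1 y2. \<bar>\<Phi> (s (fst (x, y1)), G (x, y1)) - \<Phi> (s (fst (x, y2)), G (x, y2))\<bar> \<le> \<alpha> * w (s x) * dist y1 y2"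
        proof (intro allI)
          fix y1 y2
          have "\<bar>\<Phi> (s x, G (x, y1)) - \<Phi> (s x, G (x, y2))\<bar> \<le> w (s x) * dist (G (x, y1)) (G (x, y2))"
            using 1 by blast
          also have "\<dots> \<le> w (s x) * (\<alpha> * dist y1 y2)" using 2 Suc.prems(4) by (intro mult_left_mono) auto
          finally show "\<bar>\<Phi> (s (fst (x, y1)), G (x, y1)) - \<Phi> (s (fst (x, y2)), G (x, y2))\<bar> \<le> \<alpha> * w (s x) * dist y1 y2"
            by (simp add: mult_ac)
        qed
      qed
    qed (use Suc.prems(2) in auto)
    ultimately have "\<bar>(\<integral>z. \<Phi> z \<partial>\<mu>') - (\<integral>z. \<Phi> z \<partial>\<mu>)\<bar> \<le> r * (\<integral>x. w x \<partial>m) + (K + (2 - K) * \<alpha> ^ n) * (\<alpha> * (\<integral>x. w x \<partial>m))"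
      unfolding 1 2 by (simp add: w_s)
    also have "\<dots> = (K + (2 - K) * \<alpha> ^ Suc n) * (\<integral>x. w x \<partial>m)"
      unfolding rK by (simp add: algebra_simps)
    finally show ?case .
  qed
  have "(\<lambda>n. (K + (2 - K) * \<alpha> ^ n) * (\<integral>x. w x \<partial>m)) \<longlonglongrightarrow> (K + (2 - K) * 0) * (\<integral>x. w x \<partial>m)"
    using \<alpha> by (intro tendsto_intros LIMSEQ_power_zero) auto
  then have "\<bar>(\<integral>z. \<Phi> z \<partial>\<mu>') - (\<integral>z. \<Phi> z \<partial>\<mu>)\<bar> \<le> (K + (2 - K) * 0) * (\<integral>x. w x \<partial>m)"
    by (rule LIMSEQ_le_const) (use iterate in blast)
  then show ?thesis by (simp add: K_def)
qed

section \<open>The fiberwise norm\<close>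

text \<open>Supplies the countable family that replaces the supremum defining the fiber norm. By
  compactness a function is determined up to \<open>e\<close> by its rounded values at finitely many
  points of a dense set.\<close>

lemma lipschitz_functions_separable:
  assumes compact: "compact (UNIV :: 'k set)"
  obtains \<D> :: "('k::{metric_space, second_countable_topology} \<Rightarrow> real) set" where
    "countable \<D>" "\<D> \<subseteq> {g. 1-lipschitz_on UNIV g \<and> (\<forall>y. \<bar>g y\<bar> \<le> 1)}" 
    "\<And>g e. 1-lipschitz_on UNIV g \<Longrightarrow> (\<forall>y. \<bar>g y\<bar> \<le> 1) \<Longrightarrow> 0 < e \<Longrightarrow> \<exists>h\<in>\<D>. \<forall>y. \<bar>g y - h y\<bar> \<le> e"
proof -
  obtain D :: "'k set" where D: "countable D" "\<And>X. open X \<Longrightarrow> X \<noteq> {} \<Longrightarrow> \<exists>d\<in>D. d \<in> X"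
    using countable_dense_exists by blast
  \<comment> \<open>McShane extensions of rational data on finite subsets of \<open>D\<close>\<close>
  define F :: "(rat \<times> 'k) list \<Rightarrow> 'k \<Rightarrow> real"
    where "F l y = foldr (\<lambda>(q, d) v. min (of_rat q + dist y d) v) l 1" for l y
  \<comment> \<open>The empty list gives the constant 1, which truncates \<open>F\<close> from
    above; the maximum with \<open>- 1\<close> truncates from below. Neither truncation enlarges the
    Lipschitz constant.\<close>
  define h where "h l y = max (- 1) (F l y)" for l y
  have F_Nil: "F [] y = 1" and F_Cons: "F ((q, d) # l) y = min (of_rat q + dist y d) (F l y)" for q d l y
    by (simp_all add: F_def)
  have F_lip: "\<bar>F l y - F l z\<bar> \<le> dist y z" for l y z
  proof (induction l)
    case (Cons a l)
    obtain q d where a: "a = (q, d)" by (cases a)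
    have "\<bar>dist y d - dist z d\<bar> \<le> dist y z" 
      using dist_triangle[of y d z] dist_triangle[of z d y] by (simp add: dist_commute abs_le_iff)
    then show ?case using Cons unfolding a F_Cons by linarith
  qed (simp add: F_Nil)
  have F_le: "F l y \<le> 1" for l y
    by (induction l) (auto simp: F_Nil F_Cons min_le_iff_disj)
  have F_le': "F l y \<le> of_rat q + dist y d" if "(q, d) \<in> set l" for l y q d
    using that by (induction l) (auto simp: F_Cons min_le_iff_disj)
  have F_ge: "c \<le> F l y" if "c \<le> 1" "\<And>q d. (q, d) \<in> set l \<Longrightarrow> c \<le> of_rat q + dist y d" for l y c
    using that(2) by (induction l) (auto simp: F_Nil F_Cons that(1))
  show thesis
  proof (rule that[of "h ` lists (UNIV \<times> D)"])
    show "countable (h ` lists (UNIV \<times> D))"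
      using D(1) by (intro countable_image countable_lists countable_SIGMA) auto
    show "h ` lists (UNIV \<times> D) \<subseteq> {g. 1-lipschitz_on UNIV g \<and> (\<forall>y. \<bar>g y\<bar> \<le> 1)}"
    proof (intro image_subsetI CollectI conjI allI)
      fix l
      show "1-lipschitz_on UNIV (h l)"
      proof (rule lipschitz_onI)
        fix y z show "dist (h l y) (h l z) \<le> 1 * dist y z"
          using F_lip[of l y z] by (simp add: h_def dist_real_def)
      qed simp
      show "\<bar>h l y\<bar> \<le> 1" for y using F_le[of l y] by (simp add: h_def)
    qed
    fix g :: "'k \<Rightarrow> real" and e :: real
    assume g: "1-lipschitz_on UNIV g" "\<forall>y. \<bar>g y\<bar> \<le> 1" and e: "0 < e"
    have g_lip: "\<bar>g y - g z\<bar> \<le> dist y z" for y z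
      using lipschitz_onD[OF g(1), of y z] by (simp add: dist_real_def)
    \<comment> \<open>The error \<open>e\<close> has three equal shares: rounding the value at
      \<open>d\<close> upwards, the distance from \<open>y\<close> to \<open>d\<close> in the
      extension, and the variation of \<open>g\<close> between them. Rounding upwards keeps
      \<open>F l\<close> above \<open>g\<close>.\<close>
    have cover: "UNIV \<subseteq> (\<Union>d\<in>D. ball d (e / 3))"
    proof
      fix y :: 'k
      have "ball y (e / 3) \<noteq> {}" using e by simp
      then obtain d where "d \<in> D" "d \<in> ball y (e / 3)" using D(2)[OF open_ball] by blast
      then show "y \<in> (\<Union>d\<in>D. ball d (e / 3))" by (auto simp: dist_commute)
    qed
    obtain J where J: "J \<subseteq> D" "finite J" "UNIV \<subseteq> (\<Union>d\<in>J. ball d (e / 3))"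
      by (rule compactE_image[OF compact _ cover]) auto
    have "\<exists>q. g d \<le> of_rat q \<and> of_rat q \<le> g d + e / 3" for d
      using of_rat_dense[of "g d" "g d + e / 3"] e by (auto intro: less_imp_le)
    then obtain q where q: "\<And>d. g d \<le> of_rat (q d)" "\<And>d. of_rat (q d) \<le> g d + e / 3" by metis
    obtain js where js: "set js = J" using finite_list[OF J(2)] by blast
    define l where "l = map (\<lambda>d. (q d, d)) js"
    show "\<exists>h\<in>h ` lists (UNIV \<times> D). \<forall>y. \<bar>g y - h y\<bar> \<le> e"
    proof (rule bexI[of _ "h l"], intro allI)
      show "h l \<in> h ` lists (UNIV \<times> D)" using js J(1) by (intro imageI) (auto simp: l_def)
      fix y
      have 1: "g y \<le> F l y"
      proof (rule F_ge)
        show "g y \<le> 1" using g(2) by (simp add: abs_le_iff)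
        fix r d assume "(r, d) \<in> set l"
        then have "r = q d" by (auto simp: l_def)
        then show "g y \<le> of_rat r + dist y d" using q(1)[of d] g_lip[of y d] by simp
      qed
      have "y \<in> (\<Union>d\<in>J. ball d (e / 3))" using J(3) by blast
      then obtain d where d: "d \<in> J" "dist d y < e / 3" by auto
      then have "F l y \<le> of_rat (q d) + dist y d" by (intro F_le') (auto simp: l_def js)
      then have "F l y \<le> g y + e" using q(2)[of d] g_lip[of d y] d(2) by (simp add: dist_commute)
      moreover have "h l y = F l y" using 1 g(2)[rule_format, of y] by (simp add: h_def abs_le_iff)
      ultimately show "\<bar>g y - h l y\<bar> \<le> e" using 1 by simp
    qed
  qed
qed

lemma W_norm_measure_diff:
  fixes M1 M2 :: "'k::metric_space measure"
  assumes fin: "finite_measure M1" "finite_measure M2" and sets: "sets M1 = sets borel" "sets M2 = sets borel"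
    and \<D>: "\<D> \<subseteq> {g. 1-lipschitz_on UNIV g \<and> (\<forall>y. \<bar>g y\<bar> \<le> 1)}"
      "\<And>g e. 1-lipschitz_on UNIV g \<Longrightarrow> (\<forall>y. \<bar>g y\<bar> \<le> 1) \<Longrightarrow> 0 < e \<Longrightarrow> \<exists>h\<in>\<D>. \<forall>y. \<bar>g y - h y\<bar> \<le> e"
  shows "W_norm (\<lambda>B. measure M1 B - measure M2 B) = (SUP g\<in>\<D>. ennreal \<bar>(\<integral>y. g y \<partial>M1) - (\<integral>y. g y \<partial>M2)\<bar>)"
proof -
  interpret M1: finite_measure M1 by fact
  interpret M2: finite_measure M2 by fact
  note [measurable_cong] = sets
  let ?L = "{g :: 'k \<Rightarrow> real. 1-lipschitz_on UNIV g \<and> (\<forall>y. \<bar>g y\<bar> \<le> 1)}"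
  let ?I = "\<lambda>g. (\<integral>y. g y \<partial>M1) - (\<integral>y. g y \<partial>M2)"
  have meas[measurable]: "g \<in> borel_measurable borel" if "g \<in> ?L" for g
    using that lipschitz_on_continuous_on by (intro borel_measurable_continuous_onI) auto
  have int: "integrable M1 g" "integrable M2 g" if "g \<in> ?L" for g
    using that meas[OF that]
    by (auto intro!: M1.integrable_const_bound[where B=1] M2.integrable_const_bound[where B=1])
  have zero: "signed_integral borel (\<lambda>_. 0) g = 0" if "g \<in> ?L" for g
  proof -
    let ?N = "null_measure (borel :: 'k measure)"
    have "finite_measure ?N" by (rule finite_measureI) simp
    then have "signed_integral borel (\<lambda>E. measure ?N E - measure ?N E) g = (\<integral>y. g y \<partial>?N) - (\<integral>y. g y \<partial>?N)"
      using that meas[OF that] by (intro signed_integral_measure_diff[where b=1]) auto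
    then show ?thesis by simp
  qed
  have eq: "W_norm (\<lambda>B. measure M1 B - measure M2 B) = (SUP g\<in>?L. ennreal \<bar>?I g\<bar>)"
    unfolding W_norm_def W10_def
  proof (intro SUP_cong refl arg_cong[where f=ennreal])
    fix g assume g: "g \<in> ?L"
    have "signed_integral borel (\<lambda>B. measure M1 B - measure M2 B) g = ?I g"
      using g meas[OF g] by (intro signed_integral_measure_diff[where b=1] fin sets) auto
    then show "\<bar>signed_integral borel (\<lambda>_. 0) g - signed_integral borel (\<lambda>B. measure M1 B - measure M2 B) g\<bar> = \<bar>?I g\<bar>"
      using zero[OF g] by simp
  qed
  show ?thesis
    unfolding eq
  proof (rule antisym)
    \<comment> \<open>A uniform error \<open>e / c\<close> changes the difference of the two
      integrals by at most \<open>e\<close>; the added 1 keeps \<open>c\<close> positive when both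
      measures vanish.\<close>
    define c where "c = measure M1 (space M1) + measure M2 (space M2) + 1"
    have "0 < c" by (auto simp: c_def intro: add_nonneg_pos)
    show "(SUP g\<in>?L. ennreal \<bar>?I g\<bar>) \<le> (SUP g\<in>\<D>. ennreal \<bar>?I g\<bar>)"
    proof (rule SUP_least, rule ennreal_le_epsilon)
      fix g and e :: real assume g: "g \<in> ?L" and e: "0 < e"
      then obtain h where h: "h \<in> \<D>" "\<And>y. \<bar>g y - h y\<bar> \<le> e / c"
        using \<D>(2)[of g "e / c"] \<open>0 < c\<close> by auto
      then have hL: "h \<in> ?L" using \<D>(1) by blast
      have gh: "\<bar>(\<integral>y. g y \<partial>M) - (\<integral>y. h y \<partial>M)\<bar> \<le> e / c * measure M (space M)"
        if "finite_measure M" "integrable M g" "integrable M h" for M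
      proof -
        interpret finite_measure M by fact
        have "\<bar>(\<integral>y. g y \<partial>M) - (\<integral>y. h y \<partial>M)\<bar> = \<bar>\<integral>y. g y - h y \<partial>M\<bar>" using that by simp
        also have "\<dots> \<le> (\<integral>y. \<bar>g y - h y\<bar> \<partial>M)" by (rule integral_abs_bound)
        also have "\<dots> \<le> (\<integral>y. e / c \<partial>M)" using that h(2) by (intro integral_mono) auto
        finally show ?thesis by (simp add: mult.commute)
      qed
      have "\<bar>?I g\<bar> \<le> \<bar>?I h\<bar> + e / c * (measure M1 (space M1) + measure M2 (space M2))"
        using gh[OF fin(1) int(1)[OF g] int(1)[OF hL]] gh[OF fin(2) int(2)[OF g] int(2)[OF hL]]
        unfolding distrib_left by linarith
      also have "\<dots> \<le> \<bar>?I h\<bar> + e / c * c"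
        using e \<open>0 < c\<close> by (intro add_left_mono mult_left_mono) (auto simp: c_def)
      finally have "\<bar>?I g\<bar> \<le> \<bar>?I h\<bar> + e" using \<open>0 < c\<close> by simp
      then have "ennreal \<bar>?I g\<bar> \<le> ennreal \<bar>?I h\<bar> + ennreal e"
        using e by (simp add: ennreal_plus[symmetric] ennreal_leI del: ennreal_plus)
      also have "\<dots> \<le> (SUP g\<in>\<D>. ennreal \<bar>?I g\<bar>) + ennreal e"
        by (intro add_right_mono SUP_upper h)
      finally show "ennreal \<bar>?I g\<bar> \<le> (SUP g\<in>\<D>. ennreal \<bar>?I g\<bar>) + ennreal e" .
    qed
    show "(SUP g\<in>\<D>. ennreal \<bar>?I g\<bar>) \<le> (SUP g\<in>?L. ennreal \<bar>?I g\<bar>)"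
      by (rule SUP_subset_mono[OF \<D>(1)]) simp
  qed
qed

lemma AE_le_of_integral_le:
  fixes u :: "'a \<Rightarrow> real"
  assumes m: "finite_measure m" and u: "integrable m u"
    and le: "\<And>B. B \<in> sets m \<Longrightarrow> (\<integral>x. indicator B x * u x \<partial>m) \<le> C * measure m B"
  shows "AE x in m. u x \<le> C"
proof -
  interpret finite_measure m by fact
  have [measurable]: "u \<in> borel_measurable m" using u by simp
  define B where "B = {x \<in> space m. C < u x}"
  have B[measurable]: "B \<in> sets m" unfolding B_def by measurable
  have i1: "integrable m (\<lambda>x. indicator B x * u x)" using integrable_mult_indicator[OF B u] by simp
  have i2: "integrable m (\<lambda>x. C * indicator B x)"
    by (intro integrable_mult_right integrable_real_indicator) (auto simp: less_top[symmetric])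
  have nn: "0 \<le> indicator B x * u x - C * indicator B x" for x
    by (auto simp: B_def indicator_def)
  have "(\<integral>x. indicator B x * u x - C * indicator B x \<partial>m) \<le> 0"
    using le[OF B] i1 i2 by simp
  then have "(\<integral>x. indicator B x * u x - C * indicator B x \<partial>m) = 0"
    using nn by (intro antisym integral_nonneg) auto
  then have "AE x in m. indicator B x * u x - C * indicator B x = 0"
    using i1 i2 nn by (subst (asm) integral_nonneg_eq_0_iff_AE) auto
  then show ?thesis
    using AE_space by eventually_elim (auto simp: B_def indicator_def split: if_splits)
qed


text \<open>A disintegration says that \<open>P\<close> is the monadic composition of its marginal
  \<open>N\<close> with \<open>\<kappa>\<close>, so the formula known for sets extends to bounded
  functions by \<open>integral_bind\<close>.\<close>

lemma integral_disintegration: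
  fixes P :: "((nat \<Rightarrow> 'n) \<times> 'k::metric_space) measure" and f :: "_ \<Rightarrow> real"
  assumes m: "prob_space m" and P: "finite_measure P" "sets P = sets (total_alg m)"
    "absolutely_continuous m (distr P m fst)" and dis: "disintegration m P \<kappa>"
    and f[measurable]: "f \<in> borel_measurable (total_alg m)" and b: "\<And>z. \<bar>f z\<bar> \<le> b"
  shows "integrable m (\<lambda>x. enn2real (marginal_density m P x) * (\<integral>z. f z \<partial>\<kappa> x))"
    and "(\<integral>z. f z \<partial>P) = (\<integral>x. enn2real (marginal_density m P x) * (\<integral>z. f z \<partial>\<kappa> x) \<partial>m)"
proof -
  interpret m: prob_space m by fact
  interpret P: finite_measure P by fact
  note [measurable_cong] = P(2)
  define dens where "dens = marginal_density m P"
  have [measurable]: "dens \<in> borel_measurable m" by (simp add: dens_def marginal_density_def)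
  have \<kappa>: "\<kappa> \<in> m \<rightarrow>\<^sub>M prob_algebra (total_alg m)"
    and \<kappa>E: "\<And>E. E \<in> sets (total_alg m) \<Longrightarrow> emeasure P E = (\<integral>\<^sup>+x. dens x * emeasure (\<kappa> x) E \<partial>m)"
    using dis by (auto simp: disintegration_def dens_def)
  note \<kappa>'[measurable] = measurable_prob_algebraD[OF \<kappa>]
  define N where "N = distr P m fst"
  have N: "density m dens = N"
    unfolding N_def dens_def marginal_density_def using P(3) by (intro m.density_RN_deriv) auto
  have sN[measurable_cong]: "sets N = sets m" by (simp add: N_def)
  have spN: "space N = space m" by (simp add: N_def)
  have \<kappa>N: "\<kappa> \<in> N \<rightarrow>\<^sub>M subprob_algebra (total_alg m)" by measurable
  have finN: "finite_measure N" unfolding N_def by (rule P.finite_measure_distr) measurable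
  have bind: "P = N \<bind> \<kappa>"
  proof (rule measure_eqI)
    show "sets P = sets (N \<bind> \<kappa>)"
      using sets_bind[of N \<kappa> "total_alg m"] \<kappa> m.not_empty
      by (simp add: P(2) spN sets_kernel[OF \<kappa>'])
    fix E assume "E \<in> sets P"
    then have E[measurable]: "E \<in> sets (total_alg m)" by (simp add: P(2))
    have "emeasure (N \<bind> \<kappa>) E = (\<integral>\<^sup>+x. emeasure (\<kappa> x) E \<partial>N)"
      using m.not_empty by (intro emeasure_bind[OF _ \<kappa>N E]) (simp add: spN)
    also have "\<dots> = (\<integral>\<^sup>+x. dens x * emeasure (\<kappa> x) E \<partial>m)"
      unfolding N[symmetric] by (rule nn_integral_density) measurable
    finally show "emeasure P E = emeasure (N \<bind> \<kappa>) E" by (simp add: \<kappa>E)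
  qed
  define g where "g x = (\<integral>z. f z \<partial>\<kappa> x)" for x
  have [measurable]: "g \<in> borel_measurable m" unfolding g_def by measurable
  have \<kappa>x: "prob_space (\<kappa> x)" "sets (\<kappa> x) = sets (total_alg m)" if "x \<in> space m" for x
    using measurable_space[OF \<kappa> that] by (auto simp: space_prob_algebra)
  have gb: "\<bar>g x\<bar> \<le> b" if x: "x \<in> space m" for x
  proof -
    interpret K: prob_space "\<kappa> x" by (rule \<kappa>x[OF x])
    have "integrable (\<kappa> x) f"
      using b \<kappa>x(2)[OF x] by (intro K.integrable_const_bound[where B=b]) (auto cong: measurable_cong_sets)
    then have "\<bar>g x\<bar> \<le> (\<integral>z. \<bar>f z\<bar> \<partial>\<kappa> x)" "(\<integral>z. \<bar>f z\<bar> \<partial>\<kappa> x) \<le> b"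
      unfolding g_def using b by (auto intro!: integral_abs_bound K.integral_le_const)
    then show ?thesis by simp
  qed
  have int: "(\<integral>z. f z \<partial>P) = (\<integral>x. g x \<partial>N)"
    unfolding bind g_def
  proof (rule integral_bind[OF f _ \<kappa>N finN, where B=b and B'=1])
    show "AE x in N. emeasure (\<kappa> x) (space (\<kappa> x)) \<le> ennreal 1"
      using \<kappa>x(1) prob_space.emeasure_space_1 by (intro AE_I2) (fastforce simp: spN)
  qed (rule b)
  have intN: "integrable N g"
    using gb by (intro finite_measure.integrable_const_bound[OF finN, where B=b] AE_I2) (auto simp: spN)
  \<comment> \<open>The marginal is finite, so its density is finite almost everywhere and may be
    replaced by the real-valued version that the Bochner integral needs.\<close>
  have "AE x in m. dens x \<noteq> \<infinity>"
    unfolding dens_def marginal_density_def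
    using finN P(3) unfolding N_def
    by (intro m.RN_deriv_finite finite_measure.axioms(1)) (auto simp: finite_measure_def)
  then have "density m dens = density m (\<lambda>x. ennreal (enn2real (dens x)))"
    by (intro density_cong) (auto elim!: eventually_mono simp: less_top)
  then have N': "N = density m (\<lambda>x. ennreal (enn2real (dens x)))" using N by simp
  show "integrable m (\<lambda>x. enn2real (marginal_density m P x) * (\<integral>z. f z \<partial>\<kappa> x))"
    using intN unfolding N' g_def[symmetric] dens_def[symmetric]
    by (subst (asm) integrable_real_density) auto
  show "(\<integral>z. f z \<partial>P) = (\<integral>x. enn2real (marginal_density m P x) * (\<integral>z. f z \<partial>\<kappa> x) \<partial>m)"
    unfolding int unfolding N' g_def[symmetric] dens_def[symmetric]
    by (subst integral_real_density) auto
qed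

lemma disintegration_exists:
  fixes P :: "((nat \<Rightarrow> 'n) \<times> 'k::{metric_space, second_countable_topology}) measure"
  assumes "compact (UNIV :: 'k set)" and m: "prob_space m" "\<And>x. x \<in> space m \<Longrightarrow> {x} \<in> sets m"
    and P: "finite_measure P" "sets P = sets (total_alg m)" "absolutely_continuous m (distr P m fst)"
  obtains \<kappa> where "disintegration m P \<kappa>"
proof -
  interpret m: prob_space m by fact
  show thesis
    by (rule fiber_disintegration[OF assms(1) P(1,2) m.sigma_finite_measure_axioms m.not_empty m(2) P(3)])
      (auto intro!: that simp: disintegration_def marginal_density_def)
qed

text \<open>Where the density is infinite, \<^const>\<open>measure\<close> sends the restriction to \<open>0\<close>; the finite measure \<open>M\<close>
  has the same values at every point, not only almost everywhere. This is needed because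
  \<^const>\<open>esssup\<close> is infinite on functions that are not measurable.\<close>

lemma restriction_pos_eq:
  fixes P :: "((nat \<Rightarrow> 'n) \<times> 'k::metric_space) measure"
  assumes dis: "disintegration m P \<kappa>" and x: "x \<in> space m"
  obtains M where "finite_measure M" "sets M = sets borel"
    "\<And>B. measure (restriction_pos m P \<kappa> x) B = measure M B"
    "\<And>g :: 'k \<Rightarrow> real. g \<in> borel_measurable borel \<Longrightarrow>
      (\<integral>y. g y \<partial>M) = enn2real (marginal_density m P x) * (\<integral>z. g (snd z) \<partial>\<kappa> x)"
proof -
  have \<kappa>x: "prob_space (\<kappa> x)" and sx[measurable_cong]: "sets (\<kappa> x) = sets (total_alg m)"
    using dis measurable_space[OF _ x, of \<kappa> "prob_algebra (total_alg m)"]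
    by (auto simp: space_prob_algebra disintegration_def)
  interpret K: prob_space "\<kappa> x" by fact
  define r where "r = marginal_density m P x"
  define D where "D = density (\<kappa> x) (\<lambda>_. ennreal (enn2real r))"
  have [measurable_cong]: "sets D = sets (total_alg m)" by (simp add: D_def sx)
  define M where "M = distr D borel snd"
  have em: "emeasure D B = ennreal (enn2real r) * emeasure (\<kappa> x) B" if "B \<in> sets (total_alg m)" for B
    unfolding D_def using that sx by (intro emeasure_density_const) simp
  show thesis
  proof (rule that[of M])
    have "finite_measure D"
    proof (rule finite_measureI)
      have "emeasure D (space D) = ennreal (enn2real r) * emeasure (\<kappa> x) (space (\<kappa> x))"
        using sets_eq_imp_space_eq[OF sx] by (subst em) (auto simp: D_def)
      then show "emeasure D (space D) \<noteq> \<infinity>" by (simp add: K.emeasure_space_1)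
    qed
    then show "finite_measure M"
      unfolding M_def by (rule finite_measure.finite_measure_distr) measurable
    show "sets M = sets borel" by (simp add: M_def)
    show "measure (restriction_pos m P \<kappa> x) B = measure M B" for B
    proof (cases "B \<in> sets borel")
      case [measurable]: True
      let ?B = "snd -` B \<inter> space (\<kappa> x)"
      have B: "?B \<in> sets (total_alg m)" unfolding sx[symmetric] by measurable
      have "emeasure (restriction_pos m P \<kappa> x) B = r * emeasure (\<kappa> x) ?B"
        unfolding restriction_pos_def r_def
        by (subst emeasure_distr) (auto simp: space_scale_measure)
      moreover have "emeasure M B = ennreal (enn2real r) * emeasure (\<kappa> x) ?B"
        unfolding M_def using em[OF B] by (subst emeasure_distr) (auto simp: D_def)
      ultimately show ?thesis by (simp add: measure_def enn2real_mult)
    next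
      case False
      then show ?thesis by (simp add: measure_notin_sets restriction_pos_def M_def)
    qed
    fix g :: "'k \<Rightarrow> real" assume [measurable]: "g \<in> borel_measurable borel"
    have "(\<integral>y. g y \<partial>M) = (\<integral>z. g (snd z) \<partial>D)"
      unfolding M_def by (rule integral_distr) measurable
    also have "\<dots> = enn2real r * (\<integral>z. g (snd z) \<partial>\<kappa> x)"
      unfolding D_def by (subst integral_real_density) auto
    finally show "(\<integral>y. g y \<partial>M) = enn2real (marginal_density m P x) * (\<integral>z. g (snd z) \<partial>\<kappa> x)"
      by (simp add: r_def)
  qed
qed

text \<open>The indicator of an arbitrary base set \<open>B\<close> localizes the hypothesis: for
  fixed \<open>g\<close> it becomes an almost everywhere bound on the integral of \<open>g\<close>
  over the fiber. As \<open>norm_inf\<close> is an infimum, a single choice of disintegrations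
  suffices.\<close>

lemma norm_inf_measure_diff_le:
  fixes \<mu> \<mu>' :: "((nat \<Rightarrow> 'n) \<times> 'k::{metric_space, second_countable_topology}) measure"
  assumes K: "compact (UNIV :: 'k set)" and m: "prob_space m" "\<And>x. x \<in> space m \<Longrightarrow> {x} \<in> sets m"
    and \<mu>: "finite_measure \<mu>" "sets \<mu> = sets (total_alg m)" "distr \<mu> m fst = m"
    and \<mu>': "finite_measure \<mu>'" "sets \<mu>' = sets (total_alg m)" "distr \<mu>' m fst = m"
    and C: "\<And>B g. B \<in> sets m \<Longrightarrow> 1-lipschitz_on UNIV g \<Longrightarrow> (\<forall>y. \<bar>g y\<bar> \<le> 1) \<Longrightarrow>
      \<bar>(\<integral>z. indicator B (fst z) * g (snd z) \<partial>\<mu>') - (\<integral>z. indicator B (fst z) * g (snd z) \<partial>\<mu>)\<bar> \<le> C * measure m B"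
  shows "norm_inf m (\<lambda>E. measure \<mu>' E - measure \<mu> E) \<le> ennreal C"
proof -
  interpret m: prob_space m by fact
  let ?T = "total_alg m :: ((nat \<Rightarrow> 'n) \<times> 'k) measure"
  let ?\<nu> = "\<lambda>E. measure \<mu>' E - measure \<mu> E"
  have C': "\<bar>(\<integral>z. indicator B (fst z) * g (snd z) \<partial>\<mu>') - (\<integral>z. indicator B (fst z) * g (snd z) \<partial>\<mu>)\<bar> \<le> C * measure m B"
    if "B \<in> sets m" "g \<in> {g. 1-lipschitz_on UNIV g \<and> (\<forall>y. \<bar>g y\<bar> \<le> 1)}" for B and g :: "'k \<Rightarrow> real"
    using C that by auto
  obtain P Q where PQ: "jordan_decomposition ?T ?\<nu> P Q"
    and le: "\<And>E. E \<in> sets ?T \<Longrightarrow> emeasure P E \<le> emeasure \<mu>' E" "\<And>E. E \<in> sets ?T \<Longrightarrow> emeasure Q E \<le> emeasure \<mu> E"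
    by (rule jordan_decomposition_exists[OF \<mu>'(1) \<mu>(1) \<mu>'(2) \<mu>(2)]) (rule that)
  have P: "finite_measure P" "sets P = sets ?T" and Q: "finite_measure Q" "sets Q = sets ?T"
    and PQ_eq: "\<And>E. E \<in> sets ?T \<Longrightarrow> measure P E - measure Q E = measure \<mu>' E - measure \<mu> E"
    using PQ by (auto simp: jordan_decomposition_def)
  \<comment> \<open>The Jordan parts are dominated by \<open>\<mu>'\<close> and
    \<open>\<mu>\<close>, whose marginals are \<open>m\<close>. This is the absolute continuity
    under which they can be disintegrated.\<close>
  have ac: "absolutely_continuous m (distr R m fst)"
    if "sets R = sets ?T" "sets \<rho> = sets ?T" "distr \<rho> m fst = m" "\<And>E. E \<in> sets ?T \<Longrightarrow> emeasure R E \<le> emeasure \<rho> E"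
    for R \<rho> :: "((nat \<Rightarrow> 'n) \<times> 'k) measure"
    unfolding absolutely_continuous_def
  proof
    note [measurable_cong] = that(1,2)
    have sp: "space R = space \<rho>" using that(1,2) by (metis sets_eq_imp_space_eq)
    fix B assume B: "B \<in> null_sets m"
    then have [measurable]: "B \<in> sets m" by auto
    have "fst -` B \<inter> space \<rho> \<in> sets \<rho>" by measurable
    then have "emeasure (distr R m fst) B \<le> emeasure (distr \<rho> m fst) B"
      using that(2,4) by (simp add: emeasure_distr sp)
    then show "B \<in> null_sets (distr R m fst)" using B that(3) by (auto simp: null_sets_def)
  qed
  have acP: "absolutely_continuous m (distr P m fst)" by (rule ac[OF P(2) \<mu>'(2,3) le(1)])
  have acQ: "absolutely_continuous m (distr Q m fst)" by (rule ac[OF Q(2) \<mu>(2,3) le(2)])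
  obtain \<kappa>p where \<kappa>p: "disintegration m P \<kappa>p" by (rule disintegration_exists[OF K m P acP])
  obtain \<kappa>n where \<kappa>n: "disintegration m Q \<kappa>n" by (rule disintegration_exists[OF K m Q acQ])
  define \<rho> where "\<rho> x B = measure (restriction_pos m P \<kappa>p x) B - measure (restriction_pos m Q \<kappa>n x) B" for x B
  have \<rho>: "\<rho> \<in> restrictions m ?\<nu>"
    unfolding restrictions_def jordan_pos_eq[OF PQ] jordan_neg_eq[OF PQ] \<rho>_def
    using \<kappa>p \<kappa>n by blast
  obtain \<D> :: "('k \<Rightarrow> real) set" where \<D>: "countable \<D>" "\<D> \<subseteq> {g. 1-lipschitz_on UNIV g \<and> (\<forall>y. \<bar>g y\<bar> \<le> 1)}"
    "\<And>g e. 1-lipschitz_on UNIV g \<Longrightarrow> (\<forall>y. \<bar>g y\<bar> \<le> 1) \<Longrightarrow> 0 < e \<Longrightarrow> \<exists>h\<in>\<D>. \<forall>y. \<bar>g y - h y\<bar> \<le> e"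
    by (rule lipschitz_functions_separable[OF K]) (rule that)
  have \<D>_meas: "g \<in> borel_measurable borel" "\<And>y. \<bar>g y\<bar> \<le> 1" if "g \<in> \<D>" for g
  proof -
    have "1-lipschitz_on UNIV g" "\<forall>y. \<bar>g y\<bar> \<le> 1" using that \<D>(2) by auto
    then show "g \<in> borel_measurable borel" "\<And>y. \<bar>g y\<bar> \<le> 1"
      by (auto intro!: borel_measurable_continuous_onI intro: lipschitz_on_continuous_on)
  qed
  define a b where "a x = enn2real (marginal_density m P x)" and "b x = enn2real (marginal_density m Q x)" for x
  \<comment> \<open>The integral of \<open>g\<close> against the restriction
    \<open>\<rho> x\<close>, written through the kernels so that it is visibly measurable in
    \<open>x\<close>.\<close>
  define u where "u g x = a x * (\<integral>z. g (snd z) \<partial>\<kappa>p x) - b x * (\<integral>z. g (snd z) \<partial>\<kappa>n x)" for g :: "'k \<Rightarrow> real" and x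
  have W: "W_norm (\<rho> x) = (SUP g\<in>\<D>. ennreal \<bar>u g x\<bar>)" if x: "x \<in> space m" for x
  proof -
    obtain M1 where M1: "finite_measure M1" "sets M1 = sets borel"
      "\<And>B. measure (restriction_pos m P \<kappa>p x) B = measure M1 B"
      "\<And>g :: 'k \<Rightarrow> real. g \<in> borel_measurable borel \<Longrightarrow> (\<integral>y. g y \<partial>M1) = a x * (\<integral>z. g (snd z) \<partial>\<kappa>p x)"
      unfolding a_def by (rule restriction_pos_eq[OF \<kappa>p x]) blast
    obtain M2 where M2: "finite_measure M2" "sets M2 = sets borel"
      "\<And>B. measure (restriction_pos m Q \<kappa>n x) B = measure M2 B"
      "\<And>g :: 'k \<Rightarrow> real. g \<in> borel_measurable borel \<Longrightarrow> (\<integral>y. g y \<partial>M2) = b x * (\<integral>z. g (snd z) \<partial>\<kappa>n x)"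
      unfolding b_def by (rule restriction_pos_eq[OF \<kappa>n x]) blast
    have "W_norm (\<rho> x) = W_norm (\<lambda>B. measure M1 B - measure M2 B)"
      by (simp add: \<rho>_def[abs_def] M1(3) M2(3))
    also have "\<dots> = (SUP g\<in>\<D>. ennreal \<bar>(\<integral>y. g y \<partial>M1) - (\<integral>y. g y \<partial>M2)\<bar>)"
      by (rule W_norm_measure_diff[OF M1(1) M2(1) M1(2) M2(2) \<D>(2,3)])
    also have "\<dots> = (SUP g\<in>\<D>. ennreal \<bar>u g x\<bar>)"
      using \<D>_meas(1) by (intro SUP_cong) (auto simp: u_def M1(4) M2(4))
    finally show ?thesis .
  qed
  \<comment> \<open>The measure \<open>\<kappa> x\<close> is carried by the fiber over
    \<open>x\<close>, where the indicator of \<open>B\<close> is constant and can be taken out of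
    the integral.\<close>
  have conc: "(\<integral>z. indicator B (fst z) * g (snd z) \<partial>\<kappa> x) = indicator B x * (\<integral>z. g (snd z) \<partial>\<kappa> x)"
    if dis: "disintegration m R \<kappa>" and x: "x \<in> space m" and [measurable]: "g \<in> borel_measurable borel" "B \<in> sets m"
    for R :: "((nat \<Rightarrow> 'n) \<times> 'k) measure" and \<kappa> x B and g :: "'k \<Rightarrow> real"
  proof -
    have \<kappa>x: "prob_space (\<kappa> x)" and sx[measurable_cong]: "sets (\<kappa> x) = sets ?T" and e1: "emeasure (\<kappa> x) ({x} \<times> UNIV) = 1"
      using dis x measurable_space[OF _ x, of \<kappa> "prob_algebra ?T"]
      by (auto simp: space_prob_algebra disintegration_def)
    interpret K: prob_space "\<kappa> x" by fact
    have [measurable]: "{x} \<in> sets m" by (rule m(2)[OF x])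
    have "{x} \<times> UNIV \<in> sets (\<kappa> x)" unfolding sx by measurable
    moreover have "measure (\<kappa> x) ({x} \<times> UNIV) = 1" using e1 by (simp add: measure_def)
    ultimately have "AE z in \<kappa> x. z \<in> {x} \<times> UNIV" by (subst K.AE_in_set_eq_1) auto
    then have "(\<integral>z. indicator B (fst z) * g (snd z) \<partial>\<kappa> x) = (\<integral>z. indicator B x * g (snd z) \<partial>\<kappa> x)"
      by (intro integral_cong_AE) (auto elim!: eventually_mono)
    then show ?thesis by simp
  qed
  have u_int: "integrable m (u g)" "\<And>B. B \<in> sets m \<Longrightarrow> \<bar>\<integral>x. indicator B x * u g x \<partial>m\<bar> \<le> C * measure m B"
    if g: "g \<in> \<D>" for g
  proof -
    have [measurable]: "g \<in> borel_measurable borel" by (rule \<D>_meas(1)[OF g])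
    have gm: "(\<lambda>z. g (snd z)) \<in> borel_measurable ?T" by measurable
    show i: "integrable m (u g)"
      unfolding u_def a_def b_def
      by (intro Bochner_Integration.integrable_diff
          integral_disintegration(1)[OF m(1) P acP \<kappa>p gm \<D>_meas(2)[OF g]]
          integral_disintegration(1)[OF m(1) Q acQ \<kappa>n gm \<D>_meas(2)[OF g]])
    fix B assume B[measurable]: "B \<in> sets m"
    let ?f = "\<lambda>z. indicator B (fst z) * g (snd z)"
    have fm: "?f \<in> borel_measurable ?T" by measurable
    have fb: "\<bar>?f z\<bar> \<le> 1" for z using \<D>_meas(2)[OF g, of "snd z"] by (auto simp: indicator_def)
    note dp = integral_disintegration[OF m(1) P acP \<kappa>p fm fb] and dn = integral_disintegration[OF m(1) Q acQ \<kappa>n fm fb]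
    have "(\<integral>x. indicator B x * u g x \<partial>m) = (\<integral>x. a x * (\<integral>z. ?f z \<partial>\<kappa>p x) - b x * (\<integral>z. ?f z \<partial>\<kappa>n x) \<partial>m)"
      by (intro Bochner_Integration.integral_cong refl) (simp add: u_def conc[OF \<kappa>p] conc[OF \<kappa>n] right_diff_distrib mult.left_commute[of "indicator B _"])
    also have "\<dots> = (\<integral>z. ?f z \<partial>P) - (\<integral>z. ?f z \<partial>Q)"
      unfolding dp(2) dn(2) a_def b_def by (rule Bochner_Integration.integral_diff[OF dp(1) dn(1)])
    also have "\<dots> = (\<integral>z. ?f z \<partial>\<mu>') - (\<integral>z. ?f z \<partial>\<mu>)"
      by (rule integral_measure_diff_cong[OF P(1) Q(1) \<mu>'(1) \<mu>(1) P(2) Q(2) \<mu>'(2) \<mu>(2) PQ_eq fm fb])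
    finally show "\<bar>\<integral>x. indicator B x * u g x \<partial>m\<bar> \<le> C * measure m B"
      using C'[OF B] g \<D>(2) by auto
  qed
  have AE_u: "AE x in m. \<bar>u g x\<bar> \<le> C" if g: "g \<in> \<D>" for g
  proof -
    have 1: "AE x in m. u g x \<le> C"
      using u_int(2)[OF g] by (intro AE_le_of_integral_le u_int(1)[OF g] m.finite_measure_axioms) (simp add: abs_le_iff)
    have 2: "AE x in m. - u g x \<le> C"
    proof (intro AE_le_of_integral_le m.finite_measure_axioms)
      show "integrable m (\<lambda>x. - u g x)" using u_int(1)[OF g] by simp
      show "(\<integral>x. indicator B x * - u g x \<partial>m) \<le> C * measure m B" if "B \<in> sets m" for B
        using u_int(2)[OF g that] by (simp add: abs_le_iff)
    qed
    from 1 2 show ?thesis by eventually_elim (simp add: abs_le_iff)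
  qed
  have "esssup m (\<lambda>x. W_norm (\<rho> x)) \<le> ennreal C"
  proof (rule esssup_I)
    have "(\<lambda>x. SUP g\<in>\<D>. ennreal \<bar>u g x\<bar>) \<in> borel_measurable m"
      using \<D>(1) u_int(1) by (intro borel_measurable_SUP) auto
    then show "(\<lambda>x. W_norm (\<rho> x)) \<in> borel_measurable m"
      by (rule measurable_cong[THEN iffD2, rotated]) (rule W)
    have "AE x in m. \<forall>g\<in>\<D>. \<bar>u g x\<bar> \<le> C"
      using AE_u \<D>(1) by (subst AE_ball_countable) auto
    then show "AE x in m. W_norm (\<rho> x) \<le> ennreal C"
      using AE_space by eventually_elim (auto simp: W intro!: SUP_least ennreal_leI)
  qed
  then show ?thesis unfolding norm_inf_def using \<rho> by (rule INF_lower2[rotated])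
qed

section \<open>The perturbation estimate\<close>

text \<open>A point is the intersection of its cylinders. Measurable singletons make the fibers
  measurable, on which a disintegration is required to be concentrated.\<close>

lemma markov_measure_singleton_sets:
  assumes m: "markov_measure A p m" and x: "x \<in> space m"
  shows "{x} \<in> sets m"
proof -
  have "space m = shift_space A"
    by (rule space_markov_measure[OF m])
  then have "{x} = (\<Inter>l. {y \<in> shift_space A. \<forall>t\<le>l. y (0 + t) = x t})"
    using x by auto
  also have "\<dots> \<in> sets m"
    by (intro sets.countable_INT' image_subsetI markov_measure_cylinder_shift(1)[OF m]) auto
  finally show ?thesis .
qed

text \<open>A positive measure is its own positive part, so membership in \<open>S_inf\<close> gives
  its marginal a Lipschitz density. The projection intertwines the skew product with the shift,
  hence the marginal is shift-invariant and the uniqueness of invariant densities applies.\<close>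

lemma skew_invariant_marginal:
  fixes A :: "nat^'n^'n" and \<mu> :: "((nat \<Rightarrow> 'n) \<times> 'k::metric_space) measure"
  assumes \<theta>: "0 < \<theta>" "\<theta> < 1"
    and A: "transition_matrix A" "aperiodic A" and m: "markov_measure A p m"
    and s[measurable]: "s \<in> m \<rightarrow>\<^sub>M m" "\<And>x. x \<in> shift_space A \<Longrightarrow> s x = shift x"
    and G[measurable]: "G \<in> total_alg m \<rightarrow>\<^sub>M borel"
    and \<mu>: "\<mu> \<in> invariant_probs \<theta> A m (skew s G)"
  shows "distr \<mu> m fst = m"
proof -
  interpret m: prob_space m using m by (simp add: markov_measure_def)
  let ?T = "total_alg m :: ((nat \<Rightarrow> 'n) \<times> 'k) measure"
  have "prob_space \<mu>" and sets_\<mu>[measurable_cong]: "sets \<mu> = sets ?T" and inv: "distr \<mu> ?T (skew s G) = \<mu>"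
    and S: "measure \<mu> \<in> S_inf \<theta> A m"
    using \<mu> by (auto simp: invariant_probs_def)
  interpret \<mu>: prob_space \<mu> by fact
  have space_m: "space m = shift_space A"
    by (rule space_markov_measure[OF m])
  have fin0: "finite_measure (null_measure N)" for N :: "'z measure" by (rule finite_measureI) simp
  have J: "jordan_decomposition ?T (measure \<mu>) \<mu> (null_measure ?T)"
    unfolding jordan_decomposition_def using \<mu>.finite_measure_axioms
    by (auto simp: sets_\<mu> fin0 intro!: bexI[of _ "space ?T"])
  have ac: "absolutely_continuous m (distr \<mu> m fst)"
    using S by (simp add: S_inf_def L_inf_def AB_def jordan_pos_eq[OF J])
  obtain f where f: "f \<in> F_theta \<theta> A" and f_eq: "AE x in m. signed_marginal_density m (measure \<mu>) x = f x"
    using S by (auto simp: S_inf_def)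
  \<comment> \<open>The signed density subtracts that of the negative part, here the null measure; a
    Radon-Nikodym derivative is 0 there only almost everywhere.\<close>
  have null: "distr (null_measure ?T) m fst = null_measure m"
    by (rule measure_eqI) (auto simp: emeasure_distr)
  have "AE x in m. 0 = RN_deriv m (null_measure m) x"
    by (rule m.RN_deriv_unique) (auto intro!: measure_eqI simp: emeasure_density)
  then have "AE x in m. enn2real (RN_deriv m (distr \<mu> m fst) x) = f x"
    using f_eq
    by eventually_elim
      (simp add: signed_marginal_density_def jordan_pos_eq[OF J] jordan_neg_eq[OF J] marginal_density_def null)
  moreover have "measure (distr \<mu> m fst) {x \<in> space m. shift x \<in> B} = measure (distr \<mu> m fst) B"
    if B[measurable]: "B \<in> sets m" for B
  proof -
    have F: "skew s G \<in> ?T \<rightarrow>\<^sub>M ?T" unfolding skew_def by measurable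
    then have F': "skew s G \<in> \<mu> \<rightarrow>\<^sub>M ?T" by measurable
    have sp: "space \<mu> = space m \<times> UNIV" using sets_eq_imp_space_eq[OF sets_\<mu>] by (simp add: space_pair_measure)
    have "{x \<in> space m. s x \<in> B} \<in> sets m" by measurable
    moreover have s': "{x \<in> space m. shift x \<in> B} = {x \<in> space m. s x \<in> B}" using s(2) space_m by auto
    ultimately have "measure (distr \<mu> m fst) {x \<in> space m. shift x \<in> B} = measure \<mu> (fst -` {x \<in> space m. s x \<in> B} \<inter> space \<mu>)"
      by (simp add: measure_distr)
    also have "fst -` {x \<in> space m. s x \<in> B} \<inter> space \<mu> = skew s G -` (fst -` B \<inter> space ?T) \<inter> space \<mu>"
      using measurable_space[OF s(1)] by (auto simp: skew_def sp space_pair_measure)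
    also have "measure \<mu> \<dots> = measure (distr \<mu> ?T (skew s G)) (fst -` B \<inter> space ?T)"
      by (rule measure_distr[OF F', symmetric]) measurable
    also have "\<dots> = measure (distr \<mu> m fst) B"
      unfolding inv by (simp add: measure_distr sets_eq_imp_space_eq[OF sets_\<mu>])
    finally show ?thesis .
  qed
  ultimately show ?thesis
    using markov_measure_unique_invariant_density[OF \<theta> A m _ _ ac f]
    by (simp add: \<mu>.prob_space_distr)
qed

theorem theorem1:
  fixes A :: "nat^'n^'n"
    and \<theta> \<delta>1 :: real
    and m :: "(nat \<Rightarrow> 'n) measure"
    and sg :: "real \<Rightarrow> (nat \<Rightarrow> 'n) \<Rightarrow> nat \<Rightarrow> 'n"
    and G :: "real \<Rightarrow> (nat \<Rightarrow> 'n) \<times> 'k::{metric_space, second_countable_topology} \<Rightarrow> 'k"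
    and k :: "real \<Rightarrow> 'k \<Rightarrow> real"
    and ms :: "real \<Rightarrow> (nat \<Rightarrow> 'n) measure"
    and p :: "real \<Rightarrow> real^'n"
    and J :: "real \<Rightarrow> (nat \<Rightarrow> 'n) \<Rightarrow> real"
    and R :: "real \<Rightarrow> real"
    and \<mu> :: "real \<Rightarrow> ((nat \<Rightarrow> 'n) \<times> 'k) measure"
  assumes "transition_matrix A" and "aperiodic A"
    and "0 < \<theta>" and "\<theta> < 1"
    and "markov_measure A (p 0) m"
    and "compact (UNIV :: 'k set)" and "diameter (UNIV :: 'k set) = 1"
    and "0 < \<delta>1" and "\<delta>1 \<le> 1"
    and "admissible_perturbation \<theta> A m sg G k \<delta>1 ms p J R"
    and "A1 \<theta> A \<delta>1 (\<lambda>\<delta> x. 1 / J \<delta> x)"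
    and "A2 \<theta> A \<delta>1 k (\<lambda>\<delta> x. 1 / J \<delta> x)"
    and "\<forall>\<delta>\<in>{0..<\<delta>1}. \<mu> \<delta> \<in> invariant_probs \<theta> A m (skew (sg \<delta>) (G \<delta>))"
  shows "\<exists>D2 \<delta>'. D2 < 0 \<and> 0 < \<delta>' \<and> \<delta>' < 1 \<and> \<delta>' \<le> \<delta>1 \<and>
    (\<forall>\<delta>\<in>{0..<\<delta>'}.
       norm_inf m (\<lambda>E. measure (\<mu> \<delta>) E - measure (\<mu> 0) E) \<le>
       ennreal (if \<delta> = 0 then 0 else D2 * R \<delta> * ln \<delta>))"
proof -
  note m = assms(5)
  interpret m: prob_space m using m by (simp add: markov_measure_def)
  let ?T = "total_alg m :: ((nat \<Rightarrow> 'n) \<times> 'k) measure"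
  have space_m: "space m = shift_space A"
    by (rule space_markov_measure[OF m])
  have sg: "sg \<delta> \<in> m \<rightarrow>\<^sub>M m" "\<And>x. x \<in> shift_space A \<Longrightarrow> sg \<delta> x = shift x" and G: "G \<delta> \<in> ?T \<rightarrow>\<^sub>M borel"
    if "\<delta> \<in> {0..<\<delta>1}" for \<delta>
  proof -
    have "\<delta> \<in> {0..<1}" using that assms(9) by auto
    then show "sg \<delta> \<in> m \<rightarrow>\<^sub>M m" "G \<delta> \<in> ?T \<rightarrow>\<^sub>M borel"
      using assms(10) unfolding admissible_perturbation_def by blast+
    show "sg \<delta> x = shift x" if "x \<in> shift_space A" for x
      using assms(10) that \<open>\<delta> \<in> {0..<\<delta>1}\<close> unfolding admissible_perturbation_def U1_def
      by (cases "\<delta> = 0") auto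
  qed
  have R: "0 \<le> R \<delta>" "\<And>x y. x \<in> shift_space A \<Longrightarrow> dist (G 0 (x, y)) (G \<delta> (x, y)) \<le> R \<delta>"
    if "\<delta> \<in> {0<..<\<delta>1}" for \<delta>
    using that assms(10) unfolding admissible_perturbation_def U2_def by auto
  have "G1 m (G 0)" using assms(10) unfolding admissible_perturbation_def by simp
  then obtain \<alpha> where \<alpha>: "0 < \<alpha>" "\<alpha> < 1"
    and contr: "AE x in m. \<forall>y1 y2. dist (G 0 (x, y1)) (G 0 (x, y2)) \<le> \<alpha> * dist y1 y2"
    unfolding G1_def by blast
  have diam: "dist y1 y2 \<le> 1" for y1 y2 :: 'k
    using diameter_bounded_bound[OF compact_imp_bounded[OF assms(6)], of y1 y2] assms(7) by simp
  have \<delta>0: "0 \<in> {0..<\<delta>1}" using assms(8) by simp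
  have \<mu>: "prob_space (\<mu> \<delta>)" "sets (\<mu> \<delta>) = sets ?T" "distr (\<mu> \<delta>) m fst = m"
    "distr (\<mu> \<delta>) ?T (\<lambda>(x, y). (sg 0 x, G \<delta> (x, y))) = \<mu> \<delta>" if \<delta>: "\<delta> \<in> {0..<\<delta>1}" for \<delta>
  proof -
    have inv: "\<mu> \<delta> \<in> invariant_probs \<theta> A m (skew (sg \<delta>) (G \<delta>))" using assms(13) \<delta> by blast
    then show "prob_space (\<mu> \<delta>)" and s: "sets (\<mu> \<delta>) = sets ?T" by (auto simp: invariant_probs_def)
    show "distr (\<mu> \<delta>) m fst = m"
      by (rule skew_invariant_marginal[OF assms(3,4,1,2) m sg[OF \<delta>] G[OF \<delta>] inv])
    have "distr (\<mu> \<delta>) ?T (\<lambda>(x, y). (sg 0 x, G \<delta> (x, y))) = distr (\<mu> \<delta>) ?T (skew (sg \<delta>) (G \<delta>))"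
      using sets_eq_imp_space_eq[OF s] sg(2)[OF \<delta>] sg(2)[OF \<delta>0]
      by (intro distr_cong) (auto simp: skew_def space_pair_measure space_m)
    then show "distr (\<mu> \<delta>) ?T (\<lambda>(x, y). (sg 0 x, G \<delta> (x, y))) = \<mu> \<delta>"
      using inv by (simp add: invariant_probs_def)
  qed
  \<comment> \<open>Shift invariance of \<open>m\<close> on all measurable sets is read off from
    \<open>\<mu> 0\<close>, an invariant measure projecting to \<open>m\<close>.\<close>
  have sg_inv: "distr m m (sg 0) = m"
  proof -
    note [measurable] = sg(1)[OF \<delta>0] G[OF \<delta>0] and [measurable_cong] = \<mu>(2)[OF \<delta>0]
    have "distr m m (sg 0) = distr (distr (\<mu> 0) m fst) m (sg 0)" by (simp add: \<mu>(3)[OF \<delta>0])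
    also have "\<dots> = distr (\<mu> 0) m (\<lambda>z. sg 0 (fst z))" by (subst distr_distr) (auto simp: comp_def)
    also have "\<dots> = distr (distr (\<mu> 0) ?T (\<lambda>(x, y). (sg 0 x, G 0 (x, y)))) m fst"
      by (subst distr_distr) (auto simp: comp_def case_prod_beta)
    also have "\<dots> = m" by (simp add: \<mu>(3,4)[OF \<delta>0])
    finally show ?thesis .
  qed
  \<comment> \<open>A general \<open>r\<close> treats \<open>\<delta> = 0\<close> together with the
    other parameters: there \<open>r = 0\<close> is used, as the conditions on \<open>R\<close>
    concern positive \<open>\<delta>\<close> only.\<close>
  have main: "norm_inf m (\<lambda>E. measure (\<mu> \<delta>) E - measure (\<mu> 0) E) \<le> ennreal (r / (1 - \<alpha>))"
    if \<delta>: "\<delta> \<in> {0..<\<delta>1}" and r: "0 \<le> r" "\<And>x y. x \<in> space m \<Longrightarrow> dist (G 0 (x, y)) (G \<delta> (x, y)) \<le> r" for \<delta> r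
  proof (rule norm_inf_measure_diff_le[OF assms(6) m.prob_space_axioms markov_measure_singleton_sets[OF m]])
    show "finite_measure (\<mu> 0)" "finite_measure (\<mu> \<delta>)"
      using \<mu>(1)[OF \<delta>] \<mu>(1)[OF \<delta>0] by (simp_all add: prob_space_def)
    fix B and g :: "'k \<Rightarrow> real"
    assume B[measurable]: "B \<in> sets m" and g: "1-lipschitz_on UNIV g" "\<forall>y. \<bar>g y\<bar> \<le> 1"
    have [measurable]: "g \<in> borel_measurable borel"
      using g(1) by (intro borel_measurable_continuous_onI lipschitz_on_continuous_on)
    \<comment> \<open>The weight \<open>w\<close> is the indicator of \<open>B\<close>, since
      \<open>g\<close> is 1-Lipschitz on fibers over \<open>B\<close> and the product vanishes
      elsewhere; its integral is \<open>measure m B\<close>.\<close>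
    have "\<bar>(\<integral>z. indicator B (fst z) * g (snd z) \<partial>\<mu> \<delta>) - (\<integral>z. indicator B (fst z) * g (snd z) \<partial>\<mu> 0)\<bar>
      \<le> r / (1 - \<alpha>) * (\<integral>x. indicator B x \<partial>m)"
    proof (rule skew_invariant_duality_contraction[OF m.prob_space_axioms sg(1)[OF \<delta>0] sg_inv \<mu>[OF \<delta>0] \<mu>[OF \<delta>]
          G[OF \<delta>0] G[OF \<delta>] contr \<alpha> r(2,1) diam, where b=1])
      show "AE x in m. \<forall>y1 y2. \<bar>indicator B (fst (x, y1)) * g (snd (x, y1)) - indicator B (fst (x, y2)) * g (snd (x, y2))\<bar>
          \<le> indicator B x * dist y1 y2"
        using lipschitz_onD[OF g(1)] by (auto simp: indicator_def dist_real_def)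
    qed (use g(2) in \<open>auto simp: indicator_def\<close>)
    then show "\<bar>(\<integral>z. indicator B (fst z) * g (snd z) \<partial>\<mu> \<delta>) - (\<integral>z. indicator B (fst z) * g (snd z) \<partial>\<mu> 0)\<bar>
      \<le> r / (1 - \<alpha>) * measure m B" by simp
  qed (use \<mu>[OF \<delta>0] \<mu>[OF \<delta>] in auto)
  \<comment> \<open>Below \<open>exp (- 1)\<close> the factor \<open>- ln \<delta>\<close> is at
    least 1 and can be inserted into the bound, so \<open>D2 = - 1 / (1 - \<alpha>)\<close> is a
    valid constant.\<close>
  define \<delta>' where "\<delta>' = min \<delta>1 (exp (- 1))"
  have "norm_inf m (\<lambda>E. measure (\<mu> \<delta>) E - measure (\<mu> 0) E)
      \<le> ennreal (if \<delta> = 0 then 0 else - 1 / (1 - \<alpha>) * R \<delta> * ln \<delta>)" if \<delta>: "\<delta> \<in> {0..<\<delta>'}" for \<delta>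
  proof (cases "\<delta> = 0")
    case True
    then show ?thesis using main[OF \<delta>0, of 0] by simp
  next
    case False
    then have d: "\<delta> \<in> {0<..<\<delta>1}" "0 < \<delta>" "\<delta> < exp (- 1)" using \<delta> by (auto simp: \<delta>'_def)
    have "norm_inf m (\<lambda>E. measure (\<mu> \<delta>) E - measure (\<mu> 0) E) \<le> ennreal (R \<delta> / (1 - \<alpha>))"
      using d(1) R[OF d(1)] by (intro main) (auto simp: space_m)
    also have "R \<delta> / (1 - \<alpha>) \<le> - 1 / (1 - \<alpha>) * R \<delta> * ln \<delta>"
    proof -
      have "ln \<delta> \<le> ln (exp (- 1))" using d by (subst ln_le_cancel_iff) auto
      then have "R \<delta> / (1 - \<alpha>) * 1 \<le> R \<delta> / (1 - \<alpha>) * - ln \<delta>"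
        using R(1)[OF d(1)] \<alpha> by (intro mult_left_mono) auto
      then show ?thesis by simp
    qed
    finally show ?thesis using False by (simp add: ennreal_leI)
  qed
  moreover have "- 1 / (1 - \<alpha>) < 0" "0 < \<delta>'" "\<delta>' < 1" "\<delta>' \<le> \<delta>1"
    using \<alpha> assms(8) by (auto simp: \<delta>'_def min_less_iff_disj)
  ultimately show ?thesis by blast
qed

end
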